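(* Let $D$ be an almost Dedekind domain, let $\Theta:=\{D_M\mid M\in\mathrm{Max}(D)\}$, let $\{T_\alpha\}$ be the derived sequence of $\Theta$ with associated sets $\mathcal{N}^\alpha(\Theta)$ (identified with subsets of $\mathrm{Max}(D)$ via $D_M\leftrightarrow M$), and fix an ordinal $\alpha$. If $\mathrm{Int}(D)D_M=\mathrm{Int}(D_M)$ for every $M\notin\mathcal{N}^\alpha(\Theta)$, and $\mathrm{Int}(D)T_\alpha=\mathrm{Int}(T_\alpha)$, then there is an exact sequence $$0\longrightarrow\bigoplus_{M\notin\mathcal{N}^\alpha(\Theta)}\mathrm{Pic}(\mathrm{Int}(D_M))\longrightarrow\mathrm{Pic}_{\mathrm{Int}}(D)\longrightarrow\mathrm{Pic}_{\mathrm{Int}}(T_\alpha)\longrightarrow 0.$$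
   Context: An almost Dedekind domain is an integral domain all of whose localizations at maximal ideals are discrete valuation rings; $\Theta=\{D_M\}$ is then a pre-Jaffard family of $D$. $K$ is the quotient field of $D$; for a domain $A$ with quotient field $K$, $\mathrm{Int}(A)=\{f\in K[X]\mid f(A)\subseteq A\}$, $\mathrm{Pic}(A)$ is the group of invertible fractional ideals modulo principal ones, and $\mathrm{Pic}_{\mathrm{Int}}(A):=\mathrm{Pic}(\mathrm{Int}(A))/\iota_A(\mathrm{Pic}(A))$ with $\iota_A([I])=[I\,\mathrm{Int}(A)]$. For a flat overring $T$, $\mathrm{Int}(D)T$ is the subring of $K[X]$ of finite sums $\sum f_it_i$. A family $\Theta$ of overrings of a domain $R$ (quotient field $K$) is a pre-Jaffard family of $R$ if: $\Theta=\{K\}$ or $K\notin\Theta$; every member is flat over $R$; complete (every ideal $I$ of $R$ equals $\bigcap_{T\in\Theta}IT$); independent ($TT'=K$ for distinct members); compact in the Zariski topology on overrings (subbasic opens $\{T\mid x_1,\dots,x_n\in T\}$). A Jaffard family is a locally finite pre-Jaffard family (each nonzero $x\in R$ is a nonunit in only finitely many members); a Jaffard overring of $R$ is a member of some Jaffard family of $R$. Derived sequence: $\mathcal{N}^0(\Theta)=\Theta$; $T_\alpha:=\bigcap_{T\in\mathcal{N}^\alpha(\Theta)}T$ (empty intersection $=K$); $\mathcal{N}^{\gamma+1}(\Theta)$ is the set of elements of $\mathcal{N}^\gamma(\Theta)$ that are not Jaffard overrings of $T_\gamma$; for limit $\alpha$, $\mathcal{N}^\alpha(\Theta)=\bigcap_{\beta<\alpha}\mathcal{N}^\beta(\Theta)$.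 *)

theory Defs
  imports "HOL-Analysis.Abstract_Topology" "HOL-Algebra.Product_Groups"
    "HOL-Computational_Algebra.Polynomial" "HOL-Computational_Algebra.Fraction_Field"
begin

text \<open>A domain with quotient field K is modelled as a subring of a field type 'f
  every element of which is a quotient of elements of the subring.\<close>

definition is_subring :: "'f::field set \<Rightarrow> bool" where
  "is_subring A \<longleftrightarrow> 0 \<in> A \<and> 1 \<in> A \<and>
     (\<forall>x\<in>A. \<forall>y\<in>A. x + y \<in> A \<and> x * y \<in> A) \<and> (\<forall>x\<in>A. - x \<in> A)"

definition has_qf :: "'f::field set \<Rightarrow> bool" where
  "has_qf A \<longleftrightarrow> (\<forall>z. \<exists>a\<in>A. \<exists>b\<in>A. b \<noteq> 0 \<and> z = a / b)"

definition submod :: "'f::field set \<Rightarrow> 'f set \<Rightarrow> bool" where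
  "submod A I \<longleftrightarrow> 0 \<in> I \<and> (\<forall>x\<in>I. \<forall>y\<in>I. x + y \<in> I) \<and> (\<forall>a\<in>A. \<forall>x\<in>I. a * x \<in> I)"

definition ideal_in :: "'f::field set \<Rightarrow> 'f set \<Rightarrow> bool" where
  "ideal_in A I \<longleftrightarrow> I \<subseteq> A \<and> submod A I"

definition max_ideals :: "'f::field set \<Rightarrow> 'f set set" where
  "max_ideals A = {M. ideal_in A M \<and> M \<noteq> A \<and>
      (\<forall>J. ideal_in A J \<and> M \<subseteq> J \<longrightarrow> J = M \<or> J = A)}"

definition localization :: "'f::field set \<Rightarrow> 'f set \<Rightarrow> 'f set" where
  "localization A M = {a / b | a b. a \<in> A \<and> b \<in> A \<and> b \<notin> M}"

definition is_DVR :: "'f::field set \<Rightarrow> bool" where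
  "is_DVR V \<longleftrightarrow> (\<exists>v :: 'f \<Rightarrow> int.
      (\<forall>x y. x \<noteq> 0 \<longrightarrow> y \<noteq> 0 \<longrightarrow> v (x * y) = v x + v y) \<and>
      (\<forall>x y. x \<noteq> 0 \<longrightarrow> y \<noteq> 0 \<longrightarrow> x + y \<noteq> 0 \<longrightarrow> min (v x) (v y) \<le> v (x + y)) \<and>
      v ` (UNIV - {0}) = UNIV \<and>
      V = {x. x = 0 \<or> 0 \<le> v x})"

definition almost_dedekind :: "'f::field set \<Rightarrow> bool" where
  "almost_dedekind D \<longleftrightarrow> is_subring D \<and> has_qf D \<and>
     (\<forall>M\<in>max_ideals D. is_DVR (localization D M))"

definition fsums :: "'f::field set \<Rightarrow> 'f set" where
  "fsums S = {sum_list xs | xs. set xs \<subseteq> S}"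

definition setprod :: "'f::field set \<Rightarrow> 'f set \<Rightarrow> 'f set" where
  "setprod A B = {a * b | a b. a \<in> A \<and> b \<in> B}"

definition ext :: "'f::field set \<Rightarrow> 'f set \<Rightarrow> 'f set" where
  "ext I T = fsums (setprod I T)"

definition overrings :: "'f::field set \<Rightarrow> 'f set set" where
  "overrings R = {T. is_subring T \<and> R \<subseteq> T}"

text \<open>Flatness of an overring T over R, via the equational criterion of flatness
  (T viewed as an R-module).\<close>
definition flat_over :: "'f::field set \<Rightarrow> 'f set \<Rightarrow> bool" where
  "flat_over R T \<longleftrightarrow>
    (\<forall>(n::nat) (r::nat \<Rightarrow> 'f) (t::nat \<Rightarrow> 'f).
       (\<forall>i<n. r i \<in> R \<and> t i \<in> T) \<and> (\<Sum>i<n. r i * t i) = 0 \<longrightarrow>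
       (\<exists>(m::nat) (a::nat \<Rightarrow> nat \<Rightarrow> 'f) (s::nat \<Rightarrow> 'f).
          (\<forall>i<n. \<forall>j<m. a i j \<in> R) \<and> (\<forall>j<m. s j \<in> T) \<and>
          (\<forall>i<n. t i = (\<Sum>j<m. a i j * s j)) \<and>
          (\<forall>j<m. (\<Sum>i<n. r i * a i j) = 0)))"

definition zariski :: "'f::field set \<Rightarrow> 'f set topology" where
  "zariski R = topology_generated_by {{T \<in> overrings R. F \<subseteq> T} | F. finite F}"

definition pre_jaffard :: "'f::field set \<Rightarrow> 'f set set \<Rightarrow> bool" where
  "pre_jaffard R \<Theta> \<longleftrightarrow>
     \<Theta> \<subseteq> overrings R \<and>
     (\<Theta> = {UNIV} \<or> UNIV \<notin> \<Theta>) \<and>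
     (\<forall>T\<in>\<Theta>. flat_over R T) \<and>
     (\<forall>I. ideal_in R I \<longrightarrow> I = (\<Inter>T\<in>\<Theta>. ext I T)) \<and>
     (\<forall>T\<in>\<Theta>. \<forall>T'\<in>\<Theta>. T \<noteq> T' \<longrightarrow> fsums (setprod T T') = UNIV) \<and>
     compactin (zariski R) \<Theta>"

definition locally_finite :: "'f::field set \<Rightarrow> 'f set set \<Rightarrow> bool" where
  "locally_finite R \<Theta> \<longleftrightarrow>
     (\<forall>x\<in>R. x \<noteq> 0 \<longrightarrow> finite {T\<in>\<Theta>. inverse x \<notin> T})"

definition jaffard_family :: "'f::field set \<Rightarrow> 'f set set \<Rightarrow> bool" where
  "jaffard_family R \<Theta> \<longleftrightarrow> pre_jaffard R \<Theta> \<and> locally_finite R \<Theta>"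

definition jaffard_overring :: "'f::field set \<Rightarrow> 'f set \<Rightarrow> bool" where
  "jaffard_overring R T \<longleftrightarrow> (\<exists>\<Theta>. jaffard_family R \<Theta> \<and> T \<in> \<Theta>)"

definition derived :: "'f::field set set \<Rightarrow> 'o::wellorder \<Rightarrow> 'f set set" where
  "derived \<Theta> = wfrec {(x, y). x < y} (\<lambda>N \<alpha>.
     if (\<forall>\<beta>. \<not> \<beta> < \<alpha>) then \<Theta>
     else if (\<exists>\<beta>. \<beta> < \<alpha> \<and> (\<forall>\<gamma>. \<not> (\<beta> < \<gamma> \<and> \<gamma> < \<alpha>))) then
       (let \<beta> = (THE \<beta>. \<beta> < \<alpha> \<and> (\<forall>\<gamma>. \<not> (\<beta> < \<gamma> \<and> \<gamma> < \<alpha>)))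
        in {T \<in> N \<beta>. \<not> jaffard_overring (\<Inter> (N \<beta>)) T})
     else (\<Inter>\<beta>\<in>{\<beta>. \<beta> < \<alpha>}. N \<beta>))"

text \<open>T_alpha; the empty intersection is UNIV, i.e. the quotient field K.\<close>
definition derived_ring :: "'f::field set set \<Rightarrow> 'o::wellorder \<Rightarrow> 'f set" where
  "derived_ring \<Theta> \<alpha> = \<Inter> (derived \<Theta> \<alpha>)"

definition intpoly :: "'a::field set \<Rightarrow> 'a poly set" where
  "intpoly A = {f. \<forall>a\<in>A. poly f a \<in> A}"

definition intpoly_ext :: "'a::field set \<Rightarrow> 'a set \<Rightarrow> 'a poly set" where
  "intpoly_ext D T = {sum_list xs | xs. set xs \<subseteq> {smult t f | t f. t \<in> T \<and> f \<in> intpoly D}}"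

definition invertible_ideals :: "'f::field set \<Rightarrow> 'f set set" where
  "invertible_ideals A = {I. submod A I \<and> (\<exists>J. submod A J \<and> fsums (setprod I J) = A)}"

definition pic_class :: "'f::field set \<Rightarrow> 'f set \<Rightarrow> 'f set set" where
  "pic_class A I = {J \<in> invertible_ideals A. \<exists>x. x \<noteq> 0 \<and> J = (\<lambda>y. x * y) ` I}"

text \<open>Pic(A) for a subring A of the field 'f whose quotient field is 'f.\<close>
definition Pic :: "'f::field set \<Rightarrow> 'f set set monoid" where
  "Pic A = \<lparr> carrier = pic_class A ` invertible_ideals A,
             monoid.mult = (\<lambda>X Y. {fsums (setprod I J) | I J. I \<in> X \<and> J \<in> Y}),
             one = pic_class A A \<rparr>"

definition IntK :: "'a::field set \<Rightarrow> 'a poly fract set" where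
  "IntK A = (\<lambda>p. Fract p 1) ` intpoly A"

definition const_fract :: "'a::field \<Rightarrow> 'a poly fract" where
  "const_fract a = Fract [:a:] 1"

definition iota_image :: "'a::field set \<Rightarrow> 'a poly fract set set set" where
  "iota_image A = {pic_class (IntK A) (ext (const_fract ` I) (IntK A)) | I. I \<in> invertible_ideals A}"

definition PicInt :: "'a::field set \<Rightarrow> 'a poly fract set set set monoid" where
  "PicInt A = Pic (IntK A) Mod iota_image A"

end

(* Up to a factor in K(X), an invertible ideal of Int(A) lies in K[X] and generates K[X]; this makes
   Pic_Int(A) the group of invertible Int(A)-submodules of K[X] modulo those extended from A. Such an
   ideal F of Int(D) is determined by its value functions a |-> v_M(F(a)) on D, one for every maximal
   ideal M, and its class in Pic_Int(D) vanishes iff all of them are constant.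

   If D_M is removed from the sequence at stage c, then some z in K has v_M(z) = -1 and is integral at
   every other element of N^c(Theta). If moreover the residue field at M is finite, a polynomial e of
   Int(D) that is 1 mod M on a ball p + M^n and 0 mod M off it, together with the ideal (1, z)^(-1),
   gives an invertible ideal whose value function at M is the indicator of the ball and which is trivial
   at the other elements of N^c(Theta). Locally constant functions are combinations of such indicators
   with coefficients that are additive in the function, so one obtains homomorphisms
   Pic(Int(D_M)) -> Pic_Int(D), and f is their sum. For infinite residue fields the value functions are
   constant and Pic(Int(D_M)) vanishes. Injectivity of f is seen at a factor removed last; that its
   image is the whole kernel follows by transfinite induction, since ideals with constant value
   functions on N^c(Theta) have them wherever a finite subset of T_c is integral. *)
theory Submission
  imports Defs "HOL-Algebra.Free_Abelian_Groups"
begin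

section \<open>Groups of invertible modules\<close>

text \<open>Localization maps Pic_Int(D) to each Pic(Int(D_M)), but the sequence asks for maps in
  the opposite direction, and a lift from M is under control only on the stage from which M is
  removed: at maximal ideals removed earlier its value function is unknown. So f is not diagonal
  with respect to the localizations but triangular with respect to the stages, and this dictates
  both the choice of the factor tested for injectivity and the direction of the induction for the
  kernel. The hypotheses turn integrality of values into membership up to a denominator: a
  polynomial integral on N^beta(Theta) lies in the localization of Int(D) at each M there, by way of
  D_M if M is outside N^alpha(Theta) and by way of T_alpha otherwise. Such a membership uses
  finitely many elements of T_beta, and invertible ideals have finitely many generators; this is why
  conditions on a stage spread to all M at which a finite set is integral. Every passage from local
  to global examines an ideal of multipliers in an overring and shows, with
  \<open>overring_max\<close>, that it contains 1.\<close>

definition add_closed :: "'r::comm_ring_1 set \<Rightarrow> bool" where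
  "add_closed K \<longleftrightarrow> 0 \<in> K \<and> (\<forall>x\<in>K. \<forall>y\<in>K. x + y \<in> K)"

text \<open>Finite sums, set up for commutative rings because the modules live in K[X] as well as in
  the fields to which \<open>fsums\<close> applies; the inductive form gives an induction over the
  summands.\<close>

inductive_set addhull :: "'r::comm_ring_1 set \<Rightarrow> 'r set" for S where
  addhull_zero: "0 \<in> addhull S"
| addhull_add: "a \<in> S \<Longrightarrow> b \<in> addhull S \<Longrightarrow> a + b \<in> addhull S"

definition mprod :: "'r::comm_ring_1 set \<Rightarrow> 'r set \<Rightarrow> 'r set" where
  "mprod I J = addhull {a * b | a b. a \<in> I \<and> b \<in> J}"

definition sring :: "'r::comm_ring_1 set \<Rightarrow> bool" where
  "sring A \<longleftrightarrow> add_closed A \<and> 1 \<in> A \<and> (\<forall>x\<in>A. \<forall>y\<in>A. x * y \<in> A) \<and> (\<forall>x\<in>A. - x \<in> A)"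

definition smod :: "'r::comm_ring_1 set \<Rightarrow> 'r set \<Rightarrow> bool" where
  "smod A I \<longleftrightarrow> add_closed I \<and> (\<forall>a\<in>A. \<forall>x\<in>I. a * x \<in> I)"

lemma addhull_base: "a \<in> S \<Longrightarrow> a \<in> addhull S"
  using addhull_add[OF _ addhull_zero] by fastforce

lemma addhull_plus: "x \<in> addhull S \<Longrightarrow> y \<in> addhull S \<Longrightarrow> x + y \<in> addhull S"
  by (induction rule: addhull.induct) (auto intro: addhull_add simp: add.assoc)

lemma addc_addhull [simp]: "add_closed (addhull S)"
  by (auto simp: add_closed_def addhull_zero addhull_plus)

lemma addhull_least: "S \<subseteq> K \<Longrightarrow> add_closed K \<Longrightarrow> addhull S \<subseteq> K"
proof
  fix x assume "x \<in> addhull S" "S \<subseteq> K" "add_closed K"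
  then show "x \<in> K" by (induction rule: addhull.induct) (auto simp: add_closed_def)
qed

lemma addhull_finite:
  assumes "x \<in> addhull S" obtains W where "finite W" "W \<subseteq> S" "x \<in> addhull W"
proof -
  have "\<exists>W. finite W \<and> W \<subseteq> S \<and> x \<in> addhull W"
    using assms
  proof (induction rule: addhull.induct)
    case addhull_zero
    then show ?case by (auto intro!: exI[of _ "{}"] addhull.addhull_zero)
  next
    case (addhull_add a b)
    then obtain W where W: "finite W" "W \<subseteq> S" "b \<in> addhull W" by blast
    have "addhull W \<subseteq> addhull (insert a W)" by (intro addhull_least) (auto intro: addhull_base)
    then show ?case using W addhull_add
      by (intro exI[of _ "insert a W"]) (auto intro!: addhull.addhull_add)
  qed
  then show ?thesis using that by blast
qed

lemma sum_lists_eq_addhull: "{sum_list xs | xs. set xs \<subseteq> S} = addhull S"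
proof
  show "{sum_list xs | xs. set xs \<subseteq> S} \<subseteq> addhull S"
  proof clarify
    fix xs assume "set xs \<subseteq> S"
    then show "sum_list xs \<in> addhull S" by (induction xs) (auto intro: addhull_zero addhull_add)
  qed
  show "addhull S \<subseteq> {sum_list xs | xs. set xs \<subseteq> S}"
  proof
    fix x assume "x \<in> addhull S"
    then show "x \<in> {sum_list xs | xs. set xs \<subseteq> S}"
    proof (induction rule: addhull.induct)
      case addhull_zero
      then show ?case by (auto intro!: exI[of _ "[]"])
    next
      case (addhull_add a b)
      then obtain xs where "b = sum_list xs" "set xs \<subseteq> S" by auto
      then show ?case using addhull_add by (auto intro!: exI[of _ "a # xs"])
    qed
  qed
qed

lemma fsums_eq_addhull: "fsums S = addhull S"
  by (simp add: fsums_def sum_lists_eq_addhull)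

lemma fsums_setprod_eq: "fsums (setprod I J) = mprod I J"
  by (simp add: fsums_eq_addhull setprod_def mprod_def)

lemma ext_eq_mprod: "ext I T = mprod I T"
  by (simp add: ext_def fsums_setprod_eq)

lemma addc_mprod [simp]: "add_closed (mprod I J)"
  by (simp add: mprod_def)

lemma mprodI: "a \<in> I \<Longrightarrow> b \<in> J \<Longrightarrow> a * b \<in> mprod I J"
  by (auto simp: mprod_def intro!: addhull_base)

lemma mprod_least: "(\<And>a b. a \<in> I \<Longrightarrow> b \<in> J \<Longrightarrow> a * b \<in> K) \<Longrightarrow> add_closed K \<Longrightarrow> mprod I J \<subseteq> K"
  unfolding mprod_def by (rule addhull_least) auto

lemma mprod_mono: "I \<subseteq> I' \<Longrightarrow> J \<subseteq> J' \<Longrightarrow> mprod I J \<subseteq> mprod I' J'"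
  by (rule mprod_least) (auto intro: mprodI)

lemma mprod_comm: "mprod I J = mprod J I"
proof -
  have "mprod I J \<subseteq> mprod J I" for I J :: "'a set"
    by (rule mprod_least) (subst mult.commute, auto intro: mprodI)
  then show ?thesis by blast
qed
  
lemma mprod_assoc_sub: "mprod (mprod I J) L \<subseteq> mprod I (mprod J L)"
proof (rule mprod_least)
  fix x c assume "x \<in> mprod I J" "c \<in> L"
  have "mprod I J \<subseteq> {x. x * c \<in> mprod I (mprod J L)}"
  proof (rule mprod_least)
    show "add_closed {x. x * c \<in> mprod I (mprod J L)}"
      using addc_mprod[of I "mprod J L"] by (auto simp: add_closed_def distrib_right)
  qed (use \<open>c \<in> L\<close> in \<open>auto simp: mult.assoc intro: mprodI\<close>)
  then show "x * c \<in> mprod I (mprod J L)" using \<open>x \<in> mprod I J\<close> by blast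
qed simp

lemma mprod_assoc: "mprod (mprod I J) L = mprod I (mprod J L)"
proof
  show "mprod I (mprod J L) \<subseteq> mprod (mprod I J) L"
    using mprod_assoc_sub[of L J I] by (simp add: mprod_comm)
qed (rule mprod_assoc_sub)

lemma mprod_left_comm: "mprod I (mprod J L) = mprod J (mprod I L)"
  using mprod_assoc[of I J L] mprod_assoc[of J I L] mprod_comm[of I J] by simp

lemmas mprod_ac = mprod_assoc mprod_comm mprod_left_comm

lemma smod_mprod: assumes "smod A I" shows "smod A (mprod I J)"
proof -
  have "mprod I J \<subseteq> {x. \<forall>c\<in>A. c * x \<in> mprod I J}"
  proof (rule mprod_least)
    show "add_closed {x. \<forall>c\<in>A. c * x \<in> mprod I J}"
      using addc_mprod[of I J] by (auto simp: add_closed_def distrib_left)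
  next
    fix a b assume "a \<in> I" "b \<in> J"
    then show "a * b \<in> {x. \<forall>c\<in>A. c * x \<in> mprod I J}"
      using assms by (auto simp: smod_def mult.assoc[symmetric] intro!: mprodI)
  qed
  then show ?thesis by (auto simp: smod_def)
qed

lemma smod_mprod2: assumes "smod A J" shows "smod A (mprod I J)"
  using smod_mprod[OF assms, of I] by (simp add: mprod_comm)

lemma smod_self: "sring A \<Longrightarrow> smod A A"
  by (auto simp: sring_def smod_def)

lemma mprod_unit: assumes "sring A" "smod A I" shows "mprod A I = I" "mprod I A = I"
proof -
  show "mprod A I = I"
  proof
    show "mprod A I \<subseteq> I" using assms by (intro mprod_least) (auto simp: smod_def)
    show "I \<subseteq> mprod A I" using assms mprodI[of 1 A _ I] by (auto simp: sring_def)
  qed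
  then show "mprod I A = I" by (simp add: mprod_comm)
qed

lemma sring_idem: "sring A \<Longrightarrow> mprod A A = A"
  by (simp add: mprod_unit smod_self)

lemma mprod_finite:
  assumes "x \<in> mprod I J"
  obtains X Y where "finite X" "finite Y" "X \<subseteq> I" "Y \<subseteq> J" "x \<in> mprod X Y"
proof -
  obtain W where W: "finite W" "W \<subseteq> {a * b | a b. a \<in> I \<and> b \<in> J}" "x \<in> addhull W"
    using assms addhull_finite unfolding mprod_def by blast
  then have "\<forall>w\<in>W. \<exists>a b. a \<in> I \<and> b \<in> J \<and> w = a * b" by blast
  then obtain a b where ab: "\<And>w. w \<in> W \<Longrightarrow> a w \<in> I \<and> b w \<in> J \<and> w = a w * b w" by metis
  have "addhull W \<subseteq> mprod (a ` W) (b ` W)"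
  proof (rule addhull_least)
    show "W \<subseteq> mprod (a ` W) (b ` W)"
    proof
      fix w assume "w \<in> W"
      then have "a w * b w \<in> mprod (a ` W) (b ` W)" by (auto intro: mprodI)
      then show "w \<in> mprod (a ` W) (b ` W)" using ab \<open>w \<in> W\<close> by metis
    qed
  qed simp
  then show ?thesis using W ab by (intro that[of "a ` W" "b ` W"]) auto
qed

section \<open>Invertible submodules of a ring\<close>

definition INV :: "'r::comm_ring_1 set \<Rightarrow> 'r set set" where
  "INV A = {I. smod A I \<and> (\<exists>J. smod A J \<and> mprod I J = A)}"

text \<open>The ambient ring is a parameter: in K(X) the members are invertible fractional ideals of
  Int(A), in K[X] they are those that lie in K[X] together with their inverse. Passing to classes is
  postponed, so that additivity of values can be proved for modules.\<close>

definition invg :: "'r::comm_ring_1 set \<Rightarrow> 'r set monoid" where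
  "invg A = \<lparr>carrier = INV A, monoid.mult = mprod, one = A\<rparr>"

lemma invg_simps [simp]: "carrier (invg A) = INV A" "monoid.mult (invg A) = mprod" "one (invg A) = A"
  by (simp_all add: invg_def)

lemma INV_I: "smod A I \<Longrightarrow> smod A J \<Longrightarrow> mprod I J = A \<Longrightarrow> I \<in> INV A"
  by (auto simp: INV_def)

lemma INV_E: assumes "I \<in> INV A"
  obtains J where "J \<in> INV A" "smod A I" "smod A J" "mprod I J = A"
  using assms by (auto simp: INV_def mprod_comm)

lemma INV_smod: "I \<in> INV A \<Longrightarrow> smod A I"
  by (simp add: INV_def)

lemma comm_group_invg: assumes A: "sring A" shows "comm_group (invg A)"
proof (rule comm_groupI)
  fix I J assume "I \<in> carrier (invg A)" "J \<in> carrier (invg A)"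
  then obtain I' J' where *: "smod A I" "smod A I'" "mprod I I' = A" "smod A J" "smod A J'" "mprod J J' = A"
    by (auto simp: INV_def)
  have "mprod (mprod I J) (mprod I' J') = mprod (mprod I I') (mprod J J')"
    by (simp add: mprod_ac)
  also have "\<dots> = A" using * by (simp add: sring_idem[OF A])
  finally show "I \<otimes>\<^bsub>invg A\<^esub> J \<in> carrier (invg A)"
    using * INV_I[of A "mprod I J" "mprod I' J'"] by (simp add: smod_mprod)
next
  show "\<one>\<^bsub>invg A\<^esub> \<in> carrier (invg A)"
    using A by (auto intro!: INV_I[of A _ A] smod_self sring_idem)
next
  fix I assume "I \<in> carrier (invg A)"
  then obtain J where "J \<in> INV A" "mprod I J = A" "smod A I" by (auto elim: INV_E)
  then show "\<exists>J\<in>carrier (invg A). J \<otimes>\<^bsub>invg A\<^esub> I = \<one>\<^bsub>invg A\<^esub>"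
    by (auto simp: mprod_comm)
  show "\<one>\<^bsub>invg A\<^esub> \<otimes>\<^bsub>invg A\<^esub> I = I" using \<open>smod A I\<close> A by (simp add: mprod_unit)
qed (auto simp: mprod_ac)

text \<open>If 1 is a sum of products x y, then i is the sum of the x (i y), and each i y lies in
  \<open>A\<close>; so the x occurring in such a sum generate \<open>I\<close>.\<close>

lemma INV_gens:
  assumes A: "sring A" and I: "smod A I" and J: "smod A J" and IJ: "mprod I J = A"
    and X: "X \<subseteq> I" and Y: "Y \<subseteq> J" and 1: "1 \<in> mprod X Y"
  shows "I = mprod X A"
proof
  show "mprod X A \<subseteq> I" using X I by (subst mprod_comm, intro mprod_least) (auto simp: smod_def)
  show "I \<subseteq> mprod X A"
  proof
    fix i assume i: "i \<in> I"
    have "i * 1 \<in> mprod {i} (mprod X Y)" using 1 by (intro mprodI) auto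
    also have "\<dots> = mprod X (mprod {i} Y)" by (simp add: mprod_left_comm)
    also have "\<dots> \<subseteq> mprod X A"
      using mprod_mono[of "{i}" I Y J] i Y IJ by (intro mprod_mono) auto
    finally show "i \<in> mprod X A" by simp
  qed
qed

lemma INV_finite_gens:
  assumes A: "sring A" and I: "smod A I" and J: "smod A J" and IJ: "mprod I J = A"
  obtains X Y where "finite X" "finite Y" "X \<subseteq> I" "Y \<subseteq> J" "1 \<in> mprod X Y"
    "I = mprod X A" "J = mprod Y A"
proof -
  have "1 \<in> mprod I J" using A IJ by (simp add: sring_def)
  then obtain X Y where XY: "finite X" "finite Y" "X \<subseteq> I" "Y \<subseteq> J" "1 \<in> mprod X Y"
    by (rule mprod_finite)
  then have "I = mprod X A" "J = mprod Y A"
    using INV_gens[OF A I J IJ] INV_gens[OF A J I, of Y X] IJ by (simp_all add: mprod_comm[of J I] mprod_comm[of Y X])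
  then show ?thesis using that XY by blast
qed

section \<open>Extension of modules along ring homomorphisms\<close>

definition rhom :: "('r::comm_ring_1 \<Rightarrow> 's::comm_ring_1) \<Rightarrow> bool" where
  "rhom h \<longleftrightarrow> h 0 = 0 \<and> h 1 = 1 \<and> (\<forall>x y. h (x + y) = h x + h y) \<and> (\<forall>x y. h (x * y) = h x * h y)"

text \<open>One construction serves for the ideal I Int(A) (along the constants), the module of
  values F(a) (along evaluation), the passage to K(X), and the enlargement of the coefficient ring
  (along the identity).\<close>

definition exts :: "('r::comm_ring_1 \<Rightarrow> 's::comm_ring_1) \<Rightarrow> 's set \<Rightarrow> 'r set \<Rightarrow> 's set" where
  "exts h A' I = mprod (h ` I) A'"

lemma rhom_addhull: assumes "rhom h" shows "h ` addhull S = addhull (h ` S)"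
proof
  show "h ` addhull S \<subseteq> addhull (h ` S)"
  proof -
    have "addhull S \<subseteq> {x. h x \<in> addhull (h ` S)}"
      using assms by (intro addhull_least) (auto simp: add_closed_def rhom_def intro: addhull_base addhull_zero addhull_plus)
    then show ?thesis by auto
  qed
  show "addhull (h ` S) \<subseteq> h ` addhull S"
  proof (rule addhull_least)
    show "add_closed (h ` addhull S)"
      unfolding add_closed_def
    proof safe
      show "0 \<in> h ` addhull S"
        using assms by (intro image_eqI[of _ _ 0]) (auto simp: rhom_def addhull_zero)
      fix x y assume "x \<in> addhull S" "y \<in> addhull S"
      then show "h x + h y \<in> h ` addhull S"
        using assms by (intro image_eqI[of _ _ "x + y"]) (auto simp: rhom_def addhull_plus)
    qed
  qed (auto intro: addhull_base)
qed

lemma rhom_mprod: assumes "rhom h" shows "h ` mprod I J = mprod (h ` I) (h ` J)"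
proof -
  have "h ` {a * b | a b. a \<in> I \<and> b \<in> J} = {a * b | a b. a \<in> h ` I \<and> b \<in> h ` J}"
  proof safe
    fix a b assume "a \<in> I" "b \<in> J"
    then show "\<exists>x y. h (a * b) = x * y \<and> x \<in> h ` I \<and> y \<in> h ` J"
      using assms by (intro exI[of _ "h a"] exI[of _ "h b"]) (auto simp: rhom_def)
    show "h a * h b \<in> h ` {a * b | a b. a \<in> I \<and> b \<in> J}"
      using assms \<open>a \<in> I\<close> \<open>b \<in> J\<close> by (intro image_eqI[of _ _ "a * b"]) (auto simp: rhom_def)
  qed
  then show ?thesis by (simp add: mprod_def rhom_addhull[OF assms])
qed

lemma exts_mult: assumes h: "rhom h" and A': "sring A'"
  shows "exts h A' (mprod I J) = mprod (exts h A' I) (exts h A' J)"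
proof -
  have "mprod (exts h A' I) (exts h A' J) = mprod (mprod (h ` I) (h ` J)) (mprod A' A')"
    by (simp add: exts_def mprod_ac)
  then show ?thesis by (simp add: exts_def rhom_mprod[OF h] sring_idem[OF A'])
qed

lemma smod_exts: "sring A' \<Longrightarrow> smod A' (exts h A' I)"
  by (simp add: exts_def smod_mprod2 smod_self)

lemma exts_one: assumes h: "rhom h" and A': "sring A'" and 1: "1 \<in> I" and I: "h ` I \<subseteq> A'"
  shows "exts h A' I = A'"
proof
  show "exts h A' I \<subseteq> A'" using I A' unfolding exts_def
    by (intro mprod_least) (auto simp: sring_def)
  show "A' \<subseteq> exts h A' I" using mprodI[of "h 1" "h ` I" _ A'] 1 h by (auto simp: exts_def rhom_def)
qed

lemma exts_hom: assumes h: "rhom h" and A: "sring A" and A': "sring A'" and hA: "h ` A \<subseteq> A'"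
  shows "exts h A' \<in> hom (invg A) (invg A')"
proof (rule homI)
  fix I assume "I \<in> carrier (invg A)"
  then obtain J where J: "smod A I" "smod A J" "mprod I J = A" by (auto simp: INV_def)
  have "mprod (exts h A' I) (exts h A' J) = A'"
    using exts_mult[OF h A', of I J] exts_one[OF h A' _ hA] J A by (simp add: sring_def)
  then show "exts h A' I \<in> carrier (invg A')"
    using A' by (auto intro!: INV_I smod_exts)
qed (simp add: exts_mult[OF h A'])

lemma exts_exts:
  assumes h: "rhom h" and A': "sring A'" and A'': "sring A''" and k: "rhom k" and kA: "k ` A' \<subseteq> A''"
  shows "exts k A'' (exts h A' I) = exts (k \<circ> h) A'' I"
proof -
  have "exts k A'' (exts h A' I) = mprod (mprod (k ` h ` I) (k ` A')) A''"
    by (simp add: exts_def rhom_mprod[OF k])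
  also have "\<dots> = mprod (k ` h ` I) (exts k A'' A')" by (simp add: exts_def mprod_assoc)
  also have "exts k A'' A' = A''" using A' by (intro exts_one[OF k A'' _ kA]) (simp add: sring_def)
  finally show ?thesis by (simp add: exts_def image_comp)
qed

lemma rhom_id [simp]: "rhom id" "rhom (\<lambda>x. x)"
  by (auto simp: rhom_def)

text \<open>A = I J is contained in I A = I. Equality of invertible modules is thus reduced to two
  inclusions, one for the module and one for its inverse.\<close>

lemma INV_eqI:
  assumes A: "sring A" and I: "smod A I" and J: "smod A J" and IJ: "mprod I J = A" and "I \<subseteq> A" "J \<subseteq> A"
  shows "I = A"
proof
  have "mprod I J \<subseteq> mprod I A" using assms by (intro mprod_mono) auto
  then show "A \<subseteq> I" using IJ mprod_unit[OF A I] by simp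
qed fact

lemma is_subring_sring: "is_subring A = sring A"
  by (auto simp: is_subring_def sring_def add_closed_def)

lemma submod_smod: "submod A I = smod A I"
  by (auto simp: submod_def smod_def add_closed_def)

lemma invertible_ideals_INV: "invertible_ideals A = INV A"
  by (simp add: invertible_ideals_def INV_def submod_smod fsums_setprod_eq)

section \<open>Picard groups\<close>

lemma mprod_singleton: assumes "add_closed I" shows "mprod {x} I = (\<lambda>y. x * y) ` I"
proof
  show "mprod {x} I \<subseteq> (\<lambda>y. x * y) ` I"
  proof (rule mprod_least)
    show "add_closed ((\<lambda>y. x * y) ` I)"
      using assms unfolding add_closed_def by (auto intro!: image_eqI[of 0 _ 0] simp flip: distrib_left)
  qed auto
qed (auto intro: mprodI)

lemma mprod_singletons: assumes "add_closed I" shows "mprod {x} (mprod {y} I) = mprod {x * y} I"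
  using mprod_singleton[OF addc_mprod, of x "{y}" I]
  by (simp add: mprod_singleton[OF assms] image_image mult.assoc)

lemma mprod_one: "add_closed I \<Longrightarrow> mprod {1} I = I"
  by (simp add: mprod_singleton)

lemma mprod_cancel:
  fixes x :: "'r::field"
  assumes "add_closed I" "x \<noteq> 0" shows "mprod {x} (mprod {1 / x} I) = I" "mprod {1 / x} (mprod {x} I) = I"
    "mprod {x} (mprod {inverse x} I) = I" "mprod {inverse x} (mprod {x} I) = I"
  using assms by (simp_all add: mprod_singletons mprod_one)

lemma smod_addc: "smod A I \<Longrightarrow> add_closed I"
  by (simp add: smod_def)

lemma INV_addc: "I \<in> INV A \<Longrightarrow> add_closed I"
  by (simp add: INV_def smod_def)

lemma INV_scale:
  fixes x :: "'r::field"
  assumes "I \<in> INV A" "x \<noteq> 0" shows "mprod {x} I \<in> INV A"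
proof -
  obtain J where J: "smod A I" "smod A J" "mprod I J = A" using assms by (auto simp: INV_def)
  have "mprod (mprod {x} I) (mprod {1 / x} J) = mprod {x} (mprod {1 / x} (mprod I J))"
    by (simp add: mprod_ac)
  also have "\<dots> = mprod I J" using assms by (simp add: mprod_cancel(1))
  also have "\<dots> = A" by fact
  finally show ?thesis using J by (intro INV_I[of A _ "mprod {1 / x} J"]) (auto intro: smod_mprod2)
qed

lemma pic_class_eq: "add_closed I \<Longrightarrow> pic_class A I = {J \<in> INV A. \<exists>x. x \<noteq> 0 \<and> J = mprod {x} I}"
  by (simp add: pic_class_def mprod_singleton invertible_ideals_INV)

lemma pic_class_self: "I \<in> INV A \<Longrightarrow> I \<in> pic_class A I"
  by (auto simp: pic_class_eq INV_addc mprod_one intro!: exI[of _ 1])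

lemma pic_class_eq_iff: assumes "I \<in> INV A" "J \<in> INV A"
  shows "pic_class A I = pic_class A J \<longleftrightarrow> (\<exists>x. x \<noteq> 0 \<and> J = mprod {x} I)"
proof
  assume "pic_class A I = pic_class A J"
  then show "\<exists>x. x \<noteq> 0 \<and> J = mprod {x} I"
    using pic_class_self[OF assms(2)] pic_class_eq[OF INV_addc[OF assms(1)], of A] by auto
next
  assume "\<exists>x. x \<noteq> 0 \<and> J = mprod {x} I"
  then obtain x where x: "x \<noteq> 0" "J = mprod {x} I" by blast
  have I: "add_closed I" using assms(1) by (rule INV_addc)
  have *: "mprod {y} I = mprod {y / x} J" for y using x I by (simp add: mprod_singletons)
  have **: "mprod {y} J = mprod {y * x} I" for y using x I by (simp add: mprod_singletons)
  show "pic_class A I = pic_class A J"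
    unfolding pic_class_eq[OF I] pic_class_eq[OF INV_addc[OF assms(2)]]
    using x * ** by (metis divide_eq_0_iff mult_eq_0_iff)
qed

lemma Pic_simps [simp]: "carrier (Pic A) = pic_class A ` INV A" "one (Pic A) = pic_class A A"
  by (simp_all add: Pic_def invertible_ideals_INV)

lemma INV_mprod: "sring A \<Longrightarrow> I \<in> INV A \<Longrightarrow> J \<in> INV A \<Longrightarrow> mprod I J \<in> INV A"
  using monoid.m_closed[OF comm_monoid.axioms(1)[OF comm_group.axioms(1)[OF comm_group_invg]], of A I J] by simp

lemma INV_self: "sring A \<Longrightarrow> A \<in> INV A"
  using monoid.one_closed[OF comm_monoid.axioms(1)[OF comm_group.axioms(1)[OF comm_group_invg]], of A] by simp

text \<open>\<open>Pic\<close> multiplies classes as sets of products. These exhaust the class of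
  the product, since a scalar can be moved wholly into the first factor.\<close>

lemma Pic_mult: assumes A: "sring A" and I: "I \<in> INV A" and J: "J \<in> INV A"
  shows "pic_class A I \<otimes>\<^bsub>Pic A\<^esub> pic_class A J = pic_class A (mprod I J)"
proof -
  have "{mprod I' J' | I' J'. I' \<in> pic_class A I \<and> J' \<in> pic_class A J} = pic_class A (mprod I J)"
    (is "?L = _")
  proof
    show "?L \<subseteq> pic_class A (mprod I J)"
    proof clarify
      fix I' J' assume *: "I' \<in> pic_class A I" "J' \<in> pic_class A J"
      then obtain x y where xy: "x \<noteq> 0" "I' = mprod {x} I" "y \<noteq> 0" "J' = mprod {y} J"
        using I J by (auto simp: pic_class_eq INV_addc)
      have "mprod I' J' = mprod {x} (mprod {y} (mprod I J))" using xy by (simp add: mprod_ac)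
      then have "mprod I' J' = mprod {x * y} (mprod I J)" by (simp add: mprod_singletons)
      moreover have "mprod I' J' \<in> INV A" using * A I J by (auto simp: pic_class_eq INV_addc intro!: INV_mprod)
      ultimately show "mprod I' J' \<in> pic_class A (mprod I J)" using xy by (auto simp: pic_class_eq intro!: exI[of _ "x * y"])
    qed
    show "pic_class A (mprod I J) \<subseteq> ?L"
    proof
      fix L assume "L \<in> pic_class A (mprod I J)"
      then obtain x where x: "x \<noteq> 0" "L = mprod (mprod {x} I) J" by (auto simp: pic_class_eq mprod_assoc)
      have "mprod {x} I \<in> pic_class A I" using I x by (auto simp: pic_class_eq INV_addc INV_scale)
      then show "L \<in> ?L" using x pic_class_self[OF J] by blast
    qed
  qed
  then show ?thesis by (simp add: Pic_def fsums_setprod_eq)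
qed

text \<open>The group laws of \<open>Pic\<close> are not checked on sets of classes but carried over
  from the group of modules along the class map.\<close>

lemma comm_group_image:
  assumes G: "comm_group G" and surj: "carrier H = h ` carrier G"
    and mult: "\<And>x y. x \<in> carrier G \<Longrightarrow> y \<in> carrier G \<Longrightarrow> h (x \<otimes>\<^bsub>G\<^esub> y) = h x \<otimes>\<^bsub>H\<^esub> h y"
    and one: "h \<one>\<^bsub>G\<^esub> = \<one>\<^bsub>H\<^esub>"
  shows "comm_group H"
proof -
  interpret G: comm_group G by fact
  show ?thesis
  proof (rule comm_groupI)
    fix x assume "x \<in> carrier H"
    then obtain a where a: "a \<in> carrier G" "x = h a" using surj by auto
    then show "\<one>\<^bsub>H\<^esub> \<otimes>\<^bsub>H\<^esub> x = x" using mult[of "\<one>\<^bsub>G\<^esub>" a] one by simp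
    have "h (inv\<^bsub>G\<^esub> a) \<otimes>\<^bsub>H\<^esub> x = \<one>\<^bsub>H\<^esub>" using mult[of "inv\<^bsub>G\<^esub> a" a] a one by simp
    then show "\<exists>y\<in>carrier H. y \<otimes>\<^bsub>H\<^esub> x = \<one>\<^bsub>H\<^esub>" using a surj by blast
  next
    show "\<one>\<^bsub>H\<^esub> \<in> carrier H" unfolding surj one[symmetric] by simp
  next
    fix x y assume "x \<in> carrier H" "y \<in> carrier H"
    then obtain a b where *: "a \<in> carrier G" "b \<in> carrier G" "x = h a" "y = h b" using surj by auto
    then show "x \<otimes>\<^bsub>H\<^esub> y \<in> carrier H" using surj by (simp flip: mult)
    show "x \<otimes>\<^bsub>H\<^esub> y = y \<otimes>\<^bsub>H\<^esub> x" using * by (simp flip: mult add: G.m_comm)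
    fix z assume "z \<in> carrier H"
    then obtain c where "c \<in> carrier G" "z = h c" using surj by auto
    then show "x \<otimes>\<^bsub>H\<^esub> y \<otimes>\<^bsub>H\<^esub> z = x \<otimes>\<^bsub>H\<^esub> (y \<otimes>\<^bsub>H\<^esub> z)"
      using * by (simp flip: mult add: G.m_assoc)
  qed
qed

lemma comm_group_Pic: assumes "sring A" shows "comm_group (Pic A)"
  by (rule comm_group_image[OF comm_group_invg[OF assms], of _ "pic_class A"])
    (simp_all add: Pic_mult assms)

section \<open>Reduction from K(X) to K[X]\<close>

definition emb :: "'a::field poly \<Rightarrow> 'a poly fract" where
  "emb p = Fract p 1"

lemma rhom_emb: "rhom emb"
  by (auto simp: rhom_def emb_def Zero_fract_def One_fract_def)

lemma emb_eq_iff [simp]: "emb p = emb q \<longleftrightarrow> p = q"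
  by (auto simp: emb_def eq_fract)

lemma inj_emb: "inj emb"
  by (auto intro: injI)

lemma emb_simps: "emb 0 = 0" "emb 1 = 1" "emb (p + q) = emb p + emb q" "emb (p * q) = emb p * emb q"
  using rhom_emb by (auto simp: rhom_def)

lemma IntK_emb: "IntK A = emb ` intpoly A"
  by (simp add: IntK_def emb_def)

lemma sring_intpoly: "sring A \<Longrightarrow> sring (intpoly A)"
  by (auto simp: sring_def add_closed_def intpoly_def)

lemma sring_image: assumes h: "rhom h" and A: "sring A" shows "sring (h ` A)"
proof -
  have m: "h (- x) = - h x" for x
    using h unfolding rhom_def by (metis add.right_inverse add_eq_0_iff)
  have "h 0 = 0" "h 1 = 1" "\<And>x y. h x + h y = h (x + y)" "\<And>x y. h x * h y = h (x * y)"
    using h by (auto simp: rhom_def)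
  then show ?thesis using A unfolding sring_def add_closed_def
    by (auto simp: m[symmetric])
qed

lemma sring_IntK: "sring A \<Longrightarrow> sring (IntK A)"
  by (simp add: IntK_emb sring_image rhom_emb sring_intpoly)

lemma emb_common_denom:
  assumes "finite X" shows "\<exists>q. q \<noteq> 0 \<and> (\<forall>x\<in>X. emb q * x \<in> range emb)"
  using assms
proof (induction X rule: finite_induct)
  case empty
  then show ?case by (auto intro: exI[of _ 1])
next
  case (insert x X)
  then obtain q where q: "q \<noteq> 0" "\<forall>x\<in>X. emb q * x \<in> range emb" by blast
  obtain a b where x: "x = Fract a b" "b \<noteq> 0" by (cases x) auto
  have xb: "emb b * x = emb a" using x by (simp add: emb_def eq_fract)
  have "emb (q * b) * y \<in> range emb" if "y \<in> insert x X" for y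
  proof (cases "y = x")
    case True
    then have "emb (q * b) * y = emb (q * a)" using xb by (simp add: emb_simps mult.assoc)
    then show ?thesis by simp
  next
    case False
    then have "y \<in> X" using that by blast
    then obtain p where "emb q * y = emb p" using q(2) by blast
    then have "emb (q * b) * y = emb (p * b)" by (simp add: emb_simps algebra_simps)
    then show ?thesis by simp
  qed
  then show ?case using q x by (intro exI[of _ "q * b"]) auto
qed

lemma sring_range_emb: "sring (range emb)"
  by (rule sring_image[OF rhom_emb]) (auto simp: sring_def add_closed_def)

text \<open>K[X] is a principal ideal domain: once the denominators of finitely many generators are
  cleared, a nonzero member of least degree divides all others by division with remainder.\<close>

lemma INV_range_emb_principal:
  assumes E: "E \<in> INV (range emb)"
  obtains x where "x \<noteq> 0" "E = mprod {x} (range emb)"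
proof -
  let ?R = "range emb :: 'a poly fract set"
  have R: "sring ?R" by (rule sring_range_emb)
  obtain E' where E': "smod ?R E" "smod ?R E'" "mprod E E' = ?R" using E by (auto simp: INV_def)
  obtain X Y where X: "finite X" "X \<subseteq> E" "E = mprod X ?R" using INV_finite_gens[OF R E'] by metis
  obtain q where q: "q \<noteq> 0" "\<forall>x\<in>X. emb q * x \<in> ?R" using emb_common_denom[OF X(1)] by blast
  define E0 where "E0 = mprod {emb q} E"
  have E0: "smod ?R E0" using E' by (auto simp: E0_def intro: smod_mprod2)
  have "E0 = mprod (mprod {emb q} X) ?R" using X by (simp add: E0_def mprod_assoc)
  also have "\<dots> \<subseteq> mprod ?R ?R"
    by (intro mprod_mono mprod_least subset_refl) (use q R in \<open>auto simp: sring_def\<close>)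
  finally have E0R: "E0 \<subseteq> ?R" using sring_idem[OF R] by simp
  have "\<not> E0 \<subseteq> {0}"
  proof
    assume "E0 \<subseteq> {0}"
    then have "mprod {inverse (emb q)} E0 \<subseteq> {0}" by (intro mprod_least) (auto simp: add_closed_def)
    moreover have "mprod {inverse (emb q)} E0 = E"
      unfolding E0_def using E' q by (intro mprod_cancel(4)) (auto simp: smod_addc emb_simps(1)[symmetric])
    ultimately have "mprod E E' \<subseteq> {0}" by (intro mprod_least) (auto simp: add_closed_def)
    then have "1 \<in> {0::'a poly fract}" using E' emb_simps(2) by (metis rangeI subsetD)
    then show False by simp
  qed
  then obtain g1 where g1: "g1 \<noteq> 0 \<and> emb g1 \<in> E0" using E0R emb_simps(1) by (metis imageE insertI1 subset_eq)
  obtain g where g: "g \<noteq> 0" "emb g \<in> E0"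
    and gmin: "\<And>h. h \<noteq> 0 \<Longrightarrow> emb h \<in> E0 \<Longrightarrow> degree g \<le> degree h"
    using exists_least_iff[of "\<lambda>n. \<exists>h. h \<noteq> 0 \<and> emb h \<in> E0 \<and> degree h = n"] g1 by (metis leI)
  have "E0 = mprod {emb g} ?R"
  proof
    show "mprod {emb g} ?R \<subseteq> E0"
      using g E0 by (subst mprod_comm, intro mprod_least) (auto simp: smod_def)
    show "E0 \<subseteq> mprod {emb g} ?R"
    proof
      fix y assume y: "y \<in> E0"
      then obtain p where p: "y = emb p" using E0R by blast
      have "emb (p mod g) = emb p + emb (- (p div g)) * emb g"
        by (simp flip: emb_simps(3,4) add: minus_div_mult_eq_mod[symmetric])
      also have "\<dots> \<in> E0" using y p g E0 by (auto simp: smod_def add_closed_def)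
      finally have "p mod g = 0" using gmin[of "p mod g"] degree_mod_less[of g p] g by fastforce
      then have "p = g * (p div g)" using g by (simp add: mod_eq_0_iff_dvd)
      then have "y = emb g * emb (p div g)" using p emb_simps(4) by metis
      then show "y \<in> mprod {emb g} ?R" by (auto intro: mprodI)
    qed
  qed
  then have "mprod {emb q} E = mprod {emb g} ?R" by (simp add: E0_def)
  then have "mprod {inverse (emb q)} (mprod {emb q} E) = mprod {inverse (emb q)} (mprod {emb g} ?R)" by simp
  moreover have "emb q \<noteq> 0" "emb g \<noteq> 0" using q g emb_eq_iff emb_simps(1) by metis+
  ultimately have "E = mprod {inverse (emb q) * emb g} ?R"
    using mprod_cancel(4)[of E "emb q"] E' R by (simp add: smod_addc mprod_singletons sring_def)
  then show ?thesis using that[of "inverse (emb q) * emb g"] \<open>emb q \<noteq> 0\<close> \<open>emb g \<noteq> 0\<close> by simp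
qed

lemma emb_vimage: "S \<subseteq> range emb \<Longrightarrow> emb ` (emb -` S) = S"
  by auto

text \<open>Over K[X] the module becomes principal, with generator x. Dividing F by x and
  multiplying its inverse by x moves both into K[X], so the pair is already inverse there.\<close>

lemma unitary_reduction:
  assumes A: "sring A" and F: "F \<in> INV (IntK A)"
  obtains x F' where "x \<noteq> 0" "F' \<in> INV (intpoly A)" "F = mprod {x} (emb ` F')"
proof -
  let ?R = "range emb :: 'a poly fract set" and ?B = "IntK A"
  have R: "sring ?R" by (rule sring_range_emb)
  note B = sring_IntK[OF A]
  obtain G where G: "smod ?B F" "smod ?B G" "mprod F G = ?B" using F by (auto simp: INV_def)
  define E where "E = mprod F ?R"
  define E' where "E' = mprod G ?R"
  have BR: "mprod ?B ?R = ?R"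
    using exts_one[OF rhom_id(1) R, of ?B] B by (auto simp: exts_def IntK_emb sring_def)
  have EE': "mprod E E' = ?R"
  proof -
    have "mprod E E' = mprod (mprod F G) (mprod ?R ?R)" by (simp add: E_def E'_def mprod_ac)
    then show ?thesis using G BR by (simp add: sring_idem[OF R])
  qed
  have sE: "smod ?R E" "smod ?R E'" by (simp_all add: E_def E'_def smod_mprod2 smod_self[OF R])
  then have "E \<in> INV ?R" using EE' by (intro INV_I)
  then obtain x where x: "x \<noteq> 0" "E = mprod {x} ?R" by (rule INV_range_emb_principal)
  have aR: "add_closed ?R" using R by (simp add: sring_def)
  have "mprod {x} E' = mprod {x} (mprod ?R E')" using mprod_unit[OF R sE(2)] by simp
  also have "\<dots> = mprod E E'" using x by (simp add: mprod_assoc)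
  finally have xE': "mprod {x} E' = ?R" using EE' by simp
  have xE: "mprod {1 / x} E = ?R" using x aR by (simp add: mprod_singletons mprod_one)
  have 1: "1 \<in> ?R" using R by (simp add: sring_def)
  have FE: "F \<subseteq> E" "G \<subseteq> E'" using mprodI[OF _ 1] by (fastforce simp: E_def E'_def)+
  define F0 where "F0 = mprod {1 / x} F"
  define G0 where "G0 = mprod {x} G"
  have F0R: "F0 \<subseteq> ?R" unfolding F0_def using mprod_mono[OF subset_refl FE(1), of "{1/x}"] xE by simp
  have G0R: "G0 \<subseteq> ?R" unfolding G0_def using mprod_mono[OF subset_refl FE(2), of "{x}"] xE' by simp
  have "mprod F0 G0 = mprod {1 / x} (mprod {x} (mprod F G))" by (simp add: F0_def G0_def mprod_ac)
  also have "\<dots> = mprod F G" using x by (simp add: mprod_cancel(2))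
  finally have FG0: "mprod F0 G0 = ?B" using G by simp
  have s0: "smod ?B F0" "smod ?B G0" using G by (auto simp: F0_def G0_def intro: smod_mprod2)
  have sv: "smod (intpoly A) (emb -` S)" if "smod ?B S" for S
    using that by (auto simp: smod_def add_closed_def IntK_emb emb_simps)
  have "emb ` mprod (emb -` F0) (emb -` G0) = emb ` intpoly A"
    using FG0 by (simp only: rhom_mprod[OF rhom_emb] emb_vimage[OF F0R] emb_vimage[OF G0R] IntK_emb)
  then have "mprod (emb -` F0) (emb -` G0) = intpoly A" by (simp only: inj_image_eq_iff[OF inj_emb])
  then have "emb -` F0 \<in> INV (intpoly A)" using sv s0 by (intro INV_I)
  moreover have "F = mprod {x} (emb ` (emb -` F0))"
    unfolding emb_vimage[OF F0R] unfolding F0_def mprod_cancel(1)[OF smod_addc[OF G(1)] x(1)] ..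
  ultimately show ?thesis using that x by blast
qed

lemma exts_emb: assumes "sring A" "F \<in> INV (intpoly A)" shows "exts emb (IntK A) F = emb ` F"
  unfolding exts_def IntK_emb rhom_mprod[OF rhom_emb, symmetric]
  by (simp add: mprod_unit sring_intpoly assms INV_smod)

lemma emb_INV: assumes "sring A" "F \<in> INV (intpoly A)" shows "emb ` F \<in> INV (IntK A)"
  using hom_in_carrier[OF exts_hom[OF rhom_emb sring_intpoly[OF assms(1)] sring_IntK[OF assms(1)]], of F] assms
  by (simp add: exts_emb) (simp add: IntK_emb)

text \<open>Multiplying by the inverse module shows that x and 1 / x are polynomials; hence x is a
  unit of K[X], that is, a constant. So for modules inside K[X], classes modulo K(X) are classes
  modulo K.\<close>

lemma emb_scale_const:
  assumes A: "sring A" and F: "F \<in> INV (intpoly A)" and F': "F' \<in> INV (intpoly A)"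
    and x: "x \<noteq> 0" and eq: "emb ` F' = mprod {x} (emb ` F)"
  obtains c where "c \<noteq> 0" "F' = mprod {[:c:]} F"
proof -
  have *: "y \<in> range emb" if F: "F \<in> INV (intpoly A)" and eq: "emb ` F' = mprod {y} (emb ` F)" for y F F'
  proof -
    obtain G where G: "mprod F G = intpoly A" using F by (auto simp: INV_def)
    have "1 \<in> emb ` mprod F G" using sring_intpoly[OF A] G emb_simps(2) by (metis image_eqI sring_def)
    then have "y * 1 \<in> mprod {y} (mprod (emb ` F) (emb ` G))"
      by (intro mprodI) (auto simp: rhom_mprod[OF rhom_emb])
    also have "\<dots> = emb ` mprod F' G" using eq by (simp add: rhom_mprod[OF rhom_emb] mprod_assoc)
    finally show ?thesis by auto
  qed
  obtain p where p: "x = emb p" using *[OF F eq] by auto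
  have "add_closed (emb ` F)" by (rule INV_addc[OF emb_INV[OF A F]])
  then have "emb ` F = mprod {1 / x} (emb ` F')" using x eq by (simp add: mprod_cancel)
  from *[OF F' this] obtain p' where p': "1 / x = emb p'" by blast
  have "emb (p * p') = emb 1" using x by (simp add: emb_simps flip: p p')
  then have pp: "p * p' = 1" by simp
  then have "p \<noteq> 0" "p' \<noteq> 0" by auto
  then have "degree p = 0" using degree_mult_eq[of p p'] pp by simp
  then obtain c where c: "p = [:c:]" "c \<noteq> 0" using \<open>p \<noteq> 0\<close> by (metis degree_eq_zeroE pCons_0_0)
  have "emb ` F' = emb ` mprod {[:c:]} F" using eq p c by (simp add: rhom_mprod[OF rhom_emb])
  then show ?thesis using that c inj_emb by (metis inj_image_eq_iff)
qed

section \<open>Classes in Pic(Int(A)) and in Pic_Int(A)\<close>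

definition constp :: "'a::field \<Rightarrow> 'a poly" where
  "constp a = [:a:]"

lemma rhom_constp: "rhom constp"
  by (auto simp: rhom_def constp_def one_pCons)

lemma constp_intpoly: "sring A \<Longrightarrow> constp ` A \<subseteq> intpoly A"
  by (auto simp: constp_def intpoly_def)

text \<open>From here on ideals are sets of polynomials, which can be evaluated;
  \<open>pcls_surj\<close> says that they still represent every class.\<close>

definition pcls :: "'a::field set \<Rightarrow> 'a poly set \<Rightarrow> 'a poly fract set set" where
  "pcls A F = pic_class (IntK A) (emb ` F)"

lemma pcls_hom: assumes A: "sring A" shows "pcls A \<in> hom (invg (intpoly A)) (Pic (IntK A))"
  by (rule homI) (simp_all add: pcls_def emb_INV A rhom_mprod[OF rhom_emb] Pic_mult sring_IntK)

lemma pcls_surj: assumes A: "sring A" shows "pcls A ` INV (intpoly A) = carrier (Pic (IntK A))"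
proof
  show "pcls A ` INV (intpoly A) \<subseteq> carrier (Pic (IntK A))" by (auto simp: pcls_def emb_INV A)
  show "carrier (Pic (IntK A)) \<subseteq> pcls A ` INV (intpoly A)"
  proof
    fix X assume "X \<in> carrier (Pic (IntK A))"
    then obtain F where F: "F \<in> INV (IntK A)" "X = pic_class (IntK A) F" by auto
    obtain x F' where x: "x \<noteq> 0" "F' \<in> INV (intpoly A)" "F = mprod {x} (emb ` F')"
      using unitary_reduction[OF A F(1)] by blast
    then have "X = pcls A F'"
      using F pic_class_eq_iff[OF emb_INV[OF A x(2)] F(1)] by (auto simp: pcls_def)
    then show "X \<in> pcls A ` INV (intpoly A)" using x by blast
  qed
qed

lemma pcls_eq_iff: assumes A: "sring A" and F: "F \<in> INV (intpoly A)" and F': "F' \<in> INV (intpoly A)"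
  shows "pcls A F = pcls A F' \<longleftrightarrow> (\<exists>c. c \<noteq> 0 \<and> F' = mprod {[:c:]} F)"
proof -
  have "pcls A F = pcls A F' \<longleftrightarrow> (\<exists>x. x \<noteq> 0 \<and> emb ` F' = mprod {x} (emb ` F))"
    unfolding pcls_def using A F F' by (intro pic_class_eq_iff emb_INV)
  also have "\<dots> \<longleftrightarrow> (\<exists>c. c \<noteq> 0 \<and> F' = mprod {[:c:]} F)"
  proof
    assume "\<exists>x. x \<noteq> 0 \<and> emb ` F' = mprod {x} (emb ` F)"
    then show "\<exists>c. c \<noteq> 0 \<and> F' = mprod {[:c:]} F" using emb_scale_const[OF A F F'] by metis
  next
    assume "\<exists>c. c \<noteq> 0 \<and> F' = mprod {[:c:]} F"
    then obtain c where "c \<noteq> 0" "F' = mprod {[:c:]} F" by blast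
    then show "\<exists>x. x \<noteq> 0 \<and> emb ` F' = mprod {x} (emb ` F)"
      using emb_eq_iff[of "[:c:]" 0]
      by (intro exI[of _ "emb [:c:]"]) (auto simp: rhom_mprod[OF rhom_emb] emb_simps(1))
  qed
  finally show ?thesis .
qed

definition pint :: "'a::field set \<Rightarrow> 'a poly set \<Rightarrow> 'a poly fract set set set" where
  "pint A F = iota_image A #>\<^bsub>Pic (IntK A)\<^esub> pcls A F"

abbreviation cext :: "'a::field set \<Rightarrow> 'a set \<Rightarrow> 'a poly set" where
  "cext A J \<equiv> exts constp (intpoly A) J"

lemma cext_hom: "sring A \<Longrightarrow> exts constp (intpoly A) \<in> hom (invg A) (invg (intpoly A))"
  by (intro exts_hom rhom_constp sring_intpoly constp_intpoly)

lemma cext_INV: "sring A \<Longrightarrow> J \<in> INV A \<Longrightarrow> cext A J \<in> INV (intpoly A)"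
  using hom_in_carrier[OF cext_hom] by fastforce

lemma iota_image_eq: assumes A: "sring A"
  shows "iota_image A = (\<lambda>J. pcls A (cext A J)) ` INV A"
proof -
  have "ext (const_fract ` I) (IntK A) = emb ` cext A I" for I
  proof -
    have "const_fract ` I = emb ` constp ` I" by (simp add: image_comp comp_def const_fract_def constp_def emb_def)
    then show ?thesis by (simp add: exts_def rhom_mprod[OF rhom_emb] ext_eq_mprod IntK_emb)
  qed
  then show ?thesis by (auto simp: iota_image_def invertible_ideals_INV pcls_def)
qed

lemma subgroup_iota: assumes A: "sring A" shows "subgroup (iota_image A) (Pic (IntK A))"
proof -
  have h: "pcls A \<circ> exts constp (intpoly A) \<in> hom (invg A) (Pic (IntK A))"
    using hom_compose[OF cext_hom[OF A] pcls_hom[OF A]] by (simp add: comp_def)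
  interpret group_hom "invg A" "Pic (IntK A)" "pcls A \<circ> exts constp (intpoly A)"
    using h by (simp add: group_hom_def group_hom_axioms_def comm_group.axioms(2)
        comm_group_invg[OF A] comm_group_Pic[OF sring_IntK[OF A]])
  show ?thesis using img_is_subgroup by (simp add: iota_image_eq[OF A] image_comp comp_def)
qed

lemma comm_group_PicInt: assumes A: "sring A" shows "comm_group (PicInt A)"
  unfolding PicInt_def
  by (rule comm_group.abelian_FactGroup[OF comm_group_Pic[OF sring_IntK[OF A]] subgroup_iota[OF A]])

lemma pint_hom: assumes A: "sring A" shows "pint A \<in> hom (invg (intpoly A)) (PicInt A)"
proof -
  have "iota_image A \<lhd> Pic (IntK A)"
    using comm_group.subgroup_imp_normal[OF comm_group_Pic[OF sring_IntK[OF A]] subgroup_iota[OF A]] .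
  from hom_compose[OF pcls_hom[OF A] normal.r_coset_hom_Mod[OF this]]
  show ?thesis by (simp add: pint_def[abs_def] PicInt_def comp_def)
qed

lemma pint_surj: assumes A: "sring A" shows "pint A ` INV (intpoly A) = carrier (PicInt A)"
proof -
  have "pint A ` INV (intpoly A) = (\<lambda>X. iota_image A #>\<^bsub>Pic (IntK A)\<^esub> X) ` carrier (Pic (IntK A))"
    unfolding pcls_surj[OF A, symmetric] by (auto simp: pint_def)
  then show ?thesis by (auto simp: PicInt_def FactGroup_def RCOSETS_def)
qed

text \<open>The scalar left over by \<open>pcls_eq_iff\<close> is absorbed into the ideal of
  \<open>A\<close>, so triviality becomes an equality of modules.\<close>

lemma pint_one_iff: assumes A: "sring A" and F: "F \<in> INV (intpoly A)"
  shows "pint A F = \<one>\<^bsub>PicInt A\<^esub> \<longleftrightarrow> (\<exists>J\<in>INV A. F = cext A J)"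
proof -
  interpret P: comm_group "Pic (IntK A)" by (rule comm_group_Pic[OF sring_IntK[OF A]])
  have c: "pcls A F \<in> carrier (Pic (IntK A))" using pcls_surj[OF A] F by blast
  have "pint A F = \<one>\<^bsub>PicInt A\<^esub> \<longleftrightarrow> pcls A F \<in> iota_image A"
    using P.coset_join1[OF _ c subgroup_iota[OF A]] P.coset_join2[OF c subgroup_iota[OF A]]
    by (auto simp: pint_def PicInt_def FactGroup_def)
  also have "\<dots> \<longleftrightarrow> (\<exists>J\<in>INV A. F = cext A J)"
  proof
    assume "pcls A F \<in> iota_image A"
    then obtain J where J: "J \<in> INV A" "pcls A (cext A J) = pcls A F" using iota_image_eq[OF A] by auto
    then obtain c where "c \<noteq> 0" "F = mprod {[:c:]} (cext A J)"
      using pcls_eq_iff[OF A cext_INV[OF A] F] by auto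
    then have "F = cext A (mprod {c} J)"
      by (simp add: exts_def rhom_mprod[OF rhom_constp] mprod_assoc) (simp add: constp_def)
    then show "\<exists>J\<in>INV A. F = cext A J" using INV_scale[OF J(1) \<open>c \<noteq> 0\<close>] by blast
  qed (auto simp: iota_image_eq[OF A])
  finally show ?thesis .
qed

section \<open>Valuations and almost Dedekind domains\<close>

lemma smod_one: assumes "smod A I" "1 \<in> I" shows "A \<subseteq> I"
proof
  fix x assume "x \<in> A"
  then have "x * 1 \<in> I" using assms unfolding smod_def by blast
  then show "x \<in> I" by simp
qed

text \<open>Valuations are integer-valued, so \<open>v 0\<close> carries no meaning; this predicate
  treats the value of 0 as infinite.\<close>

definition vge :: "('a::field \<Rightarrow> int) \<Rightarrow> int \<Rightarrow> 'a \<Rightarrow> bool" where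
  "vge v n x \<longleftrightarrow> x = 0 \<or> n \<le> v x"

locale valn =
  fixes v :: "'a::field \<Rightarrow> int"
  assumes v_mult: "x \<noteq> 0 \<Longrightarrow> y \<noteq> 0 \<Longrightarrow> v (x * y) = v x + v y"
    and v_add: "x \<noteq> 0 \<Longrightarrow> y \<noteq> 0 \<Longrightarrow> x + y \<noteq> 0 \<Longrightarrow> min (v x) (v y) \<le> v (x + y)"
    and v_surj: "v ` (UNIV - {0}) = UNIV"
begin

definition vr :: "'a set" where "vr = {x. vge v 0 x}"

lemma v_one [simp]: "v 1 = 0"
  using v_mult[of 1 1] by simp

lemma v_minus [simp]: "v (- x) = v x"
proof (cases "x = 0")
  case False
  have "v (- 1) = 0" using v_mult[of "-1" "-1"] by simp
  then show ?thesis using v_mult[of "-1" x] False by simp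
qed simp

lemma v_inverse: "x \<noteq> 0 \<Longrightarrow> v (inverse x) = - v x"
  using v_mult[of x "inverse x"] by simp

lemma v_divide: "x \<noteq> 0 \<Longrightarrow> y \<noteq> 0 \<Longrightarrow> v (x / y) = v x - v y"
  by (simp add: divide_inverse v_mult v_inverse)

lemma v_power: "x \<noteq> 0 \<Longrightarrow> v (x ^ n) = int n * v x"
  by (induction n) (simp_all add: v_mult algebra_simps)

lemma v_elt: obtains x where "x \<noteq> 0" "v x = k"
  using v_surj by (metis DiffE UNIV_I imageE insertI1)

lemma vge_zero [simp]: "vge v n 0"
  by (simp add: vge_def)

lemma vge_add: "vge v n x \<Longrightarrow> vge v n y \<Longrightarrow> vge v n (x + y)"
  using v_add[of x y] by (cases "x = 0"; cases "y = 0"; cases "x + y = 0") (auto simp: vge_def)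

lemma vge_minus [simp]: "vge v n (- x) = vge v n x"
  by (simp add: vge_def)

lemma vge_diff: "vge v n x \<Longrightarrow> vge v n y \<Longrightarrow> vge v n (x - y)"
  using vge_add[of n x "- y"] by simp

lemma vge_mult: "vge v m x \<Longrightarrow> vge v n y \<Longrightarrow> vge v (m + n) (x * y)"
  using v_mult[of x y] by (cases "x = 0"; cases "y = 0") (auto simp: vge_def)

lemma vge_mult0: "vge v 0 x \<Longrightarrow> vge v n y \<Longrightarrow> vge v n (x * y)"
  using vge_mult[of 0 x n y] by simp

lemma vge_mult0': "vge v n x \<Longrightarrow> vge v 0 y \<Longrightarrow> vge v n (x * y)"
  using vge_mult[of n x 0 y] by simp

lemma vge_one [simp]: "vge v n 1 \<longleftrightarrow> n \<le> 0"
  by (simp add: vge_def)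

lemma vge_mono: "vge v n x \<Longrightarrow> m \<le> n \<Longrightarrow> vge v m x"
  by (auto simp: vge_def)

lemma vge_power: "vge v 0 x \<Longrightarrow> vge v 0 (x ^ n)"
  by (induction n) (auto intro: vge_mult0)

lemma v_prod: "(\<And>i. i \<in> S \<Longrightarrow> f i \<noteq> 0) \<Longrightarrow> v (prod f S) = (\<Sum>i\<in>S. v (f i))"
  by (induction S rule: infinite_finite_induct) (auto simp: v_mult)

text \<open>If x + y had a larger value than x, then so would x = (x + y) - y.\<close>

lemma v_add_eq: assumes "x \<noteq> 0" "vge v (v x + 1) y" shows "x + y \<noteq> 0" "v (x + y) = v x"
proof -
  show n: "x + y \<noteq> 0"
  proof
    assume "x + y = 0"
    then have "y = - x" by (simp add: eq_neg_iff_add_eq_0 add.commute)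
    then show False using assms by (simp add: vge_def)
  qed
  have "vge v (v x) (x + y)" using assms by (intro vge_add) (auto simp: vge_def)
  moreover have False if "vge v (v x + 1) (x + y)"
    using vge_diff[OF that assms(2)] assms(1) by (simp add: vge_def)
  ultimately show "v (x + y) = v x" using n unfolding vge_def by force
qed

lemma addc_vge: "add_closed {x. vge v n x}"
  by (auto simp: add_closed_def intro: vge_add)

lemma sring_vr: "sring vr"
  using addc_vge[of 0] by (auto simp: sring_def vr_def intro: vge_mult0)

lemma vr_singleton: assumes "x \<noteq> 0" shows "mprod {x} vr = {y. vge v (v x) y}"
proof -
  have a: "add_closed vr" using addc_vge by (simp add: vr_def)
  have "y \<in> mprod {x} vr" if "vge v (v x) y" for y
  proof -
    have "y / x \<in> vr" using that assms by (cases "y = 0") (auto simp: vr_def vge_def v_divide)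
    then have "x * (y / x) \<in> mprod {x} vr" by (intro mprodI) simp_all
    then show ?thesis using assms by simp
  qed
  moreover have "vge v (v x) (x * z)" if "z \<in> vr" for z
    using that by (intro vge_mult0') (auto simp: vr_def vge_def)
  ultimately show ?thesis using a by (auto simp: mprod_singleton)
qed

text \<open>Some product s t of members of the module and of its inverse is a unit. Then S t inside
  the valuation ring bounds all values on S below by that of s.\<close>

lemma INV_vr: assumes "S \<in> INV vr" obtains k where "S = {y. vge v k y}"
proof -
  obtain T where T: "smod vr S" "mprod S T = vr" using assms by (auto simp: INV_def)
  have "\<exists>s\<in>S. \<exists>t\<in>T. \<not> vge v 1 (s * t)"
  proof (rule ccontr)
    assume "\<not> ?thesis"
    then have "mprod S T \<subseteq> {x. vge v 1 x}" by (intro mprod_least addc_vge) auto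
    moreover have "1 \<in> vr" by (simp add: vr_def)
    ultimately show False using T by auto
  qed
  then obtain s t where st: "s \<in> S" "t \<in> T" "s * t \<noteq> 0" "v s + v t \<le> 0"
    by (force simp: vge_def v_mult)
  have "S = {y. vge v (v s) y}"
  proof
    show "S \<subseteq> {y. vge v (v s) y}"
    proof
      fix y assume "y \<in> S"
      then have "y * t \<in> vr" using st T mprodI by blast
      then show "y \<in> {y. vge v (v s) y}" using st by (cases "y = 0") (auto simp: vr_def vge_def v_mult)
    qed
    show "{y. vge v (v s) y} \<subseteq> S"
      using vr_singleton[of s] st T(1) by (metis mprod_comm mprod_least mult_zero_left singletonD smod_def)
  qed
  then show ?thesis using that by blast
qed

definition val :: "'a set \<Rightarrow> int" where
  "val S = (THE k. S = {y. vge v k y})"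

lemma vge_set_eq_iff: "{y. vge v k y} = {y. vge v l y} \<longleftrightarrow> k = l"
proof
  assume eq: "{y. vge v k y} = {y. vge v l y}"
  have *: "l' \<le> k'" if "{y. vge v k' y} \<subseteq> {y. vge v l' y}" for k' l'
  proof -
    obtain x where "x \<noteq> 0" "v x = k'" by (rule v_elt)
    then show ?thesis using that by (auto simp: vge_def)
  qed
  then show "k = l" using eq by (intro antisym) auto
qed simp

lemma val_vge: "val {y. vge v k y} = k"
  unfolding val_def vge_set_eq_iff by (rule the_equality) auto

lemma val_set: "S \<in> INV vr \<Longrightarrow> S = {y. vge v (val S) y}"
  by (erule INV_vr) (simp add: val_vge)

lemma val_vr: "val vr = 0"
  unfolding vr_def by (rule val_vge)

lemma vge_mprod: "mprod {y. vge v k y} {y. vge v l y} = {y. vge v (k + l) y}"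
proof -
  obtain x where x: "x \<noteq> 0" "v x = k" by (rule v_elt)
  obtain y where xy: "x \<noteq> 0" "v x = k" "y \<noteq> 0" "v y = l" using x by (rule_tac v_elt)
  have "mprod (mprod {x} vr) (mprod {y} vr) = mprod {x} (mprod {y} (mprod vr vr))"
    by (simp add: mprod_ac)
  also have "\<dots> = mprod {x * y} vr"
    using sring_vr by (simp add: sring_idem mprod_singletons sring_def)
  finally show ?thesis using xy by (simp add: vr_singleton v_mult)
qed

lemma val_mprod: "S \<in> INV vr \<Longrightarrow> T \<in> INV vr \<Longrightarrow> val (mprod S T) = val S + val T"
  by (elim INV_vr) (simp add: val_vge vge_mprod)

lemma val_elt:
  assumes S: "mprod S vr \<in> INV vr"
  shows "\<exists>s\<in>S. s \<noteq> 0 \<and> v s = val (mprod S vr)" and "s \<in> S \<Longrightarrow> vge v (val (mprod S vr)) s"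
proof -
  let ?k = "val (mprod S vr)"
  have e: "mprod S vr = {y. vge v ?k y}" using val_set[OF S] .
  show all: "vge v ?k s" if "s \<in> S" for s
  proof -
    have "s * 1 \<in> mprod S vr" by (intro mprodI that) (simp add: vr_def)
    then show ?thesis using e by auto
  qed
  show "\<exists>s\<in>S. s \<noteq> 0 \<and> v s = ?k"
  proof (rule ccontr)
    assume "\<not> ?thesis"
    then have "vge v (?k + 1) s" if "s \<in> S" for s using all[OF that] that by (force simp: vge_def)
    then have "mprod S vr \<subseteq> {y. vge v (?k + 1) y}"
      by (intro mprod_least addc_vge) (auto simp: vr_def intro: vge_mult0')
    moreover obtain x where "x \<noteq> 0" "v x = ?k" by (rule v_elt)
    moreover have "x \<in> mprod S vr" using \<open>v x = ?k\<close> by (subst e) (simp add: vge_def)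
    ultimately show False by (auto simp: vge_def)
  qed
qed

end

lemma max_idealsD:
  "P \<in> max_ideals A \<Longrightarrow> smod A J \<Longrightarrow> J \<subseteq> A \<Longrightarrow> P \<subseteq> J \<Longrightarrow> J = P \<or> J = A"
  by (auto simp: max_ideals_def ideal_in_def submod_smod)

lemma exists_max_ideal:
  assumes A: "sring A" and I: "smod A I" "I \<subseteq> A" "1 \<notin> I"
  obtains P where "P \<in> max_ideals A" "I \<subseteq> P"
proof -
  let ?S = "{J. smod A J \<and> J \<subseteq> A \<and> I \<subseteq> J \<and> 1 \<notin> J}"
  have "\<exists>M\<in>?S. \<forall>X\<in>?S. M \<subseteq> X \<longrightarrow> X = M"
  proof (rule subset_Zorn_nonempty)
    show "?S \<noteq> {}" using I by auto
    fix C assume C: "C \<noteq> {}" "subset.chain ?S C"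
    then have ch: "\<And>X Y. X \<in> C \<Longrightarrow> Y \<in> C \<Longrightarrow> X \<subseteq> Y \<or> Y \<subseteq> X" and CS: "C \<subseteq> ?S"
      by (auto simp: subset_chain_def)
    have "smod A (\<Union>C)" unfolding smod_def add_closed_def
    proof safe
      obtain X where "X \<in> C" using C by blast
      then have "smod A X" using CS by blast
      then show "0 \<in> \<Union>C" using \<open>X \<in> C\<close> by (auto simp: smod_def add_closed_def)
      fix x y X Y assume *: "x \<in> X" "X \<in> C" "y \<in> Y" "Y \<in> C"
      then obtain Z where Z: "Z \<in> C" "x \<in> Z" "y \<in> Z" using ch by (metis subsetD)
      then have "smod A Z" using CS by blast
      then have "x + y \<in> Z" using Z by (simp add: smod_def add_closed_def)
      then show "x + y \<in> \<Union>C" using Z by blast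
    next
      fix a x X assume *: "a \<in> A" "x \<in> X" "X \<in> C"
      then have "smod A X" using CS by blast
      then have "a * x \<in> X" using * by (simp add: smod_def)
      then show "a * x \<in> \<Union>C" using * by blast
    qed
    then show "\<Union>C \<in> ?S" using C CS by auto
  qed
  then obtain P where P: "P \<in> ?S" "\<forall>X\<in>?S. P \<subseteq> X \<longrightarrow> X = P" by (rule bexE)
  have "J = P \<or> J = A" if J: "smod A J" "J \<subseteq> A" "P \<subseteq> J" for J
  proof (cases "1 \<in> J")
    case True
    have "x \<in> J" if "x \<in> A" for x
    proof -
      have "x * 1 \<in> J" using J True that by (auto simp: smod_def simp del: mult_1_right)
      then show ?thesis by simp
    qed
    then show ?thesis using J by auto
  next
    case False
    then have "J \<in> ?S" using J P(1) by auto
    then show ?thesis using P(2) J by blast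
  qed
  then have "P \<in> max_ideals A"
    using P(1) A by (auto simp: max_ideals_def ideal_in_def submod_smod sring_def)
  then show ?thesis using that P by blast
qed

section \<open>Almost Dedekind domains and their overrings\<close>

locale almost_dedekind_domain =
  fixes D :: "'a::field set"
  assumes AD: "almost_dedekind D"
begin

abbreviation Mx where "Mx \<equiv> max_ideals D"
abbreviation loc where "loc M \<equiv> localization D M"

definition v :: "'a set \<Rightarrow> 'a \<Rightarrow> int" where
  "v M = (SOME w. (\<forall>x y. x \<noteq> 0 \<longrightarrow> y \<noteq> 0 \<longrightarrow> w (x * y) = w x + w y) \<and>
      (\<forall>x y. x \<noteq> 0 \<longrightarrow> y \<noteq> 0 \<longrightarrow> x + y \<noteq> 0 \<longrightarrow> min (w x) (w y) \<le> w (x + y)) \<and>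
      w ` (UNIV - {0}) = UNIV \<and>
      loc M = {x. x = 0 \<or> 0 \<le> w x})"

lemma sring_D: "sring D" and D_quotient: "\<exists>a\<in>D. \<exists>b\<in>D. b \<noteq> 0 \<and> z = a / b"
  using AD by (auto simp: almost_dedekind_def is_subring_sring has_qf_def)

lemma D_closed: "0 \<in> D" "1 \<in> D" "x \<in> D \<Longrightarrow> y \<in> D \<Longrightarrow> x + y \<in> D" "x \<in> D \<Longrightarrow> y \<in> D \<Longrightarrow> x * y \<in> D"
  "x \<in> D \<Longrightarrow> - x \<in> D"
  using sring_D by (auto simp: sring_def add_closed_def)

lemma D_diff: "x \<in> D \<Longrightarrow> y \<in> D \<Longrightarrow> x - y \<in> D"
  using D_closed(3)[OF _ D_closed(5)] by fastforce

lemma D_power: "x \<in> D \<Longrightarrow> x ^ n \<in> D"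
  by (induction n) (auto intro: D_closed)

lemma D_prod: "(\<And>i. i \<in> S \<Longrightarrow> f i \<in> D) \<Longrightarrow> prod f S \<in> D"
  by (induction S rule: infinite_finite_induct) (auto intro: D_closed)

lemma v_props: assumes "M \<in> Mx" shows "valn (v M)" "loc M = {x. vge (v M) 0 x}"
proof -
  let ?P = "\<lambda>w. (\<forall>x y. x \<noteq> 0 \<longrightarrow> y \<noteq> 0 \<longrightarrow> w (x * y) = w x + w y) \<and>
      (\<forall>x y. x \<noteq> 0 \<longrightarrow> y \<noteq> 0 \<longrightarrow> x + y \<noteq> 0 \<longrightarrow> min (w x) (w y) \<le> w (x + y)) \<and>
      w ` (UNIV - {0}) = UNIV \<and> loc M = {x. x = 0 \<or> 0 \<le> (w x :: int)}"
  have "\<exists>w. ?P w" using AD assms unfolding almost_dedekind_def is_DVR_def by blast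
  then have *: "?P (v M)" unfolding v_def by (rule someI_ex)
  then show "valn (v M)" "loc M = {x. vge (v M) 0 x}" by (unfold_locales, auto simp: vge_def)
qed

lemma loc_vr: "M \<in> Mx \<Longrightarrow> valn.vr (v M) = loc M"
  by (simp add: v_props valn.vr_def)

lemma sring_loc: "M \<in> Mx \<Longrightarrow> sring (loc M)"
  using valn.sring_vr[OF v_props(1)] loc_vr by metis

lemma MxD: assumes "M \<in> Mx" shows "smod D M" "M \<subseteq> D" "1 \<notin> M"
proof -
  show *: "smod D M" "M \<subseteq> D" using assms by (auto simp: max_ideals_def ideal_in_def submod_smod)
  show "1 \<notin> M"
  proof
    assume 1: "1 \<in> M"
    have "x \<in> M" if "x \<in> D" for x
      using * 1 that unfolding smod_def by (metis mult.right_neutral)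
    then show False using * assms by (auto simp: max_ideals_def)
  qed
qed

lemma locI: "a \<in> D \<Longrightarrow> s \<in> D \<Longrightarrow> s \<notin> M \<Longrightarrow> a / s \<in> loc M"
  by (auto simp: localization_def)

lemma D_loc: "M \<in> Mx \<Longrightarrow> D \<subseteq> loc M"
  using locI[OF _ D_closed(2) MxD(3)] by fastforce

lemma D_vge: "M \<in> Mx \<Longrightarrow> x \<in> D \<Longrightarrow> vge (v M) 0 x"
  using D_loc v_props(2) by auto

lemma unit_v: assumes "M \<in> Mx" "s \<in> D" "s \<notin> M" shows "s \<noteq> 0" "v M s = 0"
proof -
  interpret valn "v M" using assms by (intro v_props)
  have "0 \<in> M" using MxD(1)[OF assms(1)] by (simp add: smod_def add_closed_def)
  then show s: "s \<noteq> 0" using assms by auto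
  have "1 / s \<in> loc M" using locI D_closed assms by blast
  then have "vge (v M) 0 (1 / s)" "vge (v M) 0 s" using assms v_props(2) D_vge by auto
  then show "v M s = 0" using s by (auto simp: vge_def v_divide)
qed

lemma M_iff: assumes "M \<in> Mx" "x \<in> D" shows "x \<in> M \<longleftrightarrow> vge (v M) 1 x"
proof
  interpret valn "v M" using assms by (intro v_props)
  show "vge (v M) 1 x \<Longrightarrow> x \<in> M" using unit_v[OF assms] by (cases "x \<in> M") (auto simp: vge_def)
  assume x: "x \<in> M"
  show "vge (v M) 1 x"
  proof (rule ccontr)
    assume n: "\<not> vge (v M) 1 x"
    then have x0: "x \<noteq> 0" by auto
    have "vge (v M) 0 (1 / x)" using n x0 by (auto simp: vge_def v_divide)
    then have "1 / x \<in> loc M" using v_props(2)[OF assms(1)] by simp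
    then obtain a b where ab: "1 / x = a / b" "a \<in> D" "b \<in> D" "b \<notin> M"
      by (auto simp: localization_def)
    then have "b = a * x" using x0 unit_v[OF assms(1) ab(3,4)] by (simp add: field_simps)
    then show False using ab x MxD(1)[OF assms(1)] by (auto simp: smod_def)
  qed
qed

lemma locE: assumes "M \<in> Mx" "vge (v M) 0 x"
  obtains a s where "a \<in> D" "s \<in> D" "s \<notin> M" "s \<noteq> 0" "v M s = 0" "x = a / s"
proof -
  have "x \<in> loc M" using v_props(2) assms by auto
  then obtain a s where "a \<in> D" "s \<in> D" "s \<notin> M" "x = a / s" by (auto simp: localization_def)
  then show ?thesis using that unit_v assms by blast
qed

lemma M_prime: "M \<in> Mx \<Longrightarrow> s \<in> D \<Longrightarrow> s \<notin> M \<Longrightarrow> t \<in> D \<Longrightarrow> t \<notin> M \<Longrightarrow> s * t \<in> D \<and> s * t \<notin> M"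
  using M_iff[of M "s * t"] unit_v[of M s] unit_v[of M t] valn.v_mult[OF v_props(1), of M s t] D_closed(4)
  by (auto simp: vge_def)

lemma M_prime_prod:
  assumes "M \<in> Mx" "\<And>i. i \<in> S \<Longrightarrow> f i \<in> D \<and> f i \<notin> M" shows "prod f S \<in> D \<and> prod f S \<notin> M"
  using assms(2) by (induction S rule: infinite_finite_induct)
    (use M_prime[OF assms(1)] D_closed MxD(3)[OF assms(1)] in auto)

lemma unit_mod: assumes M: "M \<in> Mx" and s: "s \<in> D" "s \<notin> M"
  obtains t m where "t \<in> D" "m \<in> M" "s * t = 1 - m"
proof -
  let ?J = "{m + s * t | m t. m \<in> M \<and> t \<in> D}"
  note MM = MxD[OF M]
  have "smod D ?J" unfolding smod_def add_closed_def
  proof safe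
    show "\<exists>m t. 0 = m + s * t \<and> m \<in> M \<and> t \<in> D"
      using MM D_closed by (intro exI[of _ 0]) (auto simp: smod_def add_closed_def)
    fix m t m' t' assume *: "m \<in> M" "t \<in> D" "m' \<in> M" "t' \<in> D"
    then show "\<exists>m'' t''. m + s * t + (m' + s * t') = m'' + s * t'' \<and> m'' \<in> M \<and> t'' \<in> D"
      using MM D_closed
      by (intro exI[of _ "m + m'"] exI[of _ "t + t'"]) (auto simp: smod_def add_closed_def algebra_simps)
    fix a assume "a \<in> D"
    then show "\<exists>m'' t''. a * (m + s * t) = m'' + s * t'' \<and> m'' \<in> M \<and> t'' \<in> D" using * MM D_closed
      by (intro exI[of _ "a * m"] exI[of _ "a * t"]) (auto simp: smod_def add_closed_def algebra_simps)
  qed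
  moreover have "?J \<subseteq> D" using MM s D_closed by blast
  moreover have "M \<subseteq> ?J"
  proof
    fix m assume "m \<in> M"
    then have "m = m + s * 0 \<and> m \<in> M \<and> 0 \<in> D" using D_closed by simp
    then show "m \<in> ?J" by blast
  qed
  moreover have "s \<in> ?J"
  proof -
    have "s = 0 + s * 1 \<and> 0 \<in> M \<and> 1 \<in> D" using D_closed MM by (simp add: smod_def add_closed_def)
    then show ?thesis by blast
  qed
  ultimately have "?J = D" using max_idealsD[OF M, of ?J] s by blast
  then obtain m t where "1 = m + s * t" "m \<in> M" "t \<in> D" using D_closed(2) by blast
  then show ?thesis using that[of t m] by (simp add: algebra_simps)
qed

lemma unit_mod_power: assumes M: "M \<in> Mx" and s: "s \<in> D" "s \<notin> M"
  obtains t where "t \<in> D" "vge (v M) (int n) (1 - s * t)"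
proof -
  interpret valn "v M" using M by (rule v_props)
  obtain t m where tm: "t \<in> D" "m \<in> M" "s * t = 1 - m" using unit_mod[OF M s] .
  have mD: "m \<in> D" using MxD[OF M] tm by blast
  \<comment> \<open>As s t = 1 - m, the witness is t (1 + m + ... + m^(k-1)), a truncated geometric
    series.\<close>
  have "\<exists>t'\<in>D. 1 - s * t' = m ^ k" for k
  proof (induction k)
    case 0
    then show ?case using D_closed by (intro bexI[of _ 0]) auto
  next
    case (Suc k)
    then obtain t' where t': "t' \<in> D" "1 - s * t' = m ^ k" by blast
    have "1 - s * (t + t' * m) = (1 - s * t) - s * t' * m" by (simp add: algebra_simps)
    also have "\<dots> = m * (1 - s * t')" using tm by (simp add: algebra_simps)
    finally show ?case using t' tm mD D_closed by (intro bexI[of _ "t + t' * m"]) auto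
  qed
  then obtain t' where "t' \<in> D" "1 - s * t' = m ^ n" by blast
  moreover have "vge (v M) (int n) (m ^ n)"
  proof (cases "m = 0")
    case False
    have "vge (v M) 1 m" using M_iff[OF M mD] tm by blast
    then show ?thesis using False by (simp add: vge_def v_power mult_left_mono[of 1 "v M m" "int n", simplified])
  qed (cases n, auto)
  ultimately show ?thesis using that by metis
qed

text \<open>A denominator outside M has an inverse in D modulo every power of M. The resulting
  density of D in D_M lets values on D decide integrality on D_M.\<close>

lemma loc_dense: assumes M: "M \<in> Mx" and x: "vge (v M) 0 x"
  obtains a where "a \<in> D" "vge (v M) (int n) (x - a)"
proof -
  interpret valn "v M" using M by (rule v_props)
  obtain b s where bs: "b \<in> D" "s \<in> D" "s \<notin> M" "s \<noteq> 0" "v M s = 0" "x = b / s" using locE[OF M x] .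
  obtain t where t: "t \<in> D" "vge (v M) (int n) (1 - s * t)" using unit_mod_power[OF M bs(2,3)] .
  have "x - b * t = x * (1 - s * t)" using bs by (simp add: field_simps)
  then show ?thesis using that[of "b * t"] vge_mult0[OF x t(2)] D_closed(4)[OF bs(1) t(1)] by simp
qed

text \<open>Take a maximal ideal P of T above I. Clearing the denominator of c gives a nonzero
  element of the prime ideal formed by P and D, which must then be some M, because D_M has no
  nonzero primes below M. The element c excludes the zero ideal of T = K, a ring contained in no
  D_M.\<close>

lemma overring_max:
  assumes T: "sring T" "D \<subseteq> T" and I: "smod T I" "I \<subseteq> T" "1 \<notin> I" and nz: "c \<in> I" "c \<noteq> 0"
  obtains M where "M \<in> Mx" "T \<subseteq> loc M" "\<forall>x\<in>I. vge (v M) 1 x"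
proof -
  obtain P where P: "P \<in> max_ideals T" "I \<subseteq> P" using exists_max_ideal[OF T(1) I] .
  have PT: "smod T P" "P \<subseteq> T" using P by (auto simp: max_ideals_def ideal_in_def submod_smod)
  have T': "x \<in> T \<Longrightarrow> y \<in> T \<Longrightarrow> x * y \<in> T" "x \<in> T \<Longrightarrow> y \<in> T \<Longrightarrow> x + y \<in> T" "1 \<in> T" "0 \<in> T" "x \<in> T \<Longrightarrow> - x \<in> T" for x y
    using T by (auto simp: sring_def add_closed_def)
  have P': "x \<in> T \<Longrightarrow> y \<in> P \<Longrightarrow> x * y \<in> P" "x \<in> P \<Longrightarrow> y \<in> P \<Longrightarrow> x + y \<in> P" "0 \<in> P" for x y
    using PT by (auto simp: smod_def add_closed_def)
  have P1: "1 \<notin> P"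
  proof
    assume "1 \<in> P"
    then have "T \<subseteq> P" using P'(1) by (metis mult.right_neutral subsetI)
    then show False using PT P by (auto simp: max_ideals_def)
  qed
  have prime: "x \<in> P \<or> y \<in> P" if xy: "x \<in> T" "y \<in> T" "x * y \<in> P" for x y
  proof (rule ccontr)
    assume n: "\<not> ?thesis"
    let ?J = "{p + x * t | p t. p \<in> P \<and> t \<in> T}"
    have "smod T ?J" unfolding smod_def add_closed_def
    proof safe
      show "\<exists>m t. 0 = m + x * t \<and> m \<in> P \<and> t \<in> T"
        using P' T' by (intro exI[of _ 0]) auto
      fix m t m' t' assume *: "m \<in> P" "t \<in> T" "m' \<in> P" "t' \<in> T"
      then show "\<exists>m'' t''. m + x * t + (m' + x * t') = m'' + x * t'' \<and> m'' \<in> P \<and> t'' \<in> T"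
        using P' T' by (intro exI[of _ "m + m'"] exI[of _ "t + t'"]) (auto simp: algebra_simps)
      fix a assume "a \<in> T"
      then show "\<exists>m'' t''. a * (m + x * t) = m'' + x * t'' \<and> m'' \<in> P \<and> t'' \<in> T" using * P' T'
        by (intro exI[of _ "a * m"] exI[of _ "a * t"]) (auto simp: algebra_simps)
    qed
    moreover have "?J \<subseteq> T" using PT xy T' by blast
    moreover have "P \<subseteq> ?J"
    proof
      fix m assume "m \<in> P"
      then have "m = m + x * 0 \<and> m \<in> P \<and> 0 \<in> T" using T' by simp
      then show "m \<in> ?J" by blast
    qed
    moreover have "x \<in> ?J"
    proof -
      have "x = 0 + x * 1 \<and> 0 \<in> P \<and> 1 \<in> T" using T' P' by simp
      then show ?thesis by blast
    qed
    ultimately have "?J = T" using max_idealsD[OF P(1), of ?J] n by blast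
    then have "1 \<in> ?J" using T'(3) by simp
    then obtain p t where pt: "1 = p + x * t" "p \<in> P" "t \<in> T" by blast
    have "y = y * (p + x * t)" using pt(1)[symmetric] by simp
    also have "\<dots> = y * p + t * (x * y)" by (simp add: algebra_simps)
    also have "\<dots> \<in> P" by (intro P' pt xy)
    finally have "y \<in> P" .
    then show False using n by blast
  qed
  let ?N = "P \<inter> D"
  have N: "smod D ?N" "?N \<subseteq> D" "1 \<notin> ?N"
    using P' P1 T D_closed by (auto simp: smod_def add_closed_def)
  obtain M where M: "M \<in> Mx" "?N \<subseteq> M" using exists_max_ideal[OF sring_D N] .
  interpret valn "v M" using M by (intro v_props)
  obtain a b where ab: "a \<in> D" "b \<in> D" "b \<noteq> 0" "c = a / b" using D_quotient by blast
  have "b * c \<in> P" using ab P nz T by (intro P') auto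
  then have aN: "a \<in> ?N" "a \<noteq> 0" using ab nz by auto
  have MN: "M \<subseteq> ?N"
  proof
    fix m assume m: "m \<in> M"
    then have mD: "m \<in> D" using MxD[OF M(1)] by blast
    have pw: "m ^ k \<in> P \<Longrightarrow> m \<in> P" for k
    proof (induction k)
      case (Suc k)
      then have "m \<in> P \<or> m ^ k \<in> P" using prime[of m "m ^ k"] mD T(2) D_power[OF mD, of k] by auto
      then show ?case using Suc.IH by blast
    qed (use P1 in simp)
    show "m \<in> ?N"
    proof (cases "m = 0")
      case False
      \<comment> \<open>With this exponent a divides m^k in D_M. Clearing a denominator s outside M
        puts s m^k into P, and primality leaves only m in P.\<close>
      define k where "k = nat (v M a)"
      have va: "0 \<le> v M a" using D_vge[OF M(1), of a] aN by (auto simp: vge_def)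
      have vm: "1 \<le> v M m" using M_iff[OF M(1) mD] m False by (auto simp: vge_def)
      then have "int k * 1 \<le> int k * v M m" by (intro mult_left_mono) auto
      then have "vge (v M) 0 (m ^ k / a)" using va False aN by (auto simp: vge_def v_divide v_power k_def)
      then obtain d s where ds: "d \<in> D" "s \<in> D" "s \<notin> M" "s \<noteq> 0" "m ^ k / a = d / s" using locE[OF M(1)] by metis
      then have "s * m ^ k = d * a" using aN by (simp add: field_simps)
      then have "s * m ^ k \<in> P" using aN ds T by (auto intro: P')
      then have "s \<in> P \<or> m ^ k \<in> P" using ds T D_power[OF mD] by (intro prime) auto
      then show ?thesis using pw ds M mD by blast
    qed (use P' D_closed in auto)
  qed
  have TM: "T \<subseteq> loc M"
  proof
    fix t assume t: "t \<in> T"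
    show "t \<in> loc M"
    proof (rule ccontr)
      assume "t \<notin> loc M"
      then have t0: "t \<noteq> 0" "v M t < 0" using v_props(2)[OF M(1)] by (auto simp: vge_def)
      then have "vge (v M) 0 (1 / t)" by (auto simp: vge_def v_divide)
      then obtain b s where bs: "b \<in> D" "s \<in> D" "s \<notin> M" "s \<noteq> 0" "v M s = 0" "1 / t = b / s" using locE[OF M(1)] by metis
      \<comment> \<open>Since 1 / t is a nonunit of D_M, its numerator b lies in M, hence in P; then
        s = t b lies in P and D, that is, in M.\<close>
      have sb: "s = t * b" using bs t0 by (simp add: field_simps)
      have "b \<noteq> 0" using sb bs by auto
      then have "v M b > 0" using sb t0 bs v_mult[of t b] by auto
      then have "b \<in> M" using M_iff[OF M(1) bs(1)] by (auto simp: vge_def)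
      then have "s \<in> P" using sb MN t P' by auto
      then show False using bs M by auto
    qed
  qed
  have "vge (v M) 1 x" if x: "x \<in> I" for x
  proof (rule ccontr)
    assume n: "\<not> vge (v M) 1 x"
    have "vge (v M) 0 x" using x I TM v_props(2)[OF M(1)] by auto
    then obtain b s where bs: "b \<in> D" "s \<in> D" "s \<notin> M" "s \<noteq> 0" "v M s = 0" "x = b / s" using locE[OF M(1)] by metis
    have "s * x \<in> P" using x P bs T by (intro P') auto
    then have "b \<in> M" using bs M by auto
    then have "vge (v M) 1 b" using M_iff[OF M(1) bs(1)] by blast
    then show False using n bs by (auto simp: vge_def v_divide)
  qed
  then show ?thesis using that M TM by blast
qed

text \<open>Otherwise the ideal of all t in T with t x in T is proper and lies in some M with T
  inside D_M; but it contains a denominator of x outside M. So an overring is the intersection of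
  the localizations above it.\<close>

lemma overring_eqI:
  assumes T: "sring T" "D \<subseteq> T" and x: "\<And>M. M \<in> Mx \<Longrightarrow> T \<subseteq> loc M \<Longrightarrow> vge (v M) 0 x"
  shows "x \<in> T"
proof (rule ccontr)
  assume n: "x \<notin> T"
  let ?I = "{t \<in> T. t * x \<in> T}"
  have T': "x \<in> T \<Longrightarrow> y \<in> T \<Longrightarrow> x * y \<in> T" "x \<in> T \<Longrightarrow> y \<in> T \<Longrightarrow> x + y \<in> T" "1 \<in> T" "0 \<in> T" for x y
    using T by (auto simp: sring_def add_closed_def)
  obtain a b where ab: "a \<in> D" "b \<in> D" "b \<noteq> 0" "x = a / b" using D_quotient by blast
  have "smod T ?I" using T' by (auto simp: smod_def add_closed_def distrib_right mult.assoc)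
  moreover have "1 \<notin> ?I" using n by simp
  moreover have "b \<in> ?I" using ab T by auto
  ultimately obtain M where M: "M \<in> Mx" "T \<subseteq> loc M" "\<forall>y\<in>?I. vge (v M) 1 y"
    using overring_max[OF T, of ?I b] ab by blast
  obtain c s where cs: "c \<in> D" "s \<in> D" "s \<notin> M" "s \<noteq> 0" "v M s = 0" "x = c / s"
    using locE[OF M(1) x[OF M(1,2)]] by metis
  have "s \<in> ?I" using cs T by auto
  then show False using bspec[OF M(3), of s] cs by (auto simp: vge_def)
qed

lemma D_eqI: "(\<And>M. M \<in> Mx \<Longrightarrow> vge (v M) 0 x) \<Longrightarrow> x \<in> D"
  using overring_eqI[OF sring_D] by blast

text \<open>At each M a generator of least value divides the others in D_M. Up to a denominator
  outside M its inverse lies in the dual module, so the product of module and dual is not contained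
  in M.\<close>

lemma pruefer:
  assumes W: "finite W" "w \<in> W" "w \<noteq> 0" shows "mprod W D \<in> INV D"
proof -
  let ?F = "mprod W D" let ?G = "{x. \<forall>w\<in>W. x * w \<in> D}"
  have G: "smod D ?G" using D_closed by (auto simp: smod_def add_closed_def distrib_right mult.assoc)
  have F: "smod D ?F" by (simp add: smod_mprod2 smod_self sring_D)
  have FG: "mprod ?F ?G \<subseteq> D"
  proof -
    have "mprod ?F ?G = mprod D (mprod W ?G)" by (simp add: mprod_ac)
    also have "\<dots> \<subseteq> mprod D D"
      by (intro mprod_mono mprod_least) (use sring_D in \<open>auto simp: sring_def mult.commute\<close>)
    finally show ?thesis using sring_D by (simp add: sring_idem)
  qed
  have wF: "W \<subseteq> ?F" using mprodI[of _ W 1 D] D_closed by fastforce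
  have "1 \<in> mprod ?F ?G"
  proof (rule ccontr)
    assume n: "1 \<notin> mprod ?F ?G"
    define d where "d = (\<lambda>w. SOME b. b \<in> D \<and> b \<noteq> 0 \<and> b * w \<in> D)"
    have d: "d w \<in> D \<and> d w \<noteq> 0 \<and> d w * w \<in> D" for w
    proof -
      obtain a b where "a \<in> D" "b \<in> D" "b \<noteq> 0" "w = a / b" using D_quotient by blast
      then have "b \<in> D \<and> b \<noteq> 0 \<and> b * w \<in> D" by simp
      then show ?thesis unfolding d_def by (rule someI)
    qed
    have dG: "prod d W \<in> ?G"
    proof clarify
      fix w assume "w \<in> W"
      then have "prod d W * w = d w * w * prod d (W - {w})" using W by (simp add: prod.remove ac_simps)
      then show "prod d W * w \<in> D" using d D_prod D_closed(4) by metis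
    qed
    then have nz: "w * prod d W \<in> mprod ?F ?G" "w * prod d W \<noteq> 0"
      using W wF d by (auto intro: mprodI)
    obtain M where M: "M \<in> Mx" "D \<subseteq> loc M" "\<forall>x\<in>mprod ?F ?G. vge (v M) 1 x"
      by (rule overring_max[OF sring_D subset_refl smod_mprod[OF F] FG n nz])
    interpret valn "v M" using M by (intro v_props)
    obtain w0 where w0: "w0 \<in> W" "w0 \<noteq> 0" "\<And>u. u \<in> W \<Longrightarrow> u \<noteq> 0 \<Longrightarrow> v M w0 \<le> v M u"
      using ex_min_if_finite[of "v M ` (W - {0})"] W by (force simp: not_less)
    have "\<exists>s. s \<in> D \<and> s \<notin> M \<and> s * (u / w0) \<in> D" if "u \<in> W" for u
    proof -
      have "vge (v M) 0 (u / w0)" using w0 that by (cases "u = 0") (auto simp: vge_def v_divide)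
      then obtain a s where "a \<in> D" "s \<in> D" "s \<notin> M" "s \<noteq> 0" "u / w0 = a / s" using locE[OF M(1)] by metis
      then show ?thesis by (intro exI[of _ s]) auto
    qed
    then obtain s where s: "\<And>u. u \<in> W \<Longrightarrow> s u \<in> D \<and> s u \<notin> M \<and> s u * (u / w0) \<in> D" by metis
    have pD: "prod s W \<in> D \<and> prod s W \<notin> M" using M_prime_prod[OF M(1), of W s] s by simp
    have "prod s W / w0 \<in> ?G"
    proof clarify
      fix u assume u: "u \<in> W"
      then have "prod s W / w0 * u = s u * (u / w0) * prod s (W - {u})" using W by (simp add: prod.remove ac_simps)
      moreover have "prod s (W - {u}) \<in> D" using s by (intro D_prod) auto
      ultimately show "prod s W / w0 * u \<in> D" using s u D_closed(4) by metis
    qed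
    then have "w0 * (prod s W / w0) \<in> mprod ?F ?G" using w0 wF by (intro mprodI) auto
    then have "vge (v M) 1 (prod s W)" using bspec[OF M(3), of "w0 * (prod s W / w0)"] w0(2) by simp
    then show False using pD M_iff[OF M(1)] by blast
  qed
  then have "D \<subseteq> mprod ?F ?G"
    by (rule smod_one[OF smod_mprod[OF F]])
  then show ?thesis using FG F G by (intro INV_I[of _ _ ?G]) auto
qed

end

section \<open>The derived sequence\<close>

definition is_zero :: "'o::wellorder \<Rightarrow> bool" where
  "is_zero \<alpha> \<longleftrightarrow> (\<forall>\<beta>. \<not> \<beta> < \<alpha>)"

definition is_pred :: "'o::wellorder \<Rightarrow> 'o \<Rightarrow> bool" where
  "is_pred \<beta> \<alpha> \<longleftrightarrow> \<beta> < \<alpha> \<and> (\<forall>\<gamma>. \<not> (\<beta> < \<gamma> \<and> \<gamma> < \<alpha>))"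

definition is_limit :: "'o::wellorder \<Rightarrow> bool" where
  "is_limit \<alpha> \<longleftrightarrow> \<not> is_zero \<alpha> \<and> \<not> (\<exists>\<beta>. is_pred \<beta> \<alpha>)"

lemma ordinal_cases:
  obtains "is_zero \<alpha>" | \<beta> where "is_pred \<beta> \<alpha>" | "is_limit \<alpha>"
  unfolding is_limit_def by blast

lemma is_pred_unique: "is_pred \<beta> \<alpha> \<Longrightarrow> is_pred \<gamma> \<alpha> \<Longrightarrow> \<beta> = \<gamma>"
  unfolding is_pred_def by (meson linorder_neqE)

lemma is_pred_the: "is_pred \<beta> \<alpha> \<Longrightarrow> (THE \<beta>. \<beta> < \<alpha> \<and> (\<forall>\<gamma>. \<not> (\<beta> < \<gamma> \<and> \<gamma> < \<alpha>))) = \<beta>"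
  unfolding is_pred_def[symmetric] by (rule the_equality) (auto dest: is_pred_unique)

lemma is_pred_le: "is_pred \<beta> \<alpha> \<Longrightarrow> \<gamma> < \<alpha> \<Longrightarrow> \<gamma> \<le> \<beta>"
  unfolding is_pred_def by (meson not_le)

lemma derived_unfold:
  "derived \<Theta> \<alpha> = (let N = cut (derived \<Theta>) {(x, y). x < y} \<alpha> in
     if (\<forall>\<beta>. \<not> \<beta> < \<alpha>) then \<Theta>
     else if (\<exists>\<beta>. \<beta> < \<alpha> \<and> (\<forall>\<gamma>. \<not> (\<beta> < \<gamma> \<and> \<gamma> < \<alpha>))) then
       (let \<beta> = (THE \<beta>. \<beta> < \<alpha> \<and> (\<forall>\<gamma>. \<not> (\<beta> < \<gamma> \<and> \<gamma> < \<alpha>)))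
        in {T \<in> N \<beta>. \<not> jaffard_overring (\<Inter> (N \<beta>)) T})
     else (\<Inter>\<beta>\<in>{\<beta>. \<beta> < \<alpha>}. N \<beta>))"
  by (subst derived_def[abs_def], subst wfrec[OF wf]) (simp add: derived_def[abs_def] Let_def)

lemma derived_zero: "is_zero \<alpha> \<Longrightarrow> derived \<Theta> \<alpha> = \<Theta>"
  by (subst derived_unfold) (simp add: is_zero_def)

lemma derived_succ: assumes "is_pred \<beta> \<alpha>"
  shows "derived \<Theta> \<alpha> = {T \<in> derived \<Theta> \<beta>. \<not> jaffard_overring (\<Inter> (derived \<Theta> \<beta>)) T}"
proof -
  have 1: "\<not> (\<forall>\<beta>. \<not> \<beta> < \<alpha>)" "\<exists>\<beta>. \<beta> < \<alpha> \<and> (\<forall>\<gamma>. \<not> (\<beta> < \<gamma> \<and> \<gamma> < \<alpha>))" "\<beta> < \<alpha>"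
    using assms by (auto simp: is_pred_def)
  show ?thesis
    by (subst derived_unfold) (simp only: Let_def 1 if_True if_False is_pred_the[OF assms], simp add: cut_apply 1)
qed

lemma derived_limit: assumes "is_limit \<alpha>" shows "derived \<Theta> \<alpha> = (\<Inter>\<beta>\<in>{\<beta>. \<beta> < \<alpha>}. derived \<Theta> \<beta>)"
proof -
  have 1: "\<not> (\<forall>\<beta>. \<not> \<beta> < \<alpha>)" "\<not> (\<exists>\<beta>. \<beta> < \<alpha> \<and> (\<forall>\<gamma>. \<not> (\<beta> < \<gamma> \<and> \<gamma> < \<alpha>)))"
    using assms by (auto simp: is_limit_def is_pred_def is_zero_def)
  show ?thesis
    by (subst derived_unfold) (simp only: Let_def 1 if_True if_False, simp add: cut_apply)
qed

lemma derived_antimono: "\<beta> \<le> \<alpha> \<Longrightarrow> derived \<Theta> \<alpha> \<subseteq> derived \<Theta> \<beta>"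
proof (induction \<alpha> rule: less_induct)
  case (less \<alpha>)
  show ?case
  proof (cases "\<beta> = \<alpha>")
    case False
    then have lt: "\<beta> < \<alpha>" using less by simp
    show ?thesis
    proof (cases \<alpha> rule: ordinal_cases)
      case 1
      then show ?thesis using lt by (auto simp: is_zero_def)
    next
      case (2 \<gamma>)
      then have "derived \<Theta> \<gamma> \<subseteq> derived \<Theta> \<beta>" using less.IH is_pred_le[OF 2 lt] by (simp add: is_pred_def)
      then show ?thesis using derived_succ[OF 2] by blast
    next
      case 3
      then show ?thesis using lt by (auto simp: derived_limit)
    qed
  qed simp
qed

lemma derived_subset: "derived \<Theta> (\<alpha>::'o::wellorder) \<subseteq> \<Theta>"
proof -
  define z where "z = (LEAST x::'o. True)"
  have z: "z \<le> x" for x unfolding z_def by (rule Least_le) simp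
  then have "is_zero z" by (simp add: is_zero_def not_less)
  then show ?thesis using derived_antimono[OF z] derived_zero by metis
qed

context almost_dedekind_domain
begin

lemma D_elt: assumes "M \<in> Mx" "0 \<le> k" obtains a where "a \<in> D" "a \<noteq> 0" "v M a = k"
proof -
  interpret valn "v M" using assms by (intro v_props)
  obtain x where x: "x \<noteq> 0" "v M x = k" by (rule v_elt)
  then have "vge (v M) 0 x" using assms by (simp add: vge_def)
  then obtain a s where as: "a \<in> D" "s \<in> D" "s \<notin> M" "s \<noteq> 0" "v M s = 0" "x = a / s"
    using locE[OF assms(1)] by metis
  then have "a \<noteq> 0" using x by auto
  then show ?thesis using that as x by (simp add: v_divide)
qed

lemma loc_proper: assumes "M \<in> Mx" shows "\<exists>x. x \<notin> loc M"
proof -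
  interpret valn "v M" using assms by (intro v_props)
  obtain x where "x \<noteq> 0" "v M x = -1" by (rule v_elt)
  then show ?thesis using v_props(2)[OF assms] by (auto simp: vge_def)
qed

lemma loc_incl: assumes "M \<in> Mx" "L \<in> Mx" "loc M \<subseteq> loc L" shows "M = L"
proof -
  interpret valn "v L" using assms by (intro v_props)
  have "L \<subseteq> M"
  proof
    fix x assume x: "x \<in> L"
    show "x \<in> M"
    proof (rule ccontr)
      assume "x \<notin> M"
      then have n: "x \<in> D" "x \<notin> M" "x \<noteq> 0" using x MxD[OF assms(2)] unit_v[OF assms(1)] by auto
      then have "1 / x \<in> loc M" by (intro locI D_closed)
      then have "vge (v L) 0 (1 / x)" using assms(3) v_props(2)[OF assms(2)] by auto
      moreover have "vge (v L) 1 x" using M_iff[OF assms(2) n(1)] x by simp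
      ultimately show False using n by (auto simp: vge_def v_divide)
    qed
  qed
  then show ?thesis using max_idealsD[OF assms(2) MxD(1,2)[OF assms(1)]] MxD(3)[OF assms(1)] D_closed(2) by blast
qed

text \<open>Let d have value 1 at M. Local finiteness leaves finitely many other members in which d
  is not a unit, and in each of them some finitely generated ideal inside M becomes the unit ideal.
  Together with d these generate an ideal inside M that is trivial in every member but D_M; its
  inverse has a pole at M and is integral in the other members.\<close>

lemma jaffard_isolated:
  assumes R: "sring R" "D \<subseteq> R" and M: "M \<in> Mx" "R \<subseteq> loc M" and J: "jaffard_overring R (loc M)"
  obtains z where "z \<noteq> 0" "v M z = -1" "\<forall>L\<in>Mx. R \<subseteq> loc L \<longrightarrow> L \<noteq> M \<longrightarrow> vge (v L) 0 z"
proof -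
  interpret valn "v M" using M by (intro v_props)
  obtain \<Theta> where pj: "pre_jaffard R \<Theta>" and lf: "locally_finite R \<Theta>" and MT: "loc M \<in> \<Theta>"
    using J by (auto simp: jaffard_overring_def jaffard_family_def)
  have S: "sring S" "R \<subseteq> S" "D \<subseteq> S" if "S \<in> \<Theta>" for S
    using pj that R by (auto simp: pre_jaffard_def overrings_def is_subring_sring)
  have compl: "I = (\<Inter>S\<in>\<Theta>. mprod I S)" if "smod R I" "I \<subseteq> R" for I
  proof -
    have "\<forall>I. ideal_in R I \<longrightarrow> I = (\<Inter>S\<in>\<Theta>. mprod I S)" using pj by (simp add: pre_jaffard_def ext_eq_mprod)
    then show ?thesis using that by (simp add: ideal_in_def submod_smod)
  qed
  have indep: "mprod (loc M) S = UNIV" if "S \<in> \<Theta>" "S \<noteq> loc M" for S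
    using pj that MT by (auto simp: pre_jaffard_def fsums_setprod_eq)
  \<comment> \<open>Independence: a member S inside D_M would give D_M S = D_M, which is not
    K.\<close>
  have a: "\<exists>y\<in>S. \<not> vge (v M) 0 y" if SS: "S \<in> \<Theta>" "S \<noteq> loc M" for S
  proof (rule ccontr)
    assume "\<not> ?thesis"
    then have "S \<subseteq> loc M" using v_props(2)[OF M(1)] by auto
    then have "mprod (loc M) S \<subseteq> mprod (loc M) (loc M)" by (intro mprod_mono) auto
    then show False using indep[OF SS] sring_idem[OF sring_loc[OF M(1)]] loc_proper[OF M(1)] by auto
  qed
  \<comment> \<open>Completeness, applied to the contraction of the maximal ideal of D_L to R,
    yields a member in which it stays proper; the maximal ideal of D found above it contains L and
    so equals L.\<close>
  have b: "\<exists>S\<in>\<Theta>. S \<noteq> loc M \<and> S \<subseteq> loc L" if L: "L \<in> Mx" "R \<subseteq> loc L" "L \<noteq> M" for L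
  proof -
    interpret L: valn "v L" using L by (intro v_props)
    let ?I = "{x \<in> R. vge (v L) 1 x}"
    have I: "smod R ?I" "?I \<subseteq> R" "1 \<notin> ?I"
    proof -
      show "smod R ?I" using R(1) L(2) v_props(2)[OF L(1)]
        by (auto simp: smod_def add_closed_def sring_def intro: L.vge_add L.vge_mult0)
    qed auto
    then obtain S where SS: "S \<in> \<Theta>" "1 \<notin> mprod ?I S" using compl[OF I(1,2)] by blast
    have sub: "mprod ?I S \<subseteq> S"
      using S[OF SS(1)] by (intro mprod_least) (auto simp: sring_def)
    have 1: "1 \<in> S" using S[OF SS(1)] by (simp add: sring_def)
    obtain c where c: "c \<in> D" "c \<noteq> 0" "v L c = 1" using D_elt[OF L(1), of 1] by auto
    have Lsub: "x \<in> mprod ?I S" if "x \<in> D" "vge (v L) 1 x" for x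
    proof -
      have "x \<in> ?I" using that R by auto
      then have "x * 1 \<in> mprod ?I S" using 1 by (rule mprodI)
      then show ?thesis by simp
    qed
    have "c \<in> mprod ?I S" using c by (intro Lsub) (auto simp: vge_def)
    then obtain L' where L': "L' \<in> Mx" "S \<subseteq> loc L'" "\<forall>x\<in>mprod ?I S. vge (v L') 1 x"
      using overring_max[OF S(1)[OF SS(1)] S(3)[OF SS(1)] _ sub SS(2) _ c(2)]
        smod_mprod2[OF smod_self[OF S(1)[OF SS(1)]]] by blast
    have "L \<subseteq> L'"
    proof
      fix x assume x: "x \<in> L"
      then have xD: "x \<in> D" using MxD[OF L(1)] by blast
      then have "vge (v L) 1 x" using x M_iff[OF L(1)] by blast
      then have "vge (v L') 1 x" using Lsub[OF xD] L'(3) by blast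
      then show "x \<in> L'" using M_iff[OF L'(1) xD] by blast
    qed
    then have "L' = L" using max_idealsD[OF L(1) MxD(1,2)[OF L'(1)]] MxD(3)[OF L'(1)] D_closed(2) by blast
    moreover have "S \<noteq> loc M" if "S \<subseteq> loc L" using that loc_incl[OF M(1) L(1)] L(3) by blast
    ultimately show ?thesis using SS L' by blast
  qed
  obtain d where d: "d \<in> D" "d \<noteq> 0" "v M d = 1" using D_elt[OF M(1), of 1] by auto
  define E where "E = {S \<in> \<Theta>. inverse d \<notin> S} - {loc M}"
  have finE: "finite E" using lf d R by (auto simp: locally_finite_def E_def)
  have "\<exists>Y. finite Y \<and> Y \<subseteq> D \<and> (\<forall>y\<in>Y. vge (v M) 1 y) \<and> 1 \<in> mprod S Y" if "S \<in> E" for S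
  proof -
    have SS: "S \<in> \<Theta>" "S \<noteq> loc M" using that by (auto simp: E_def)
    obtain y where y: "y \<in> S" "\<not> vge (v M) 0 y" using a[OF SS] by blast
    \<comment> \<open>The inverse of (1, y) lies in M because y has negative value at M, and it
      generates the unit ideal in S because y lies in S.\<close>
    have "mprod {1, y} D \<in> INV D" by (rule pruefer[of _ 1]) auto
    then obtain G where G: "smod D G" "mprod (mprod {1, y} D) G = D" by (auto simp: INV_def)
    have D': "mprod {1, y} G = D"
      using G mprod_unit[OF sring_D G(1)] by (simp add: mprod_assoc)
    then have "1 \<in> mprod {1, y} G" using D_closed by simp
    then obtain X Y where XY: "finite Y" "X \<subseteq> {1, y}" "Y \<subseteq> G" "1 \<in> mprod X Y" by (rule mprod_finite)
    have g: "g \<in> D" "g * y \<in> D" if "g \<in> G" for g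
      using mprodI[of 1 "{1,y}" g G] mprodI[of y "{1,y}" g G] that D' by (auto simp: mult.commute)
    have "vge (v M) 1 g" if "g \<in> G" for g
      using D_vge[OF M(1) g(2)[OF that]] y v_mult[of g y] by (cases "g = 0") (auto simp: vge_def)
    moreover have "mprod X Y \<subseteq> mprod S Y"
      using XY y S[OF SS(1)] by (intro mprod_mono) (auto simp: sring_def)
    ultimately show ?thesis using XY g by (intro exI[of _ Y]) blast
  qed
  then have "\<forall>S\<in>E. \<exists>Y. finite Y \<and> Y \<subseteq> D \<and> (\<forall>y\<in>Y. vge (v M) 1 y) \<and> 1 \<in> mprod S Y" by blast
  from bchoice[OF this] obtain Y where Y: "\<forall>S\<in>E. finite (Y S) \<and> Y S \<subseteq> D \<and> (\<forall>y\<in>Y S. vge (v M) 1 y) \<and> 1 \<in> mprod S (Y S)"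
    by blast
  define G where "G = insert d (\<Union>S\<in>E. Y S)"
  have G: "finite G" "G \<subseteq> D" "\<forall>y\<in>G. vge (v M) 1 y" "d \<in> G"
    using Y finE d by (auto simp: G_def vge_def)
  then have "mprod G D \<in> INV D" using d by (intro pruefer[of _ d])
  then obtain C where C: "smod D C" "mprod (mprod G D) C = D" by (auto simp: INV_def)
  have GC: "mprod G C = D" using C mprod_unit[OF sring_D C(1)] by (simp add: mprod_assoc)
  have "\<exists>c\<in>C. \<not> vge (v M) 0 c"
  proof (rule ccontr)
    assume "\<not> ?thesis"
    then have "mprod G C \<subseteq> {x. vge (v M) 1 x}"
      using G by (intro mprod_least addc_vge) (auto intro: vge_mult0')
    then have "1 \<in> {x. vge (v M) 1 x}" using GC D_closed by blast
    then show False by simp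
  qed
  then obtain c where c: "c \<in> C" "\<not> vge (v M) 0 c" by blast
  have cG: "c * g \<in> D" if "g \<in> G" for g using mprodI[OF that c(1)] GC by (simp add: mult.commute)
  have cS: "c \<in> S" if SS: "S \<in> \<Theta>" "S \<noteq> loc M" for S
  proof (cases "S \<in> E")
    case True
    then have "c * 1 \<in> mprod {c} (mprod S (Y S))" using Y by (intro mprodI) auto
    also have "\<dots> = mprod S (mprod {c} (Y S))" by (rule mprod_left_comm)
    also have "\<dots> \<subseteq> mprod S S"
    proof (intro mprod_mono mprod_least subset_refl)
      fix a b assume "a \<in> {c}" "b \<in> Y S"
      then show "a * b \<in> S" using True cG S(3)[OF SS(1)] by (auto simp: G_def)
    qed (use S[OF SS(1)] in \<open>simp add: sring_def\<close>)
    finally show ?thesis using sring_idem[OF S(1)[OF SS(1)]] by simp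
  next
    case False
    then have "inverse d \<in> S" using SS by (auto simp: E_def)
    moreover have "c * d \<in> S" using cG[OF G(4)] S(3)[OF SS(1)] by blast
    ultimately have "c * d * inverse d \<in> S" using S(1)[OF SS(1)] by (auto simp: sring_def)
    then show ?thesis using d(2) by (simp add: mult.assoc)
  qed
  have c0: "c \<noteq> 0" "v M c < 0" using c by (auto simp: vge_def)
  \<comment> \<open>The pole of c at M can have any order; e brings the value to exactly -1 and,
    lying in D, does no harm elsewhere.\<close>
  obtain e where e: "e \<in> D" "e \<noteq> 0" "v M e = - v M c - 1" using D_elt[OF M(1), of "- v M c - 1"] c0 by auto
  show ?thesis
  proof
    show "c * e \<noteq> 0" "v M (c * e) = -1" using c0 e by (auto simp: v_mult)
    show "\<forall>L\<in>Mx. R \<subseteq> loc L \<longrightarrow> L \<noteq> M \<longrightarrow> vge (v L) 0 (c * e)"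
    proof (intro ballI impI)
      fix L assume L: "L \<in> Mx" "R \<subseteq> loc L" "L \<noteq> M"
      then obtain S where "S \<in> \<Theta>" "S \<noteq> loc M" "S \<subseteq> loc L" using b by blast
      then have "vge (v L) 0 c" using cS v_props(2)[OF L(1)] by auto
      then show "vge (v L) 0 (c * e)" using valn.vge_mult0[OF v_props(1)[OF L(1)]] D_vge[OF L(1) e(1)] by blast
    qed
  qed
qed

end

locale derived_stages = almost_dedekind_domain D for D :: "'a::field set" +
  fixes \<alpha> :: "'o::wellorder"
begin

text \<open>\<open>NN \<beta>\<close> is $\mathcal{N}^\beta(\Theta)$ as a set of maximal ideals, and \<open>TT \<beta>\<close> is $T_\beta$.\<close>
definition NN :: "'o \<Rightarrow> 'a set set" where
  "NN \<beta> = {M \<in> Mx. loc M \<in> derived (loc ` Mx) \<beta>}"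

definition TT :: "'o \<Rightarrow> 'a set" where
  "TT \<beta> = derived_ring (loc ` Mx) \<beta>"

lemma derived_NN: "derived (loc ` Mx) \<beta> = loc ` NN \<beta>"
  using derived_subset[of "loc ` Mx" \<beta>] by (auto simp: NN_def)

lemma NN_Mx: "M \<in> NN \<beta> \<Longrightarrow> M \<in> Mx"
  by (simp add: NN_def)

lemma TT_iff: "x \<in> TT \<beta> \<longleftrightarrow> (\<forall>M\<in>NN \<beta>. vge (v M) 0 x)"
proof -
  have "x \<in> TT \<beta> \<longleftrightarrow> (\<forall>M\<in>NN \<beta>. x \<in> loc M)" by (simp add: TT_def derived_ring_def derived_NN)
  then show ?thesis using v_props(2) NN_Mx by auto
qed

lemma TT_Inter: "TT \<beta> = \<Inter> (derived (loc ` Mx) \<beta>)"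
  by (simp add: TT_def derived_ring_def)

lemma D_TT: "D \<subseteq> TT \<beta>"
  using D_vge NN_Mx by (auto simp: TT_iff)

lemma sring_TT: "sring (TT \<beta>)"
  unfolding sring_def add_closed_def
proof safe
  fix x y assume "x \<in> TT \<beta>" "y \<in> TT \<beta>"
  then show "x + y \<in> TT \<beta>" "x * y \<in> TT \<beta>" "- x \<in> TT \<beta>"
    using valn.vge_add[OF v_props(1)] valn.vge_mult0[OF v_props(1)] valn.vge_minus[OF v_props(1)] NN_Mx
    by (auto simp: TT_iff)
qed (use D_TT D_closed in auto)

lemma TT_loc: "M \<in> NN \<beta> \<Longrightarrow> TT \<beta> \<subseteq> loc M"
  using v_props(2) NN_Mx by (auto simp: TT_iff)

lemma NN_antimono: "\<beta> \<le> \<delta> \<Longrightarrow> NN \<delta> \<subseteq> NN \<beta>"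
  using derived_antimono by (fastforce simp: NN_def)

lemma TT_mono: "\<beta> \<le> \<delta> \<Longrightarrow> TT \<beta> \<subseteq> TT \<delta>"
  unfolding TT_def derived_ring_def using derived_antimono by blast

definition isol :: "'o \<Rightarrow> 'a set \<Rightarrow> 'a \<Rightarrow> bool" where
  "isol \<beta> M z \<longleftrightarrow> M \<in> NN \<beta> \<and> z \<noteq> 0 \<and> v M z = -1 \<and> (\<forall>L\<in>NN \<beta>. L \<noteq> M \<longrightarrow> vge (v L) 0 z)"

lemma removed_isol:
  assumes "is_pred \<beta> \<delta>" "M \<in> NN \<beta>" "M \<notin> NN \<delta>" shows "\<exists>z. isol \<beta> M z"
proof -
  have M: "M \<in> Mx" using assms NN_Mx by blast
  have "loc M \<in> derived (loc ` Mx) \<beta>" "loc M \<notin> derived (loc ` Mx) \<delta>" using assms M by (auto simp: NN_def)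
  then have "jaffard_overring (TT \<beta>) (loc M)" by (simp add: derived_succ[OF assms(1)] TT_Inter)
  from jaffard_isolated[OF sring_TT D_TT M TT_loc[OF assms(2)] this]
  obtain z where z: "z \<noteq> 0" "v M z = -1" "\<forall>L\<in>Mx. TT \<beta> \<subseteq> loc L \<longrightarrow> L \<noteq> M \<longrightarrow> vge (v L) 0 z" .
  then have "isol \<beta> M z" using assms TT_loc NN_Mx by (auto simp: isol_def)
  then show ?thesis by blast
qed

lemma NN_zero: "is_zero \<beta> \<Longrightarrow> NN \<beta> = Mx"
  by (auto simp: NN_def derived_zero)

lemma NN_limit: "is_limit \<beta> \<Longrightarrow> M \<in> NN \<beta> \<longleftrightarrow> M \<in> Mx \<and> (\<forall>\<gamma><\<beta>. M \<in> NN \<gamma>)"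
  by (auto simp: NN_def derived_limit)

text \<open>An M removed in the passage to a successor is isolated by some z, which then lies in
  T_\<beta> but not in D_M. Hence \<open>overring_max\<close>, applied to T_\<beta>, always lands in
  \<open>NN \<beta>\<close>.\<close>

lemma NN_iff: "M \<in> Mx \<Longrightarrow> M \<in> NN \<beta> \<longleftrightarrow> TT \<beta> \<subseteq> loc M"
proof (induction \<beta> rule: less_induct)
  case (less \<beta>)
  have "M \<in> NN \<beta>" if T: "TT \<beta> \<subseteq> loc M"
  proof -
    have low: "M \<in> NN \<gamma>" if "\<gamma> < \<beta>" for \<gamma>
      using less.IH[OF that less.prems] TT_mono[OF less_imp_le[OF that]] T by blast
    show ?thesis
    proof (cases \<beta> rule: ordinal_cases)
      case 1
      then show ?thesis using NN_zero less.prems by blast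
    next
      case (2 \<gamma>)
      show ?thesis
      proof (rule ccontr)
        assume n: "M \<notin> NN \<beta>"
        have "\<gamma> < \<beta>" using 2 by (simp add: is_pred_def)
        then obtain z where z: "isol \<gamma> M z" using removed_isol[OF 2 low n] by blast
        have "z \<in> TT \<beta>" unfolding TT_iff
        proof
          fix L assume L: "L \<in> NN \<beta>"
          then have "L \<in> NN \<gamma>" "L \<noteq> M" using NN_antimono[OF less_imp_le[OF \<open>\<gamma> < \<beta>\<close>]] n by auto
          then show "vge (v L) 0 z" using z by (auto simp: isol_def)
        qed
        then show False using T z v_props(2)[OF less.prems] by (auto simp: isol_def vge_def)
      qed
    next
      case 3
      then show ?thesis using low less.prems by (simp add: NN_limit)
    qed
  qed
  then show ?case using TT_loc by blast
qed

text \<open>The union of the earlier rings is an overring, and the D_M containing it are those with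
  M in every earlier stage, that is, in \<open>NN \<beta>\<close>. By \<open>overring_eqI\<close> it
  contains T_\<beta>.\<close>

lemma TT_limit: assumes "is_limit \<beta>" shows "x \<in> TT \<beta> \<longleftrightarrow> (\<exists>\<gamma><\<beta>. x \<in> TT \<gamma>)"
proof
  assume x: "x \<in> TT \<beta>"
  let ?T = "\<Union>\<gamma>\<in>{\<gamma>. \<gamma> < \<beta>}. TT \<gamma>"
  obtain \<gamma>0 where g0: "\<gamma>0 < \<beta>" using assms by (auto simp: is_limit_def is_zero_def)
  have c: "\<exists>\<gamma><\<beta>. y \<in> TT \<gamma> \<and> z \<in> TT \<gamma>" if yz: "y \<in> TT \<gamma>1" "\<gamma>1 < \<beta>" "z \<in> TT \<gamma>2" "\<gamma>2 < \<beta>" for y z \<gamma>1 \<gamma>2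
  proof (cases "\<gamma>1 \<le> \<gamma>2")
    case True
    then show ?thesis using TT_mono[OF True] yz by blast
  next
    case False
    then have "\<gamma>2 \<le> \<gamma>1" by simp
    then show ?thesis using TT_mono[OF \<open>\<gamma>2 \<le> \<gamma>1\<close>] yz by blast
  qed
  have T: "sring ?T" unfolding sring_def add_closed_def
  proof (intro conjI ballI)
    have "0 \<in> TT \<gamma>0" "1 \<in> TT \<gamma>0" using D_TT D_closed by blast+
    then show "0 \<in> ?T" "1 \<in> ?T" using g0 by blast+
    fix y z assume "y \<in> ?T" "z \<in> ?T"
    then obtain \<gamma> where \<gamma>: "\<gamma> < \<beta>" "y \<in> TT \<gamma>" "z \<in> TT \<gamma>" using c by blast
    then have "y + z \<in> TT \<gamma>" "y * z \<in> TT \<gamma>" "- y \<in> TT \<gamma>" using sring_TT by (auto simp: sring_def add_closed_def)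
    then show "y + z \<in> ?T" "y * z \<in> ?T" using \<gamma> by blast+
  next
    fix y assume "y \<in> ?T"
    then obtain \<gamma> where \<gamma>: "\<gamma> < \<beta>" "y \<in> TT \<gamma>" by blast
    then have "- y \<in> TT \<gamma>" using sring_TT by (auto simp: sring_def)
    then show "- y \<in> ?T" using \<gamma> by blast
  qed
  have DT: "D \<subseteq> ?T" using D_TT g0 by blast
  have "x \<in> ?T"
  proof (rule overring_eqI[OF T DT])
    fix M assume M: "M \<in> Mx" "?T \<subseteq> loc M"
    then have "\<forall>\<gamma><\<beta>. M \<in> NN \<gamma>" using NN_iff[OF M(1)] by blast
    then have "M \<in> NN \<beta>" using NN_limit[OF assms] M by blast
    then show "vge (v M) 0 x" using x TT_iff by blast
  qed
  then show "\<exists>\<gamma><\<beta>. x \<in> TT \<gamma>" by blast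
next
  assume "\<exists>\<gamma><\<beta>. x \<in> TT \<gamma>"
  then obtain \<gamma> where "\<gamma> < \<beta>" "x \<in> TT \<gamma>" by blast
  then show "x \<in> TT \<beta>" using TT_mono[OF less_imp_le] by blast
qed

lemma finite_TT_limit: assumes "is_limit \<beta>" "finite W" "W \<subseteq> TT \<beta>" shows "\<exists>\<gamma><\<beta>. W \<subseteq> TT \<gamma>"
  using assms(2,3)
proof (induction W rule: finite_induct)
  case empty
  then show ?case using assms by (auto simp: is_limit_def is_zero_def)
next
  case (insert w W)
  then obtain \<gamma>1 where 1: "\<gamma>1 < \<beta>" "W \<subseteq> TT \<gamma>1" by blast
  obtain \<gamma>2 where 2: "\<gamma>2 < \<beta>" "w \<in> TT \<gamma>2" using insert TT_limit[OF assms(1)] by blast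
  have "max \<gamma>1 \<gamma>2 < \<beta>" using 1 2 by simp
  moreover have "insert w W \<subseteq> TT (max \<gamma>1 \<gamma>2)"
    using 1 2 TT_mono[of \<gamma>1 "max \<gamma>1 \<gamma>2"] TT_mono[of \<gamma>2 "max \<gamma>1 \<gamma>2"] by auto
  ultimately show ?case by blast
qed

text \<open>The t in T_\<beta> for which t w fails to be integral at only finitely many members form
  an ideal. If it were proper, it would lie in some M of \<open>NN \<beta>\<close>. If w is integral
  at M, a denominator of w outside M is in the ideal; if not, M disappears at \<delta>, and the
  isolating z produces a member that is a unit at M.\<close>

lemma finite_bad1:
  assumes p: "is_pred \<beta> \<delta>" and w: "w \<in> TT \<delta>" shows "finite {M \<in> NN \<beta>. \<not> vge (v M) 0 w}"
proof (rule ccontr)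
  assume inf: "\<not> ?thesis"
  let ?B = "\<lambda>t. {M \<in> NN \<beta>. \<not> vge (v M) 0 (t * w)}"
  let ?I = "{t \<in> TT \<beta>. finite (?B t)}"
  have lt: "\<beta> < \<delta>" using p by (simp add: is_pred_def)
  have "smod (TT \<beta>) ?I" unfolding smod_def add_closed_def
  proof (intro conjI ballI)
    have "?B 0 = {}" by (simp add: vge_def)
    then have "finite (?B 0)" by (simp only: finite.emptyI)
    then show "0 \<in> ?I" using D_TT D_closed(1) by blast
    fix x y assume xy: "x \<in> ?I" "y \<in> ?I"
    have s: "?B (x + y) \<subseteq> ?B x \<union> ?B y"
      using valn.vge_add[OF v_props(1)] NN_Mx by (auto simp: distrib_right)
    have "finite (?B x \<union> ?B y)" using xy by blast
    then have "finite (?B (x + y))" by (rule finite_subset[OF s])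
    moreover have "x + y \<in> TT \<beta>" using xy sring_TT[of \<beta>] unfolding sring_def add_closed_def by blast
    ultimately show "x + y \<in> ?I" by blast
  next
    fix a x assume ax: "a \<in> TT \<beta>" "x \<in> ?I"
    have s: "?B (a * x) \<subseteq> ?B x"
      using valn.vge_mult0[OF v_props(1)] NN_Mx ax(1) by (auto simp: mult.assoc TT_iff)
    have "finite (?B x)" using ax by blast
    then have "finite (?B (a * x))" by (rule finite_subset[OF s])
    moreover have "a * x \<in> TT \<beta>" using ax sring_TT[of \<beta>] unfolding sring_def by blast
    ultimately show "a * x \<in> ?I" by blast
  qed
  moreover have "1 \<notin> ?I" using inf by simp
  moreover obtain a b where ab: "a \<in> D" "b \<in> D" "b \<noteq> 0" "w = a / b" using D_quotient by blast
  have bw: "?B b = {}" using ab D_vge NN_Mx by auto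
  have bI: "b \<in> ?I" unfolding mem_Collect_eq bw using ab D_TT by auto
  ultimately obtain M where M: "M \<in> Mx" "TT \<beta> \<subseteq> loc M" "\<forall>x\<in>?I. vge (v M) 1 x"
    using overring_max[OF sring_TT[of \<beta>] D_TT[of \<beta>], of ?I b] ab(3) by blast
  interpret valn "v M" using M by (intro v_props)
  have MN: "M \<in> NN \<beta>" using NN_iff M by blast
  show False
  proof (cases "vge (v M) 0 w")
    case True
    then obtain c s where cs: "c \<in> D" "s \<in> D" "s \<notin> M" "s \<noteq> 0" "v M s = 0" "w = c / s"
      using locE[OF M(1)] by metis
    have bs: "?B s = {}" using cs D_vge NN_Mx by auto
    have "s \<in> ?I" unfolding mem_Collect_eq bs using cs D_TT by auto
    with M(3) have "vge (v M) 1 s" by (rule bspec)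
    then show False using cs by (auto simp: vge_def)
  next
    case False
    then have "M \<notin> NN \<delta>" using w by (auto simp: TT_iff)
    then obtain z where z: "isol \<beta> M z" using removed_isol[OF p MN] by blast
    \<comment> \<open>The power of z cancels the value of the denominator b at M, while s w = a z^k
      stays integral at every other member.\<close>
    define s where "s = b * z ^ nat (v M b)"
    have vb: "0 \<le> v M b" using D_vge[OF M(1) ab(2)] ab by (simp add: vge_def)
    have s: "s \<noteq> 0" "v M s = 0" using z ab vb by (auto simp: s_def v_mult v_power isol_def)
    have other: "vge (v L) 0 (z ^ n)" if "L \<in> NN \<beta>" "L \<noteq> M" for L n
      using that z valn.vge_power[OF v_props(1)] NN_Mx by (auto simp: isol_def)
    have "s \<in> TT \<beta>" unfolding TT_iff
    proof
      fix L assume L: "L \<in> NN \<beta>"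
      show "vge (v L) 0 s"
      proof (cases "L = M")
        case False
        then show ?thesis unfolding s_def
          by (intro valn.vge_mult0[OF v_props(1)] other D_vge ab NN_Mx[OF L] L)
      qed (use s in \<open>simp add: vge_def\<close>)
    qed
    moreover have "?B s \<subseteq> {M}"
    proof clarify
      fix L assume L: "L \<in> NN \<beta>" "\<not> vge (v L) 0 (s * w)" "L \<notin> {}"
      have e: "s * w = a * z ^ nat (v M b)" using ab by (simp add: s_def)
      show "L = M"
      proof (rule ccontr)
        assume "L \<noteq> M"
        then have "vge (v L) 0 (s * w)" unfolding e
          by (intro valn.vge_mult0[OF v_props(1)] other D_vge ab NN_Mx[OF L(1)] L(1))
        then show False using L by blast
      qed
    qed
    then have "finite (?B s)" by (rule finite_subset) (rule finite.insertI[OF finite.emptyI])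
    ultimately have "s \<in> ?I" by blast
    with M(3) have "vge (v M) 1 s" by (rule bspec)
    then show False using s by (auto simp: vge_def)
  qed
qed

lemma finite_bad:
  assumes p: "is_pred \<beta> \<delta>" and W: "finite W" "W \<subseteq> TT \<delta>" shows "finite {M \<in> NN \<beta>. \<not> W \<subseteq> loc M}"
proof -
  have "{M \<in> NN \<beta>. \<not> W \<subseteq> loc M} \<subseteq> (\<Union>w\<in>W. {M \<in> NN \<beta>. \<not> vge (v M) 0 w})"
    using v_props(2) NN_Mx by fastforce
  moreover have "finite \<dots>" using W finite_bad1[OF p] by blast
  ultimately show ?thesis by (rule finite_subset)
qed

text \<open>The first index at which M is missing is neither zero nor a limit; its predecessor is
  the stage sought.\<close>

lemma stage_exists:
  assumes "M \<in> Mx" "M \<notin> NN \<delta>" shows "\<exists>\<gamma><\<delta>. \<exists>z. isol \<gamma> M z"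
proof -
  define \<beta> where "\<beta> = (LEAST \<beta>. M \<notin> NN \<beta>)"
  have b: "M \<notin> NN \<beta>" "\<beta> \<le> \<delta>" unfolding \<beta>_def using assms LeastI[of "\<lambda>\<beta>. M \<notin> NN \<beta>" \<delta>] Least_le[of "\<lambda>\<beta>. M \<notin> NN \<beta>" \<delta>] by auto
  have low: "M \<in> NN \<gamma>" if "\<gamma> < \<beta>" for \<gamma> using not_less_Least[of \<gamma> "\<lambda>\<beta>. M \<notin> NN \<beta>"] that by (auto simp: \<beta>_def)
  show ?thesis
  proof (cases \<beta> rule: ordinal_cases)
    case 1
    then show ?thesis using b assms NN_zero by blast
  next
    case (2 \<gamma>)
    then have "\<gamma> < \<beta>" by (simp add: is_pred_def)
    then show ?thesis using removed_isol[OF 2 low b(1)] b(2) by (meson less_le_trans)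
  next
    case 3
    then show ?thesis using low b assms by (simp add: NN_limit)
  qed
qed

end

section \<open>Value functions of invertible ideals\<close>

context valn
begin

lemma poly_vge: "(\<And>i. vge v w (coeff f i)) \<Longrightarrow> vge v 0 x \<Longrightarrow> vge v w (poly f x)"
proof (induction f)
  case (pCons a f)
  have "vge v w (coeff f i)" for i using pCons.prems(1)[of "Suc i"] by simp
  then have "vge v w (poly f x)" using pCons by blast
  then show ?case using pCons.prems(1)[of 0] pCons.prems(2) by (simp add: vge_add vge_mult0)
qed simp

lemma poly_bound: "\<exists>C\<ge>0. \<forall>x. vge v 0 x \<longrightarrow> vge v (- C) (poly f x)"
proof (induction f)
  case 0
  then show ?case by (intro exI[of _ 0]) simp
next
  case (pCons a f)
  then obtain C where C: "C \<ge> 0" "\<And>x. vge v 0 x \<Longrightarrow> vge v (- C) (poly f x)" by blast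
  have "vge v (- max C \<bar>v a\<bar>) (a + x * poly f x)" if "vge v 0 x" for x
    using C that by (intro vge_add) (auto simp: vge_def[of v _ a] intro: vge_mono[OF vge_mult0[OF that C(2)[OF that]]])
  then show ?case using C by (intro exI[of _ "max C \<bar>v a\<bar>"]) auto
qed

text \<open>Uniform continuity with an explicit difference quotient w; comparing values instead
  would break down where the two values of f coincide.\<close>

lemma poly_cont:
  "\<exists>C\<ge>0. \<forall>x y. vge v 0 x \<longrightarrow> vge v 0 y \<longrightarrow> (\<exists>w. vge v (- C) w \<and> poly f x - poly f y = (x - y) * w)"
proof (induction f)
  case 0
  then show ?case by (intro exI[of _ 0]) (auto intro: exI[of _ 0])
next
  case (pCons a f)
  then obtain C where C: "C \<ge> 0"
    "\<And>x y. vge v 0 x \<Longrightarrow> vge v 0 y \<Longrightarrow> \<exists>w. vge v (- C) w \<and> poly f x - poly f y = (x - y) * w" by blast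
  obtain B where B: "B \<ge> 0" "\<And>x. vge v 0 x \<Longrightarrow> vge v (- B) (poly f x)" using poly_bound by blast
  have "\<exists>w. vge v (- max C B) w \<and> poly (pCons a f) x - poly (pCons a f) y = (x - y) * w"
    if x: "vge v 0 x" and y: "vge v 0 y" for x y
  proof -
    obtain w where w: "vge v (- C) w" "poly f x - poly f y = (x - y) * w" using C x y by blast
    have "vge v (- max C B) (x * w + poly f y)"
      by (intro vge_add vge_mult0 x vge_mono[OF w(1)] vge_mono[OF B(2)[OF y]]) auto
    moreover have "poly (pCons a f) x - poly (pCons a f) y = x * (poly f x - poly f y) + (x - y) * poly f y"
      by (simp add: algebra_simps)
    then have "poly (pCons a f) x - poly (pCons a f) y = (x - y) * (x * w + poly f y)"
      unfolding w(2) by (simp add: algebra_simps)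
    ultimately show ?thesis by blast
  qed
  then show ?case using C by (intro exI[of _ "max C B"]) auto
qed

lemma synthetic_div_vge:
  "(\<And>i. vge v w (coeff f i)) \<Longrightarrow> vge v 0 r \<Longrightarrow> vge v w (coeff (synthetic_div f r) i)"
proof (induction f arbitrary: i)
  case (pCons a f)
  have *: "vge v w (coeff f i)" for i using pCons.prems(1)[of "Suc i"] by simp
  show ?case using pCons.IH[OF * pCons.prems(2)] poly_vge[OF * pCons.prems(2)]
    by (cases i) (simp_all add: synthetic_div_pCons)
qed simp

end

section \<open>Values of ideals at the points of D\<close>

context almost_dedekind_domain
begin

lemma intpoly_locI:
  assumes M: "M \<in> Mx" and f: "\<And>a. a \<in> D \<Longrightarrow> vge (v M) 0 (poly f a)" and x: "vge (v M) 0 x"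
  shows "vge (v M) 0 (poly f x)"
proof -
  interpret valn "v M" using M by (rule v_props)
  obtain C where C: "C \<ge> 0" "\<And>x y. vge (v M) 0 x \<Longrightarrow> vge (v M) 0 y \<Longrightarrow> \<exists>w. vge (v M) (- C) w \<and> poly f x - poly f y = (x - y) * w"
    using poly_cont[of f] by blast
  \<comment> \<open>Approximation to order C offsets the possible pole of the difference
    quotient.\<close>
  obtain a where a: "a \<in> D" "vge (v M) (int (nat C)) (x - a)" using loc_dense[OF M x] .
  obtain w where w: "vge (v M) (- C) w" "poly f x - poly f a = (x - a) * w"
    using C(2)[OF x D_vge[OF M a(1)]] by blast
  have "vge (v M) (C + - C) ((x - a) * w)" using a(2) C(1) w(1) by (intro vge_mult) auto
  then have "vge (v M) 0 (poly f a + (x - a) * w)" using f[OF a(1)] by (intro vge_add) auto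
  then show ?thesis by (simp flip: w(2))
qed

lemma intpoly_loc: "M \<in> Mx \<Longrightarrow> f \<in> intpoly (loc M) \<longleftrightarrow> (\<forall>a\<in>D. vge (v M) 0 (poly f a))"
  using intpoly_locI[of M f] D_vge[of M] by (auto simp: intpoly_def v_props(2))

lemma intpoly_D_vge: "M \<in> Mx \<Longrightarrow> f \<in> intpoly D \<Longrightarrow> a \<in> D \<Longrightarrow> vge (v M) 0 (poly f a)"
  using D_vge by (auto simp: intpoly_def)

lemma intpoly_D_loc: "M \<in> Mx \<Longrightarrow> intpoly D \<subseteq> intpoly (loc M)"
  using intpoly_D_vge by (auto simp: intpoly_loc)

definition ev :: "'a \<Rightarrow> 'a poly \<Rightarrow> 'a" where "ev a f = poly f a"

lemma rhom_ev: "rhom (ev a)"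
  by (auto simp: rhom_def ev_def)

text \<open>Lets Int(D), Int(D_M) and the Int(T_\<beta>) with M in \<open>NN \<beta>\<close> share
  one theory of values at M.\<close>

definition integral_at :: "'a set \<Rightarrow> 'a poly set \<Rightarrow> bool" where
  "integral_at M A \<longleftrightarrow> M \<in> Mx \<and> sring A \<and> (\<forall>a\<in>D. \<forall>f\<in>A. vge (v M) 0 (poly f a))"

lemma integral_at_D: "M \<in> Mx \<Longrightarrow> integral_at M (intpoly D)"
  using intpoly_D_vge sring_intpoly[OF sring_D] by (auto simp: integral_at_def)

lemma integral_at_loc: "M \<in> Mx \<Longrightarrow> integral_at M (intpoly (loc M))"
  using sring_intpoly[OF sring_loc] by (auto simp: integral_at_def intpoly_loc)

text \<open>The number v_M(F(a)): the values at a of the members of F generate over D_M a power of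
  its maximal ideal, and this is the exponent.\<close>

definition phi :: "'a set \<Rightarrow> 'a \<Rightarrow> 'a poly set \<Rightarrow> int" where
  "phi M a F = valn.val (v M) (exts (ev a) (loc M) F)"

lemma integral_at_ev: "integral_at M A \<Longrightarrow> a \<in> D \<Longrightarrow> ev a ` A \<subseteq> loc M"
  by (auto simp: integral_at_def v_props(2) ev_def)

lemma exts_ev_INV: assumes "integral_at M A" "a \<in> D" "F \<in> INV A" shows "exts (ev a) (loc M) F \<in> INV (loc M)"
proof -
  have "exts (ev a) (loc M) \<in> hom (invg A) (invg (loc M))"
    using assms integral_at_ev by (intro exts_hom rhom_ev) (auto simp: integral_at_def sring_loc)
  from hom_in_carrier[OF this] show ?thesis using assms by simp
qed

lemma phi_mult: assumes "integral_at M A" "a \<in> D" "F \<in> INV A" "G \<in> INV A"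
  shows "phi M a (mprod F G) = phi M a F + phi M a G"
proof -
  have M: "M \<in> Mx" using assms by (simp add: integral_at_def)
  interpret valn "v M" using M by (rule v_props)
  show ?thesis unfolding phi_def exts_mult[OF rhom_ev sring_loc[OF M]]
    using assms by (intro val_mprod) (simp_all add: loc_vr[OF M] exts_ev_INV)
qed

lemma phi_one: assumes "integral_at M A" "a \<in> D" shows "phi M a A = 0"
proof -
  have M: "M \<in> Mx" and A: "sring A" using assms by (simp_all add: integral_at_def)
  have "exts (ev a) (loc M) A = loc M"
    using integral_at_ev[OF assms] A by (intro exts_one rhom_ev sring_loc M) (simp_all add: sring_def)
  then show ?thesis using valn.val_vr[OF v_props(1)[OF M]] by (simp add: phi_def loc_vr[OF M])
qed

lemma phi_inv: assumes "integral_at M A" "a \<in> D" "F \<in> INV A" "G \<in> INV A" "mprod F G = A"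
  shows "phi M a G = - phi M a F"
  using phi_mult[OF assms(1-4)] phi_one[OF assms(1,2)] assms(5) by simp

lemma phi_char: assumes "integral_at M A" "a \<in> D" "F \<in> INV A"
  shows "\<exists>f\<in>F. poly f a \<noteq> 0 \<and> v M (poly f a) = phi M a F" "f \<in> F \<Longrightarrow> vge (v M) (phi M a F) (poly f a)"
proof -
  have M: "M \<in> Mx" using assms by (simp add: integral_at_def)
  interpret valn "v M" using M by (rule v_props)
  have *: "mprod (ev a ` F) vr \<in> INV vr"
    using exts_ev_INV[OF assms] by (simp add: loc_vr[OF M] exts_def)
  have e: "phi M a F = val (mprod (ev a ` F) vr)" by (simp add: phi_def exts_def loc_vr[OF M])
  show "\<exists>f\<in>F. poly f a \<noteq> 0 \<and> v M (poly f a) = phi M a F"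
    using val_elt(1)[OF *] unfolding e by (auto simp: ev_def)
  show "f \<in> F \<Longrightarrow> vge (v M) (phi M a F) (poly f a)"
    using val_elt(2)[OF *, of "ev a f"] unfolding e by (auto simp: ev_def)
qed

lemma phi_eqI: assumes "integral_at M A" "a \<in> D" "F \<in> INV A"
  and "f \<in> F" "poly f a \<noteq> 0" "v M (poly f a) = k" "\<And>g. g \<in> F \<Longrightarrow> vge (v M) k (poly g a)"
  shows "phi M a F = k"
proof (rule antisym)
  show "phi M a F \<le> k" using phi_char(2)[OF assms(1-4)] assms(5,6) by (simp add: vge_def)
  obtain g where "g \<in> F" "poly g a \<noteq> 0" "v M (poly g a) = phi M a F" using phi_char(1)[OF assms(1-3)] by blast
  then show "k \<le> phi M a F" using assms(7)[of g] by (simp add: vge_def)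
qed

lemma phi_ext: assumes "integral_at M A'" "a \<in> D"
  shows "phi M a (exts id A' F) = phi M a F"
proof -
  have M: "M \<in> Mx" and A: "sring A'" using assms by (simp_all add: integral_at_def)
  have "exts (ev a) (loc M) (exts id A' F) = exts (ev a) (loc M) F"
    using exts_exts[OF rhom_id(1) A sring_loc[OF M] rhom_ev integral_at_ev[OF assms]] by simp
  then show ?thesis by (simp add: phi_def)
qed

lemma phi_cext: assumes "sring A" "integral_at M (intpoly A)" "a \<in> D"
  shows "phi M a (cext A J) = valn.val (v M) (exts id (loc M) J)"
proof -
  have M: "M \<in> Mx" using assms by (simp add: integral_at_def)
  have "ev a \<circ> constp = id" by (auto simp: ev_def constp_def)
  then have "exts (ev a) (loc M) (cext A J) = exts id (loc M) J"
    using exts_exts[OF rhom_constp sring_intpoly[OF assms(1)] sring_loc[OF M] rhom_ev integral_at_ev[OF assms(2,3)]] by simp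
  then show ?thesis by (simp add: phi_def)
qed

lemma phi_scale: assumes "integral_at M A" "a \<in> D" "F \<in> INV A" "mprod {[:c:]} F \<in> INV A" "c \<noteq> 0"
  shows "phi M a (mprod {[:c:]} F) = v M c + phi M a F"
proof -
  have M: "M \<in> Mx" using assms by (simp_all add: integral_at_def)
  interpret valn "v M" using M by (rule v_props)
  have im: "mprod {[:c:]} F = (\<lambda>f. [:c:] * f) ` F" using assms INV_addc by (intro mprod_singleton) blast
  obtain f where f: "f \<in> F" "poly f a \<noteq> 0" "v M (poly f a) = phi M a F" using phi_char(1)[OF assms(1-3)] by blast
  show ?thesis
  proof (rule phi_eqI[OF assms(1,2,4)])
    show "[:c:] * f \<in> mprod {[:c:]} F" using f im by auto
    show "poly ([:c:] * f) a \<noteq> 0" "v M (poly ([:c:] * f) a) = v M c + phi M a F"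
      using f assms by (auto simp: v_mult)
    fix g assume "g \<in> mprod {[:c:]} F"
    then obtain h where h: "h \<in> F" "g = [:c:] * h" using im by auto
    have "vge (v M) (v M c + phi M a F) (c * poly h a)"
      by (intro vge_mult phi_char(2)[OF assms(1-3) h(1)]) (simp add: vge_def)
    then show "vge (v M) (v M c + phi M a F) (poly g a)" using h by simp
  qed
qed

text \<open>Vanishing values make all members of F integer-valued, and likewise those of its
  inverse; \<open>INV_eqI\<close> concludes.\<close>

lemma phi_zero_D:
  assumes F: "F \<in> INV (intpoly D)" and z: "\<And>M a. M \<in> Mx \<Longrightarrow> a \<in> D \<Longrightarrow> phi M a F = 0"
  shows "F = intpoly D"
proof -
  obtain H where H: "H \<in> INV (intpoly D)" "smod (intpoly D) F" "smod (intpoly D) H" "mprod F H = intpoly D"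
    using F by (rule INV_E)
  have sub: "G \<subseteq> intpoly D" if G: "G \<in> INV (intpoly D)" "\<And>M a. M \<in> Mx \<Longrightarrow> a \<in> D \<Longrightarrow> phi M a G = 0" for G
  proof
    fix f assume f: "f \<in> G"
    have "poly f a \<in> D" if a: "a \<in> D" for a
    proof (rule D_eqI)
      fix M assume M: "M \<in> Mx"
      show "vge (v M) 0 (poly f a)"
        using phi_char(2)[OF integral_at_D[OF M] a G(1) f] G(2)[OF M a] by simp
    qed
    then show "f \<in> intpoly D" by (simp add: intpoly_def)
  qed
  have zH: "phi M a H = 0" if "M \<in> Mx" "a \<in> D" for M a
    using phi_inv[OF integral_at_D[OF that(1)] that(2) F H(1,4)] z[OF that] by simp
  show ?thesis
    by (rule INV_eqI[OF sring_intpoly[OF sring_D] H(2,3,4) sub[OF F z] sub[OF H(1) zH]])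
qed

lemma phi_zero_loc:
  assumes M: "M \<in> Mx" and F: "F \<in> INV (intpoly (loc M))" and z: "\<And>a. a \<in> D \<Longrightarrow> phi M a F = 0"
  shows "F = intpoly (loc M)"
proof -
  let ?B = "intpoly (loc M)"
  obtain H where H: "H \<in> INV ?B" "smod ?B F" "smod ?B H" "mprod F H = ?B"
    using F by (rule INV_E)
  have sub: "G \<subseteq> ?B" if G: "G \<in> INV ?B" "\<And>a. a \<in> D \<Longrightarrow> phi M a G = 0" for G
  proof
    fix f assume f: "f \<in> G"
    have "vge (v M) 0 (poly f a)" if a: "a \<in> D" for a
      using phi_char(2)[OF integral_at_loc[OF M] a G(1) f] G(2)[OF a] by simp
    then show "f \<in> ?B" using intpoly_loc[OF M] by blast
  qed
  have zH: "phi M a H = 0" if "a \<in> D" for a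
    using phi_inv[OF integral_at_loc[OF M] that F H(1,4)] z[OF that] by simp
  show ?thesis
    by (rule INV_eqI[OF sring_intpoly[OF sring_loc[OF M]] H(2,3,4) sub[OF F z] sub[OF H(1) zH]])
qed

text \<open>The values at one base point, here 0, form an ideal of D that realizes the constant part
  of all value functions at once.\<close>

lemma value_ideal:
  assumes F: "F \<in> INV (intpoly D)"
  shows "exts (ev 0) D F \<in> INV D"
    and "M \<in> Mx \<Longrightarrow> a \<in> D \<Longrightarrow> phi M a (cext D (exts (ev 0) D F)) = phi M 0 F"
proof -
  have evD: "ev 0 ` intpoly D \<subseteq> D" using D_closed(1) by (auto simp: ev_def intpoly_def)
  show "exts (ev 0) D F \<in> INV D"
    using hom_in_carrier[OF exts_hom[OF rhom_ev sring_intpoly[OF sring_D] sring_D evD], of F] F by simp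
  assume M: "M \<in> Mx" "a \<in> D"
  have "id ` D \<subseteq> loc M" using D_loc[OF M(1)] by simp
  from exts_exts[OF rhom_ev sring_D sring_loc[OF M(1)] rhom_id(1) this]
  have "exts id (loc M) (exts (ev 0) D F) = exts (ev 0) (loc M) F" by simp
  then show "phi M a (cext D (exts (ev 0) D F)) = phi M 0 F"
    using phi_cext[OF sring_D integral_at_D[OF M(1)] M(2)] by (simp add: phi_def)
qed

text \<open>If the value functions are constant, the quotient of F by the ideal extended from F(0)
  has value zero everywhere and is trivial by \<open>phi_zero_D\<close>.\<close>

lemma cext_iff_phi_const:
  assumes F: "F \<in> INV (intpoly D)"
  shows "(\<exists>J\<in>INV D. F = cext D J) \<longleftrightarrow> (\<forall>M\<in>Mx. \<forall>a\<in>D. phi M a F = phi M 0 F)"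
proof
  assume "\<exists>J\<in>INV D. F = cext D J"
  then show "\<forall>M\<in>Mx. \<forall>a\<in>D. phi M a F = phi M 0 F"
    using phi_cext[OF sring_D integral_at_D] D_closed(1) by auto
next
  assume c: "\<forall>M\<in>Mx. \<forall>a\<in>D. phi M a F = phi M 0 F"
  let ?B = "intpoly D"
  define J where "J = cext D (exts (ev 0) D F)"
  have B: "sring ?B" by (rule sring_intpoly[OF sring_D])
  have J: "J \<in> INV ?B" unfolding J_def by (rule cext_INV[OF sring_D value_ideal(1)[OF F]])
  obtain H where H: "H \<in> INV ?B" "mprod J H = ?B" using J by (rule INV_E)
  have FH: "mprod F H \<in> INV ?B" by (rule INV_mprod[OF B F H(1)])
  have "mprod F H = ?B"
  proof (rule phi_zero_D[OF FH])
    fix M a assume M: "M \<in> Mx" "a \<in> D"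
    have "phi M a J = phi M 0 F" unfolding J_def by (rule value_ideal(2)[OF F M])
    then show "phi M a (mprod F H) = 0"
      using phi_mult[OF integral_at_D[OF M(1)] M(2) F H(1)] phi_inv[OF integral_at_D[OF M(1)] M(2) J H] c M by simp
  qed
  then have "mprod (mprod F H) J = mprod ?B J" by simp
  moreover have "mprod (mprod F H) J = mprod F (mprod J H)" by (simp add: mprod_ac)
  ultimately have "F = J"
    using H(2) mprod_unit[OF B INV_smod[OF F]] mprod_unit[OF B INV_smod[OF J]] by simp
  then show "\<exists>J\<in>INV D. F = cext D J" using value_ideal(1)[OF F] J_def by blast
qed

lemma pint_one_phi: assumes F: "F \<in> INV (intpoly D)"
  shows "pint D F = \<one>\<^bsub>PicInt D\<^esub> \<longleftrightarrow> (\<forall>M\<in>Mx. \<forall>a\<in>D. phi M a F = phi M 0 F)"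
  using pint_one_iff[OF sring_D F] cext_iff_phi_const[OF F] by simp

lemma pcls_phi:
  assumes M: "M \<in> Mx" and F: "F \<in> INV (intpoly (loc M))" and G: "G \<in> INV (intpoly (loc M))"
    and eq: "pcls (loc M) F = pcls (loc M) G" and a: "a \<in> D"
  shows "phi M a F - phi M 0 F = phi M a G - phi M 0 G"
proof -
  obtain c where c: "c \<noteq> 0" "G = mprod {[:c:]} F" using pcls_eq_iff[OF sring_loc[OF M] F G] eq by blast
  then show ?thesis
    using phi_scale[OF integral_at_loc[OF M] a F] phi_scale[OF integral_at_loc[OF M] D_closed(1) F] G by simp
qed

text \<open>Over the discrete valuation ring D_M a constant value is the value of a scalar. So
  constancy trivializes the class in Pic(Int(D_M)) itself, not only modulo extended ideals.\<close>

lemma pcls_one_phi: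
  assumes M: "M \<in> Mx" and F: "F \<in> INV (intpoly (loc M))" and c: "\<And>a. a \<in> D \<Longrightarrow> phi M a F = phi M 0 F"
  shows "pcls (loc M) F = \<one>\<^bsub>Pic (IntK (loc M))\<^esub>"
proof -
  let ?B = "intpoly (loc M)"
  interpret valn "v M" using M by (rule v_props)
  note sring_B = sring_intpoly[OF sring_loc[OF M]]
  obtain c where c': "c \<noteq> 0" "v M c = - phi M 0 F" by (rule v_elt)
  have "F \<in> INV ?B" by fact
  obtain H where H: "H \<in> INV ?B" "smod ?B F" "smod ?B H" "mprod F H = ?B" using F by (rule INV_E)
  have "mprod (mprod {[:c:]} F) (mprod {[:1 / c:]} H) = mprod {[:c:]} (mprod {[:1 / c:]} (mprod F H))"
    by (simp add: mprod_ac)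
  also have "\<dots> = ?B" using c' sring_B H(4) by (simp add: mprod_singletons mprod_one sring_def one_pCons[symmetric])
  finally have I: "mprod {[:c:]} F \<in> INV ?B"
    using H by (intro INV_I[of _ _ "mprod {[:1 / c:]} H"] smod_mprod2)
  have "mprod {[:c:]} F = ?B"
  proof (rule phi_zero_loc[OF M I])
    fix a assume a: "a \<in> D"
    show "phi M a (mprod {[:c:]} F) = 0" using phi_scale[OF integral_at_loc[OF M] a F I c'(1)] c[OF a] c'(2) by simp
  qed
  then have "pcls (loc M) F = pcls (loc M) ?B"
    using pcls_eq_iff[OF sring_loc[OF M] F INV_self[OF sring_B]] c' by auto
  then show ?thesis by (simp add: pcls_def IntK_emb)
qed

text \<open>Evaluate 1 = sum of x y at a: some term has value at most 0. Its factors have values at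
  least v_M(F(a)) and -v_M(F(a)), so both bounds are attained. The finite sets are chosen before a,
  which is what makes uniform estimates possible.\<close>

lemma gens_attain:
  assumes ok: "integral_at M A" and a: "a \<in> D" and F: "F \<in> INV A" and H: "H \<in> INV A" "mprod F H = A"
    and X: "X \<subseteq> F" "Y \<subseteq> H" "1 \<in> mprod X Y"
  obtains f h where "f \<in> X" "h \<in> Y" "poly f a \<noteq> 0" "v M (poly f a) = phi M a F"
    "poly h a \<noteq> 0" "v M (poly h a) = - phi M a F"
proof -
  have M: "M \<in> Mx" using ok by (simp add: integral_at_def)
  interpret valn "v M" using M by (rule v_props)
  have "\<exists>f\<in>X. \<exists>h\<in>Y. \<not> vge (v M) 1 (poly f a * poly h a)"
  proof (rule ccontr)
    assume "\<not> ?thesis"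
    moreover have "add_closed {g. vge (v M) 1 (poly g a)}" by (auto simp: add_closed_def intro: vge_add)
    ultimately have "mprod X Y \<subseteq> {g. vge (v M) 1 (poly g a)}" by (intro mprod_least) auto
    then have "vge (v M) 1 (poly 1 a)" using X by blast
    then show False by simp
  qed
  then obtain f h where fh: "f \<in> X" "h \<in> Y" "\<not> vge (v M) 1 (poly f a * poly h a)" by blast
  then have nz: "poly f a \<noteq> 0" "poly h a \<noteq> 0" by auto
  then have "v M (poly f a) + v M (poly h a) \<le> 0" using fh(3) by (auto simp: vge_def v_mult)
  moreover have "phi M a F \<le> v M (poly f a)" using phi_char(2)[OF ok a F, of f] fh X nz by (auto simp: vge_def)
  moreover have "phi M a H \<le> v M (poly h a)" using phi_char(2)[OF ok a H(1), of h] fh X nz by (auto simp: vge_def)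
  moreover have "phi M a H = - phi M a F" by (rule phi_inv[OF ok a F H])
  ultimately have "v M (poly f a) = phi M a F" "v M (poly h a) = - phi M a F" by linarith+
  then show ?thesis using that fh nz by blast
qed

section \<open>Local constancy of value functions\<close>

lemma uniform_bound:
  fixes P :: "'b \<Rightarrow> int \<Rightarrow> bool"
  assumes "finite X" "\<And>x. x \<in> X \<Longrightarrow> \<exists>C\<ge>0. P x C" "\<And>x C C'. P x C \<Longrightarrow> C \<le> C' \<Longrightarrow> P x C'"
  shows "\<exists>C\<ge>0. \<forall>x\<in>X. P x C"
  using assms(1,2)
proof (induction X rule: finite_induct)
  case (insert x X)
  then obtain C where C: "C \<ge> 0" "\<forall>x\<in>X. P x C" by blast
  obtain C' where C': "C' \<ge> 0" "P x C'" using insert by blast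
  have "P y (max C C')" if "y \<in> insert x X" for y
    using that C C' assms(3)[of y C "max C C'"] assms(3)[of y C' "max C C'"] by auto
  then show ?case using C by (intro exI[of _ "max C C'"]) auto
qed auto

lemma phi_locally_const:
  assumes ok: "integral_at M A" and F: "F \<in> INV A"
  shows "\<exists>n::nat. \<forall>a\<in>D. \<forall>b\<in>D. vge (v M) (int n) (a - b) \<longrightarrow> phi M a F = phi M b F"
proof -
  have M: "M \<in> Mx" and A: "sring A" using ok by (simp_all add: integral_at_def)
  interpret valn "v M" using M by (rule v_props)
  obtain H where H: "H \<in> INV A" "smod A F" "smod A H" "mprod F H = A" using F by (rule INV_E)
  obtain X Y where XY: "finite X" "finite Y" "X \<subseteq> F" "Y \<subseteq> H" "1 \<in> mprod X Y"
    using INV_finite_gens[OF A H(2-4)] by metis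
  have "\<exists>C\<ge>0. \<forall>f\<in>X. \<forall>x y. vge (v M) 0 x \<longrightarrow> vge (v M) 0 y \<longrightarrow>
     (\<exists>w. vge (v M) (- C) w \<and> poly f x - poly f y = (x - y) * w)"
  proof (rule uniform_bound[OF XY(1) poly_cont], intro allI impI)
    fix f :: "'a poly" and C C' x y
    assume "\<forall>x y. vge (v M) 0 x \<longrightarrow> vge (v M) 0 y \<longrightarrow> (\<exists>w. vge (v M) (- C) w \<and> poly f x - poly f y = (x - y) * w)"
      "C \<le> C'" "vge (v M) 0 x" "vge (v M) 0 y"
    then obtain w where "vge (v M) (- C) w" "poly f x - poly f y = (x - y) * w" by blast
    moreover then have "vge (v M) (- C') w" using \<open>C \<le> C'\<close> by (auto elim: vge_mono)
    ultimately show "\<exists>w. vge (v M) (- C') w \<and> poly f x - poly f y = (x - y) * w" by blast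
  qed
  then obtain C where C: "C \<ge> 0" "\<And>f x y. f \<in> X \<Longrightarrow> vge (v M) 0 x \<Longrightarrow> vge (v M) 0 y \<Longrightarrow>
     \<exists>w. vge (v M) (- C) w \<and> poly f x - poly f y = (x - y) * w" by blast
  have "\<exists>K\<ge>0. \<forall>h\<in>Y. \<forall>x. vge (v M) 0 x \<longrightarrow> vge (v M) (- K) (poly h x)"
  proof (rule uniform_bound[OF XY(2) poly_bound], intro allI impI)
    fix f :: "'a poly" and C C' x
    assume "\<forall>x. vge (v M) 0 x \<longrightarrow> vge (v M) (- C) (poly f x)" "C \<le> C'" "vge (v M) 0 x"
    then show "vge (v M) (- C') (poly f x)" using vge_mono[of "- C" "poly f x" "- C'"] by auto
  qed
  then obtain K where K: "K \<ge> 0" "\<And>h x. h \<in> Y \<Longrightarrow> vge (v M) 0 x \<Longrightarrow> vge (v M) (- K) (poly h x)" by blast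
  \<comment> \<open>The bound -K for the generators of the inverse gives v_M(F(a)) at most K. Moving
    a by M^n changes f(a) by something of value at least n - C = K + 1, hence without changing its
    value.\<close>
  define n where "n = nat (K + C + 1)"
  have le: "phi M b F \<le> phi M a F" if ab: "a \<in> D" "b \<in> D" "vge (v M) (int n) (b - a)" for a b
  proof -
    obtain f h where fh: "f \<in> X" "h \<in> Y" "poly f a \<noteq> 0" "v M (poly f a) = phi M a F"
      "poly h a \<noteq> 0" "v M (poly h a) = - phi M a F" by (rule gens_attain[OF ok ab(1) F H(1,4) XY(3-5)])
    have "phi M a F \<le> K" using K(2)[OF fh(2) D_vge[OF M ab(1)]] fh by (auto simp: vge_def)
    obtain w where w: "vge (v M) (- C) w" "poly f b - poly f a = (b - a) * w"
      using C(2)[OF fh(1) D_vge[OF M ab(2)] D_vge[OF M ab(1)]] by blast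
    have "vge (v M) (int n + - C) ((b - a) * w)" by (rule vge_mult[OF ab(3) w(1)])
    then have "vge (v M) (v M (poly f a) + 1) ((b - a) * w)"
      using \<open>phi M a F \<le> K\<close> K(1) C(1) fh(4) by (elim vge_mono) (simp add: n_def)
    from v_add_eq[OF fh(3) this] have "poly f b \<noteq> 0" "v M (poly f b) = phi M a F"
      using fh(4) by (simp_all flip: w(2))
    then show ?thesis using phi_char(2)[OF ok ab(2) F, of f] fh(1) XY(3) by (auto simp: vge_def)
  qed
  have "phi M a F = phi M b F" if ab: "a \<in> D" "b \<in> D" "vge (v M) (int n) (a - b)" for a b
  proof (rule antisym)
    show "phi M a F \<le> phi M b F" using le[of b a] ab by simp
    have "vge (v M) (int n) (- (a - b))" using ab(3) by (simp only: vge_minus)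
    then show "phi M b F \<le> phi M a F" using le[of a b] ab by simp
  qed
  then show ?thesis by blast
qed

section \<open>Gauss valuations and infinite residue fields\<close>

definition finite_residue :: "'a set \<Rightarrow> bool" where
  "finite_residue M \<longleftrightarrow> (\<exists>S. finite S \<and> S \<subseteq> D \<and> (\<forall>a\<in>D. \<exists>s\<in>S. vge (v M) 1 (a - s)))"

text \<open>Here \<open>w\<close> is the Gauss valuation of \<open>f\<close>.\<close>
lemma gauss_primitive:
  assumes M: "M \<in> Mx"
  shows "(\<And>i. vge (v M) w (coeff f i)) \<Longrightarrow> \<not> vge (v M) (w + 1) (coeff f k) \<Longrightarrow>
    \<exists>S. finite S \<and> S \<subseteq> D \<and> (\<forall>a\<in>D. (\<forall>s\<in>S. \<not> vge (v M) 1 (a - s)) \<longrightarrow> \<not> vge (v M) (w + 1) (poly f a))"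
proof (induction "degree f" arbitrary: f k rule: less_induct)
  case less
  interpret valn "v M" using M by (rule v_props)
  show ?case
  proof (cases "\<exists>r\<in>D. vge (v M) (w + 1) (poly f r)")
    case False
    then show ?thesis by (intro exI[of _ "{}"]) auto
  next
    case True
    then obtain r where r: "r \<in> D" "vge (v M) (w + 1) (poly f r)" by blast
    have rv: "vge (v M) 0 r" by (rule D_vge[OF M r(1)])
    \<comment> \<open>f = (X - r) g + f(r), where f(r) has value above w. So g has the same Gauss
      value in smaller degree, and away from the residue class of r the factor a - r is a
      unit.\<close>
    define g where "g = synthetic_div f r"
    have fg: "f = [:- r, 1:] * g + [:poly f r:]" unfolding g_def by (rule synthetic_div_correct'[symmetric])
    have cf: "coeff f i = (case i of 0 \<Rightarrow> poly f r | Suc j \<Rightarrow> coeff g j) - r * coeff g i" for i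
      by (subst fg) (cases i, auto)
    have g: "vge (v M) w (coeff g i)" for i unfolding g_def by (intro synthetic_div_vge less.prems(1) rv)
    have "\<exists>j. \<not> vge (v M) (w + 1) (coeff g j)"
    proof (rule ccontr)
      assume "\<not> ?thesis"
      then have "vge (v M) (w + 1) (coeff f k)" unfolding cf[of k]
        by (intro vge_diff vge_mult0 rv) (auto split: nat.split simp: r)
      then show False using less.prems(2) by blast
    qed
    then obtain j where j: "\<not> vge (v M) (w + 1) (coeff g j)" by blast
    have "degree f \<noteq> 0"
    proof
      assume "degree f = 0"
      then obtain c where "f = [:c:]" by (rule degree_eq_zeroE)
      then have "g = 0" by (simp add: g_def)
      then show False using j by simp
    qed
    then have "degree g < degree f" by (simp add: g_def degree_synthetic_div)
    from less.hyps[OF this g j] obtain S where S: "finite S" "S \<subseteq> D"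
      "\<forall>a\<in>D. (\<forall>s\<in>S. \<not> vge (v M) 1 (a - s)) \<longrightarrow> \<not> vge (v M) (w + 1) (poly g a)" by blast
    have "\<not> vge (v M) (w + 1) (poly f a)" if a: "a \<in> D" "\<forall>s\<in>insert r S. \<not> vge (v M) 1 (a - s)" for a
    proof
      assume "vge (v M) (w + 1) (poly f a)"
      moreover have e: "poly f a - poly f r = (a - r) * poly g a" by (subst fg) (simp add: algebra_simps)
      ultimately have "vge (v M) (w + 1) ((a - r) * poly g a)" using vge_diff[OF _ r(2)] by metis
      moreover have "\<not> vge (v M) (w + 1) (poly g a)" using S a by auto
      moreover have "vge (v M) 0 (a - r)" "\<not> vge (v M) 1 (a - r)"
        using a r D_vge[OF M D_diff] by auto
      ultimately show False by (auto simp: vge_def v_mult)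
    qed
    then show ?thesis using S r by (intro exI[of _ "insert r S"]) auto
  qed
qed

lemma gauss:
  assumes M: "M \<in> Mx" and f: "f \<noteq> 0"
  obtains w S where "finite S" "S \<subseteq> D" "\<forall>a\<in>D. vge (v M) w (poly f a)"
    "\<forall>a\<in>D. (\<forall>s\<in>S. \<not> vge (v M) 1 (a - s)) \<longrightarrow> poly f a \<noteq> 0 \<and> v M (poly f a) = w"
proof -
  interpret valn "v M" using M by (rule v_props)
  let ?C = "v M ` (coeff f ` {..degree f} - {0})"
  have ne: "?C \<noteq> {}" using f leading_coeff_0_iff[of f] by blast
  define w where "w = Min ?C"
  have "w \<in> ?C" unfolding w_def using ne by (intro Min_in) auto
  then obtain k where k: "coeff f k \<noteq> 0" "v M (coeff f k) = w" by auto
  have all: "vge (v M) w (coeff f i)" for i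
  proof (cases "coeff f i = 0")
    case False
    then have "i \<le> degree f" by (rule le_degree)
    then have "v M (coeff f i) \<in> ?C" using False by blast
    then have "w \<le> v M (coeff f i)" unfolding w_def by (intro Min_le) auto
    then show ?thesis by (simp add: vge_def)
  qed simp
  have "\<not> vge (v M) (w + 1) (coeff f k)" using k by (simp add: vge_def)
  from gauss_primitive[OF M all this] obtain S where S: "finite S" "S \<subseteq> D"
    "\<forall>a\<in>D. (\<forall>s\<in>S. \<not> vge (v M) 1 (a - s)) \<longrightarrow> \<not> vge (v M) (w + 1) (poly f a)" by blast
  have p: "vge (v M) w (poly f a)" if "a \<in> D" for a by (rule poly_vge[OF all D_vge[OF M that]])
  show ?thesis
  proof (rule that[OF S(1,2)])
    show "\<forall>a\<in>D. vge (v M) w (poly f a)" using p by blast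
    show "\<forall>a\<in>D. (\<forall>s\<in>S. \<not> vge (v M) 1 (a - s)) \<longrightarrow> poly f a \<noteq> 0 \<and> v M (poly f a) = w"
    proof (intro ballI impI)
      fix a assume a: "a \<in> D" "\<forall>s\<in>S. \<not> vge (v M) 1 (a - s)"
      then have "\<not> vge (v M) (w + 1) (poly f a)" using S(3) by blast
      then show "poly f a \<noteq> 0 \<and> v M (poly f a) = w" using p[OF a(1)] by (auto simp: vge_def)
    qed
  qed
qed

text \<open>Choose f in F attaining the value at a and h in the inverse attaining it at b. At a
  point c outside the finitely many exceptional residue classes both take their Gauss values, which
  are minimal over D; comparing the values at a, b and c gives one inequality, and symmetry the
  other.\<close>

lemma phi_const_inf:
  assumes ok: "integral_at M A" and F: "F \<in> INV A" and inf: "\<not> finite_residue M" and ab: "a \<in> D" "b \<in> D"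
  shows "phi M a F = phi M b F"
proof -
  have M: "M \<in> Mx" and A: "sring A" using ok by (simp_all add: integral_at_def)
  interpret valn "v M" using M by (rule v_props)
  obtain H where H: "H \<in> INV A" "mprod F H = A" using F by (rule INV_E)
  have "phi M b F \<le> phi M a F" if ab: "a \<in> D" "b \<in> D" for a b
  proof -
    obtain f where f: "f \<in> F" "poly f a \<noteq> 0" "v M (poly f a) = phi M a F" using phi_char(1)[OF ok ab(1) F] by blast
    obtain h where h: "h \<in> H" "poly h b \<noteq> 0" "v M (poly h b) = phi M b H" using phi_char(1)[OF ok ab(2) H(1)] by blast
    have "f \<noteq> 0" "h \<noteq> 0" using f h by auto
    obtain w S where w: "finite S" "S \<subseteq> D" "\<forall>a\<in>D. vge (v M) w (poly f a)"
      "\<forall>a\<in>D. (\<forall>s\<in>S. \<not> vge (v M) 1 (a - s)) \<longrightarrow> poly f a \<noteq> 0 \<and> v M (poly f a) = w"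
      by (rule gauss[OF M \<open>f \<noteq> 0\<close>])
    obtain w' S' where w': "finite S'" "S' \<subseteq> D" "\<forall>a\<in>D. vge (v M) w' (poly h a)"
      "\<forall>a\<in>D. (\<forall>s\<in>S'. \<not> vge (v M) 1 (a - s)) \<longrightarrow> poly h a \<noteq> 0 \<and> v M (poly h a) = w'"
      by (rule gauss[OF M \<open>h \<noteq> 0\<close>])
    have fin: "finite (S \<union> S')" "S \<union> S' \<subseteq> D" using w(1,2) w'(1,2) by auto
    have "\<exists>c\<in>D. \<forall>s\<in>S \<union> S'. \<not> vge (v M) 1 (c - s)"
    proof (rule ccontr)
      assume "\<not> ?thesis"
      then have "\<forall>a\<in>D. \<exists>s\<in>S \<union> S'. vge (v M) 1 (a - s)" by blast
      with fin have "finite_residue M" unfolding finite_residue_def by (intro exI[of _ "S \<union> S'"] conjI)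
      then show False using inf by blast
    qed
    then obtain c where c: "c \<in> D" "\<forall>s\<in>S \<union> S'. \<not> vge (v M) 1 (c - s)" by (rule bexE)
    have "poly f c \<noteq> 0" "v M (poly f c) = w" "poly h c \<noteq> 0" "v M (poly h c) = w'" using bspec[OF w(4) c(1)] bspec[OF w'(4) c(1)] c(2) by simp_all
    then have "phi M c F \<le> w" "phi M c H \<le> w'"
      using phi_char(2)[OF ok c(1) F f(1)] phi_char(2)[OF ok c(1) H(1) h(1)] by (auto simp: vge_def)
    moreover have "phi M c H = - phi M c F" by (rule phi_inv[OF ok c(1) F H])
    moreover have "w \<le> phi M a F" using bspec[OF w(3) ab(1)] f by (auto simp: vge_def)
    moreover have "w' \<le> phi M b H" using bspec[OF w'(3) ab(2)] h by (auto simp: vge_def)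
    moreover have "phi M b H = - phi M b F" by (rule phi_inv[OF ok ab(2) F H])
    ultimately show ?thesis by linarith
  qed
  then show ?thesis using ab by (intro antisym) auto
qed

end

context derived_stages
begin

lemma integral_at_TT: assumes "M \<in> NN \<beta>" shows "integral_at M (intpoly (TT \<beta>))"
proof -
  have "vge (v M) 0 (poly f a)" if "f \<in> intpoly (TT \<beta>)" "a \<in> D" for f a
    using that D_TT[of \<beta>] assms by (auto simp: intpoly_def TT_iff)
  then show ?thesis using sring_intpoly[OF sring_TT] NN_Mx[OF assms] by (auto simp: integral_at_def)
qed

text \<open>Values on D suffice, because D is dense in every D_M.\<close>

lemma intpoly_TT: "f \<in> intpoly (TT \<beta>) \<longleftrightarrow> (\<forall>M\<in>NN \<beta>. \<forall>a\<in>D. vge (v M) 0 (poly f a))"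
proof
  show "f \<in> intpoly (TT \<beta>) \<Longrightarrow> \<forall>M\<in>NN \<beta>. \<forall>a\<in>D. vge (v M) 0 (poly f a)"
    using integral_at_TT by (auto simp: integral_at_def)
  assume f: "\<forall>M\<in>NN \<beta>. \<forall>a\<in>D. vge (v M) 0 (poly f a)"
  show "f \<in> intpoly (TT \<beta>)" unfolding intpoly_def mem_Collect_eq TT_iff
  proof (intro ballI)
    fix x M assume "x \<in> TT \<beta>" and M: "M \<in> NN \<beta>"
    then have vx: "vge (v M) 0 x" by (simp add: TT_iff)
    have fM: "vge (v M) 0 (poly f a)" if "a \<in> D" for a using f M that by blast
    show "vge (v M) 0 (poly f x)" by (rule intpoly_locI[OF NN_Mx[OF M] fM vx])
  qed
qed

lemma intpoly_D_TT: "intpoly D \<subseteq> intpoly (TT \<beta>)"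
  using intpoly_D_vge NN_Mx by (auto simp: intpoly_TT)

end

section \<open>Characteristic functions of residue balls\<close>

context almost_dedekind_domain
begin

text \<open>A representative of the class of x modulo M^n. Congruent arguments give the same
  predicate, hence the same choice, so \<open>rho M n\<close> behaves as a normal form and its image
  as the residue ring.\<close>

definition rho :: "'a set \<Rightarrow> nat \<Rightarrow> 'a \<Rightarrow> 'a" where
  "rho M n x = (SOME y. y \<in> D \<and> vge (v M) (int n) (x - y))"

lemma rho_D: assumes "M \<in> Mx" "x \<in> D" shows "rho M n x \<in> D" "vge (v M) (int n) (x - rho M n x)"
proof -
  have "x \<in> D \<and> vge (v M) (int n) (x - x)" using assms by (simp add: vge_def)
  then have "rho M n x \<in> D \<and> vge (v M) (int n) (x - rho M n x)" unfolding rho_def by (rule someI)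
  then show "rho M n x \<in> D" "vge (v M) (int n) (x - rho M n x)" by auto
qed

lemma vge_sym: "M \<in> Mx \<Longrightarrow> vge (v M) n (x - y) \<Longrightarrow> vge (v M) n (y - x)"
  using valn.vge_minus[OF v_props(1), of M n "x - y"] by simp

lemma vge_trans: "M \<in> Mx \<Longrightarrow> vge (v M) n (x - y) \<Longrightarrow> vge (v M) n (y - z) \<Longrightarrow> vge (v M) n (x - z)"
  using valn.vge_add[OF v_props(1), of M n "x - y" "y - z"] by simp

lemma rho_cong: assumes "M \<in> Mx" "vge (v M) (int n) (x - y)" shows "rho M n x = rho M n y"
proof -
  have "vge (v M) (int n) (x - z) \<longleftrightarrow> vge (v M) (int n) (y - z)" for z
    using vge_trans[OF assms(1), of "int n" x y z] vge_trans[OF assms(1), of "int n" y x z]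
      vge_sym[OF assms] assms(2) by blast
  then show ?thesis by (simp add: rho_def)
qed

lemma rho_eq_iff: assumes "M \<in> Mx" "x \<in> D" "y \<in> D"
  shows "rho M n x = rho M n y \<longleftrightarrow> vge (v M) (int n) (x - y)"
proof
  assume e: "rho M n x = rho M n y"
  have "vge (v M) (int n) (rho M n x - y)" unfolding e by (rule vge_sym[OF assms(1) rho_D(2)[OF assms(1,3)]])
  then show "vge (v M) (int n) (x - y)" by (rule vge_trans[OF assms(1) rho_D(2)[OF assms(1,2)]])
next
  show "vge (v M) (int n) (x - y) \<Longrightarrow> rho M n x = rho M n y" by (rule rho_cong[OF assms(1)])
qed

lemma rho_rho: assumes "M \<in> Mx" "x \<in> D" "n \<le> m" shows "rho M n (rho M m x) = rho M n x"
proof -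
  have "vge (v M) (int n) (x - rho M m x)"
    using rho_D(2)[OF assms(1,2), of m] assms(3) valn.vge_mono[OF v_props(1)[OF assms(1)]] by simp
  from rho_cong[OF assms(1) vge_sym[OF assms(1) this]] show ?thesis .
qed

lemma rho_image: "M \<in> Mx \<Longrightarrow> p \<in> rho M n ` D \<Longrightarrow> p \<in> D \<and> rho M n p = p"
  using rho_D rho_rho[of M _ n n] by auto

lemma finite_rho: assumes M: "M \<in> Mx" and fin: "finite_residue M" shows "finite (rho M n ` D)"
proof (induction n)
  interpret valn "v M" using M by (rule v_props)
  case 0
  have "rho M 0 ` D \<subseteq> {rho M 0 0}"
  proof clarify
    fix x assume "x \<in> D"
    then have "vge (v M) (int 0) (x - 0)" using D_vge[OF M] by simp
    then show "rho M 0 x = rho M 0 0" by (rule rho_cong[OF M])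
  qed
  then show ?case by (rule finite_subset) simp
next
  interpret valn "v M" using M by (rule v_props)
  case (Suc n)
  obtain S where S: "finite S" "S \<subseteq> D" "\<forall>a\<in>D. \<exists>s\<in>S. vge (v M) 1 (a - s)"
    using fin by (auto simp: finite_residue_def)
  obtain \<pi> where pi: "\<pi> \<noteq> 0" "v M \<pi> = 1" by (rule v_elt)
  \<comment> \<open>One more digit s in a \<pi>-adic expansion. The element \<pi> can lie outside D,
    but \<open>rho_cong\<close> asks only for the congruence.\<close>
  define g where "g = (\<lambda>(r, s). rho M (Suc n) (r + \<pi> ^ n * s))"
  have "rho M (Suc n) ` D \<subseteq> g ` (rho M n ` D \<times> S)"
  proof clarify
    fix x assume x: "x \<in> D"
    let ?r = "rho M n x"
    have vp: "v M (\<pi> ^ n) = int n" using pi by (simp add: v_power)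
    have "vge (v M) 0 ((x - ?r) / \<pi> ^ n)"
      using rho_D(2)[OF M x, of n] pi vp by (cases "x - ?r = 0") (auto simp: vge_def v_divide)
    then obtain a where a: "a \<in> D" "vge (v M) (int 1) ((x - ?r) / \<pi> ^ n - a)" by (rule loc_dense[OF M])
    obtain s where s: "s \<in> S" "vge (v M) 1 (a - s)" using S(3) a(1) by blast
    have "vge (v M) 1 ((x - ?r) / \<pi> ^ n - s)" by (rule vge_trans[OF M _ s(2)]) (use a(2) in simp)
    then have "vge (v M) (int n + 1) (\<pi> ^ n * ((x - ?r) / \<pi> ^ n - s))"
      using vp by (intro vge_mult) (auto simp: vge_def)
    moreover have "\<pi> ^ n * ((x - ?r) / \<pi> ^ n - s) = x - (?r + \<pi> ^ n * s)" using pi by (simp add: field_simps)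
    ultimately have "vge (v M) (int (Suc n)) (x - (?r + \<pi> ^ n * s))" by (simp add: add.commute)
    then have "rho M (Suc n) x = g (?r, s)" unfolding g_def prod.case by (rule rho_cong[OF M])
    then show "rho M (Suc n) x \<in> g ` (rho M n ` D \<times> S)" using x s by blast
  qed
  moreover have "finite (g ` (rho M n ` D \<times> S))" using Suc S by blast
  ultimately show ?case by (rule finite_subset)
qed

lemma (in valn) vge_prod_one:
  assumes "\<And>i. i \<in> S \<Longrightarrow> vge v 1 (f i - 1)" shows "vge v 1 (prod f S - 1)"
  using assms
proof (induction S rule: infinite_finite_induct)
  case (insert x S)
  have e: "prod f (insert x S) - 1 = f x * (prod f S - 1) + (f x - 1)" using insert by (simp add: algebra_simps)
  have 1: "vge v 1 (f x - 1)" "vge v 1 (prod f S - 1)" using insert by auto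
  then have "vge v 0 (f x - 1 + 1)" by (intro vge_add) (auto elim: vge_mono)
  then have "vge v 0 (f x)" by simp
  then show ?case unfolding e by (intro vge_add vge_mult0 1)
qed auto

text \<open>Translation by c - b permutes the residue classes modulo M^n and preserves the values of
  differences of distinct classes.\<close>

lemma rho_sum_shift:
  assumes M: "M \<in> Mx" and b: "b \<in> rho M n ` D" and c: "c \<in> rho M n ` D"
  shows "(\<Sum>x\<in>rho M n ` D - {b}. v M (b - x)) = (\<Sum>x\<in>rho M n ` D - {c}. v M (c - x))"
proof -
  interpret valn "v M" using M by (rule v_props)
  let ?R = "rho M n ` D"
  have inv: "rho M n (rho M n (x + c' - b') + b' - c') = x" "rho M n (x + c' - b') \<in> ?R - {c'}"
    "v M (b' - x) = v M (c' - rho M n (x + c' - b'))"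
    if x: "x \<in> ?R - {b'}" and b': "b' \<in> ?R" and c': "c' \<in> ?R" for x b' c'
  proof -
    have D: "x \<in> D" "b' \<in> D" "c' \<in> D" and r: "rho M n x = x" "rho M n b' = b'" "rho M n c' = c'"
      using rho_image[OF M, of x n] rho_image[OF M b'] rho_image[OF M c'] x by blast+
    define y where "y = x + c' - b'"
    have y: "y \<in> D" using D by (simp add: y_def D_closed D_diff)
    note ry = rho_D[OF M y, of n]
    have "vge (v M) (int n) ((rho M n y + b' - c') - x)"
      using vge_sym[OF M ry(2)] by (simp add: y_def algebra_simps)
    then have "rho M n (rho M n y + b' - c') = rho M n x" by (rule rho_cong[OF M])
    then show "rho M n (rho M n (x + c' - b') + b' - c') = x" using r by (simp add: y_def)
    have nb: "\<not> vge (v M) (int n) (b' - x)"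
      using rho_eq_iff[OF M D(2) D(1), of n] r x by auto
    have e0: "(b' - x) + (y - rho M n y) = c' - rho M n y" by (simp add: y_def)
    have "b' - x \<noteq> 0" "vge (v M) (v M (b' - x) + 1) (y - rho M n y)"
      using nb ry(2) by (auto simp: vge_def)
    from v_add_eq[OF this, unfolded e0]
    have e: "c' - rho M n y \<noteq> 0" "v M (c' - rho M n y) = v M (b' - x)" by blast+
    then show "v M (b' - x) = v M (c' - rho M n (x + c' - b'))" by (simp add: y_def)
    show "rho M n (x + c' - b') \<in> ?R - {c'}" using e y unfolding y_def by auto
  qed
  show ?thesis
    by (rule sum.reindex_bij_witness[of _ "\<lambda>x. rho M n (x + b - c)" "\<lambda>x. rho M n (x + c - b)"])
      (use inv b c in auto)
qed

text \<open>The polynomial is the product of (X - b) / (q - b) over the other classes b modulo M^n.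
  On the ball around q every factor is 1 modulo M. If a lies in another class c,
  \<open>rho_sum_shift\<close> cancels all terms but two, leaving the value v(a - c) - v(c - q), at
  least n - (n - 1) = 1.\<close>

lemma ball_poly:
  assumes M: "M \<in> Mx" and fin: "finite_residue M" and p: "p \<in> D"
  obtains h where "\<forall>a\<in>D. vge (v M) (int n) (a - p) \<longrightarrow> vge (v M) 1 (poly h a - 1)"
    "\<forall>a\<in>D. \<not> vge (v M) (int n) (a - p) \<longrightarrow> vge (v M) 1 (poly h a)"
proof -
  interpret valn "v M" using M by (rule v_props)
  let ?R = "rho M n ` D"
  define q where "q = rho M n p"
  have q: "q \<in> ?R" "q \<in> D" using p rho_D[OF M p] by (auto simp: q_def)
  have rq: "rho M n q = q" using rho_image[OF M q(1)] by blast
  have pq: "vge (v M) (int n) (a - p) \<longleftrightarrow> vge (v M) (int n) (a - q)" if "a \<in> D" for a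
    using rho_eq_iff[OF M that p, of n] rho_eq_iff[OF M that q(2), of n] rq by (simp add: q_def)
  have finR: "finite ?R" by (rule finite_rho[OF M fin])
  define h where "h = (\<Prod>b\<in>?R - {q}. smult (1 / (q - b)) [:- b, 1:])"
  have ph: "poly h a = (\<Prod>b\<in>?R - {q}. (a - b) / (q - b))" for a
    by (simp add: h_def poly_prod diff_divide_distrib)
  have bD: "b \<in> D" "rho M n b = b" if "b \<in> ?R" for b using rho_image[OF M that] by blast+
  have nb: "\<not> vge (v M) (int n) (c - b)" if "b \<in> ?R" "c \<in> ?R" "b \<noteq> c" for b c
  proof
    assume "vge (v M) (int n) (c - b)"
    then have "rho M n c = rho M n b" by (rule rho_cong[OF M])
    then show False using bD(2)[OF that(1)] bD(2)[OF that(2)] that(3) by simp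
  qed
  have 1: "vge (v M) 1 (poly h a - 1)" if a: "a \<in> D" "vge (v M) (int n) (a - q)" for a
    unfolding ph
  proof (rule vge_prod_one)
    fix b assume "b \<in> ?R - {q}"
    then have n: "\<not> vge (v M) (int n) (q - b)" using nb[of b q] q by auto
    then have n0: "q - b \<noteq> 0" "v M (q - b) < int n" by (auto simp: vge_def)
    then have "(a - b) / (q - b) - 1 = (a - q) / (q - b)" by (simp add: field_simps)
    then show "vge (v M) 1 ((a - b) / (q - b) - 1)" using n0 a(2) by (cases "a - q = 0") (auto simp: vge_def v_divide)
  qed
  have 2: "vge (v M) 1 (poly h a)" if a: "a \<in> D" "\<not> vge (v M) (int n) (a - q)" for a
  proof (cases "poly h a = 0")
    case False
    then have nz: "a - b \<noteq> 0" if "b \<in> ?R - {q}" for b using that finR unfolding ph by auto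
    define c where "c = rho M n a"
    have c: "c \<in> ?R" "vge (v M) (int n) (a - c)" using rho_D[OF M a(1)] a(1) by (auto simp: c_def)
    then have cq: "c \<noteq> q" using a by auto
    then have cR: "c \<in> ?R - {q}" using c by blast
    have va: "v M (a - b) = v M (c - b)" if "b \<in> ?R - {q} - {c}" for b
    proof -
      have "\<not> vge (v M) (int n) (c - b)" using nb[of b c] c that by auto
      then have "c - b \<noteq> 0" "vge (v M) (v M (c - b) + 1) (a - c)" using c(2) by (auto simp: vge_def)
      from v_add_eq(2)[OF this] show ?thesis by simp
    qed
    have "v M (poly h a) = (\<Sum>b\<in>?R - {q}. v M (a - b) - v M (q - b))"
    proof -
      have "v M (poly h a) = (\<Sum>b\<in>?R - {q}. v M ((a - b) / (q - b)))"
        unfolding ph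
      proof (rule v_prod)
        fix b assume "b \<in> ?R - {q}"
        then have "a - b \<noteq> 0" "q - b \<noteq> 0" using nz by auto
        then show "(a - b) / (q - b) \<noteq> 0" by simp
      qed
      also have "\<dots> = (\<Sum>b\<in>?R - {q}. v M (a - b) - v M (q - b))"
      proof (rule sum.cong[OF refl])
        fix b assume "b \<in> ?R - {q}"
        then have "a - b \<noteq> 0" "q - b \<noteq> 0" using nz by auto
        then show "v M ((a - b) / (q - b)) = v M (a - b) - v M (q - b)" by (rule v_divide)
      qed
      finally show ?thesis .
    qed
    also have "\<dots> = (\<Sum>b\<in>?R - {q}. v M (a - b)) - (\<Sum>b\<in>?R - {q}. v M (q - b))" by (rule sum_subtractf)
    also have "(\<Sum>b\<in>?R - {q}. v M (q - b)) = (\<Sum>b\<in>?R - {c}. v M (c - b))"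
      by (rule rho_sum_shift[OF M q(1) c(1)])
    also have "\<dots> = v M (c - q) + (\<Sum>b\<in>?R - {c} - {q}. v M (c - b))"
      using finR q cq by (intro sum.remove) auto
    also have "(\<Sum>b\<in>?R - {q}. v M (a - b)) = v M (a - c) + (\<Sum>b\<in>?R - {q} - {c}. v M (a - b))"
      using finR cR by (intro sum.remove) auto
    also have "(\<Sum>b\<in>?R - {q} - {c}. v M (a - b)) = (\<Sum>b\<in>?R - {q} - {c}. v M (c - b))"
      by (intro sum.cong va) auto
    also have "?R - {q} - {c} = ?R - {c} - {q}" by blast
    finally have "v M (poly h a) = v M (a - c) - v M (c - q)" by simp
    moreover have "v M (a - c) \<ge> int n" using c(2) nz[OF cR] by (auto simp: vge_def)
    moreover have "v M (c - q) < int n" using nb[of q c] q c cq by (auto simp: vge_def)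
    ultimately show ?thesis by (simp add: vge_def)
  qed simp
  show ?thesis
    by (rule that[of h]) (use 1 2 pq in blast)+
qed

end

section \<open>Localization of integer-valued polynomials\<close>

lemma intpoly_ext_eq: "intpoly_ext D T = mprod (constp ` T) (intpoly D)"
proof -
  have "{smult t f | t f. t \<in> T \<and> f \<in> intpoly D} = {a * b | a b. a \<in> constp ` T \<and> b \<in> intpoly D}"
    by (force simp: constp_def)
  then show ?thesis by (simp add: intpoly_ext_def sum_lists_eq_addhull mprod_def)
qed

lemma constp_mult: "constp t * f = smult t f"
  by (simp add: constp_def)

context almost_dedekind_domain
begin

text \<open>The localization of C at M, kept inside K[X] so that different M can be
  compared.\<close>

definition local_at :: "'a set \<Rightarrow> 'a poly set \<Rightarrow> 'a poly set" where
  "local_at M C = {f. \<exists>s\<in>D. s \<notin> M \<and> smult s f \<in> C}"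

definition D_module :: "'a poly set \<Rightarrow> bool" where
  "D_module C \<longleftrightarrow> add_closed C \<and> (\<forall>d\<in>D. \<forall>f\<in>C. smult d f \<in> C)"

lemma smod_dmod: assumes "smod (intpoly D) C" shows "D_module C"
proof -
  have "smult d f \<in> C" if "d \<in> D" "f \<in> C" for d f
  proof -
    have "constp d \<in> intpoly D" using that constp_intpoly[OF sring_D] by blast
    then have "constp d * f \<in> C" using assms that(2) unfolding smod_def by blast
    then show ?thesis by (simp add: constp_mult)
  qed
  then show ?thesis using assms by (auto simp: D_module_def smod_def)
qed

lemma dmod_B: "D_module (intpoly D)"
  by (rule smod_dmod[OF smod_self[OF sring_intpoly[OF sring_D]]])

lemma addc_locm: assumes M: "M \<in> Mx" and C: "D_module C" shows "add_closed (local_at M C)"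
  unfolding add_closed_def
proof (intro conjI ballI)
  show "0 \<in> local_at M C" using C MxD(3)[OF M] D_closed(2) by (auto simp: local_at_def D_module_def add_closed_def intro!: bexI[of _ 1])
  fix f g assume "f \<in> local_at M C" "g \<in> local_at M C"
  then obtain s t where st: "s \<in> D" "s \<notin> M" "smult s f \<in> C" "t \<in> D" "t \<notin> M" "smult t g \<in> C"
    by (auto simp: local_at_def)
  have "smult (s * t) (f + g) = smult t (smult s f) + smult s (smult t g)"
    by (simp add: smult_add_right mult.commute)
  also have "\<dots> \<in> C" using C st unfolding D_module_def add_closed_def by blast
  finally show "f + g \<in> local_at M C" using M_prime[OF M st(1,2,4,5)] by (auto simp: local_at_def)
qed

lemma mprod_locm:
  assumes M: "M \<in> Mx" and C: "D_module C" and T: "T \<subseteq> loc M" and f: "f \<in> mprod C (constp ` T)"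
  shows "f \<in> local_at M C"
proof -
  have "mprod C (constp ` T) \<subseteq> local_at M C"
  proof (rule mprod_least[OF _ addc_locm[OF M C]])
    fix g c assume "g \<in> C" "c \<in> constp ` T"
    then obtain t where t: "t \<in> T" "c = constp t" by blast
    then have "vge (v M) 0 t" using T v_props(2)[OF M] by auto
    then obtain a s where as: "a \<in> D" "s \<in> D" "s \<notin> M" "s \<noteq> 0" "v M s = 0" "t = a / s" by (rule locE[OF M])
    have "g * c = smult t g" using t by (simp add: constp_def mult.commute)
    then have "smult s (g * c) = smult a g" using as by simp
    also have "\<dots> \<in> C" using C \<open>g \<in> C\<close> as by (simp add: D_module_def)
    finally show "g * c \<in> local_at M C" using as by (auto simp: local_at_def)
  qed
  then show ?thesis using f by blast
qed

lemma locm_B_vge: assumes M: "M \<in> Mx" and f: "f \<in> local_at M (intpoly D)" and a: "a \<in> D"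
  shows "vge (v M) 0 (poly f a)"
proof -
  interpret valn "v M" using M by (rule v_props)
  obtain s where s: "s \<in> D" "s \<notin> M" "smult s f \<in> intpoly D" using f by (auto simp: local_at_def)
  have "vge (v M) 0 (s * poly f a)" using intpoly_D_vge[OF M s(3) a] by simp
  then show ?thesis using unit_v[OF M s(1,2)] by (cases "poly f a = 0") (auto simp: vge_def v_mult)
qed

lemma poly_denominator: "\<exists>d\<in>D. d \<noteq> 0 \<and> smult d f \<in> intpoly D"
proof (induction f)
  case 0
  then show ?case using D_closed by (intro bexI[of _ 1]) (auto simp: intpoly_def)
next
  case (pCons c f)
  then obtain d where d: "d \<in> D" "d \<noteq> 0" "smult d f \<in> intpoly D" by blast
  obtain a b where ab: "a \<in> D" "b \<in> D" "b \<noteq> 0" "c = a / b" using D_quotient by blast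
  have "smult (b * d) (pCons c f) \<in> intpoly D" unfolding intpoly_def
  proof clarify
    fix x assume x: "x \<in> D"
    have "d * poly f x \<in> D" using d(3) x by (simp add: intpoly_def)
    then have "d * a + b * (x * (d * poly f x)) \<in> D"
      using D_closed(3)[OF D_closed(4)[OF d(1) ab(1)] D_closed(4)[OF ab(2) D_closed(4)[OF x]]] by blast
    moreover have "poly (smult (b * d) (pCons c f)) x = d * a + b * (x * (d * poly f x))"
      using ab by (simp add: field_simps)
    ultimately show "poly (smult (b * d) (pCons c f)) x \<in> D" by (simp only:)
  qed
  then show ?case using ab d D_closed by (intro bexI[of _ "b * d"]) auto
qed

text \<open>The t in T that multiply f into C T form an ideal. It contains the nonzero d and, for
  every M with T inside D_M, an element outside M; by \<open>overring_max\<close> it contains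
  1.\<close>

lemma local_global:
  assumes T: "sring T" "D \<subseteq> T" and C: "D_module C" and d: "d \<in> D" "d \<noteq> 0" "smult d f \<in> C"
    and f: "\<And>M. M \<in> Mx \<Longrightarrow> T \<subseteq> loc M \<Longrightarrow> f \<in> local_at M C"
  shows "f \<in> mprod C (constp ` T)"
proof (rule ccontr)
  assume n: "f \<notin> mprod C (constp ` T)"
  let ?CT = "mprod C (constp ` T)"
  let ?I = "{t \<in> T. smult t f \<in> ?CT}"
  have T': "x \<in> T \<Longrightarrow> y \<in> T \<Longrightarrow> x * y \<in> T" "x \<in> T \<Longrightarrow> y \<in> T \<Longrightarrow> x + y \<in> T" "1 \<in> T" "0 \<in> T" for x y
    using T by (auto simp: sring_def add_closed_def)
  have CT: "smult t g \<in> ?CT" if "t \<in> T" "g \<in> ?CT" for t g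
  proof -
    have "?CT \<subseteq> {g. smult t g \<in> ?CT}"
    proof (rule mprod_least)
      show "add_closed {g. smult t g \<in> ?CT}" using addc_mprod[of C "constp ` T"] by (auto simp: add_closed_def smult_add_right)
      fix c u assume c: "c \<in> C" "u \<in> constp ` T"
      then obtain u' where u': "u' \<in> T" "u = constp u'" by blast
      have "smult t (c * u) = c * constp (t * u')" using u' by (simp add: constp_def mult.commute)
      also have "\<dots> \<in> ?CT" using c T' u' that by (intro mprodI) auto
      finally show "c * u \<in> {g. smult t g \<in> ?CT}" by simp
    qed
    then show ?thesis using that by blast
  qed
  have C_CT: "c \<in> ?CT" if "c \<in> C" for c
  proof -
    have "c * constp 1 \<in> ?CT" using that T' by (intro mprodI) auto
    then show ?thesis by (simp add: constp_def flip: one_pCons)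
  qed
  have "smod T ?I" unfolding smod_def add_closed_def
  proof (intro conjI ballI)
    have "(0::'a poly) \<in> ?CT" using addc_mprod[of C "constp ` T"] by (simp add: add_closed_def)
    then show "0 \<in> ?I" using T' by simp
    fix x y assume xy: "x \<in> ?I" "y \<in> ?I"
    then have "smult x f + smult y f \<in> ?CT" using addc_mprod[of C "constp ` T"] unfolding add_closed_def by blast
    then show "x + y \<in> ?I" using xy T' by (simp add: smult_add_left)
  next
    fix a x assume ax: "a \<in> T" "x \<in> ?I"
    then have "smult a (smult x f) \<in> ?CT" using CT[of a "smult x f"] by blast
    then show "a * x \<in> ?I" using ax T' by simp
  qed
  moreover have "1 \<notin> ?I" using n by simp
  moreover have "d \<in> ?I" using d T C_CT by auto
  ultimately obtain M where M: "M \<in> Mx" "T \<subseteq> loc M" "\<forall>x\<in>?I. vge (v M) 1 x"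
    using overring_max[OF T, of ?I d] d(2) by blast
  obtain s where s: "s \<in> D" "s \<notin> M" "smult s f \<in> C" using f[OF M(1,2)] by (auto simp: local_at_def)
  have "s \<in> ?I" using s T C_CT by auto
  with M(3) have "vge (v M) 1 s" by (rule bspec)
  then show False using unit_v[OF M(1) s(1,2)] by (simp add: vge_def)
qed

lemma local_global_D:
  assumes C: "D_module C" and d: "d \<in> D" "d \<noteq> 0" "smult d f \<in> C"
    and f: "\<And>M. M \<in> Mx \<Longrightarrow> f \<in> local_at M C"
  shows "f \<in> C"
proof -
  have "f \<in> mprod C (constp ` D)" by (rule local_global[OF sring_D subset_refl C d f])
  moreover have "mprod C (constp ` D) \<subseteq> C"
  proof (rule mprod_least)
    show "add_closed C" using C by (simp add: D_module_def)
    fix a b assume "a \<in> C" "b \<in> constp ` D"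
    then show "a * b \<in> C" using C by (auto simp: D_module_def constp_def mult.commute)
  qed
  ultimately show ?thesis by blast
qed

lemma mprod_constp_finite:
  assumes "f \<in> mprod C (constp ` T)"
  obtains W where "finite W" "W \<subseteq> T" "f \<in> mprod C (constp ` W)"
proof -
  obtain X Y where XY: "finite Y" "X \<subseteq> C" "Y \<subseteq> constp ` T" "f \<in> mprod X Y"
    using assms by (rule mprod_finite)
  obtain W where W: "W \<subseteq> T" "finite W" "Y = constp ` W" using finite_subset_image[OF XY(1,3)] by blast
  have "mprod X Y \<subseteq> mprod C (constp ` W)" using XY W by (intro mprod_mono) auto
  then show ?thesis using that W XY by blast
qed

lemma normalize_value:
  assumes F: "F \<in> INV (intpoly D)"
  obtains G where "G \<in> INV (intpoly D)" "\<forall>M\<in>Mx. \<forall>a\<in>D. phi M a G = phi M a F - phi M 0 F"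
proof -
  let ?B = "intpoly D"
  define J where "J = cext D (exts (ev 0) D F)"
  have B: "sring ?B" by (rule sring_intpoly[OF sring_D])
  have J: "J \<in> INV ?B" unfolding J_def by (rule cext_INV[OF sring_D value_ideal(1)[OF F]])
  obtain H where H: "H \<in> INV ?B" "mprod J H = ?B" using J by (rule INV_E)
  have "phi M a (mprod F H) = phi M a F - phi M 0 F" if M: "M \<in> Mx" "a \<in> D" for M a
  proof -
    have "phi M a J = phi M 0 F" unfolding J_def by (rule value_ideal(2)[OF F M])
    then show ?thesis
      using phi_mult[OF integral_at_D[OF M(1)] M(2) F H(1)] phi_inv[OF integral_at_D[OF M(1)] M(2) J H] by simp
  qed
  then show ?thesis using that[OF INV_mprod[OF B F H(1)]] by blast
qed

end

section \<open>Spreading integrality from a stage, and the ball ideals\<close>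

locale int_compatible = derived_stages D \<alpha> for D :: "'a::field set" and \<alpha> :: "'o::wellorder" +
  assumes Int_loc_eq: "M \<in> Mx \<Longrightarrow> M \<notin> NN \<alpha> \<Longrightarrow> intpoly_ext D (loc M) = intpoly (loc M)"
    and Int_TT_eq: "intpoly_ext D (TT \<alpha>) = intpoly (TT \<alpha>)"
begin

abbreviation B where "B \<equiv> intpoly D"

lemma sring_B: "sring B" by (rule sring_intpoly[OF sring_D])

lemma intpoly_loc_locm: assumes M: "M \<in> Mx" "M \<notin> NN \<alpha>" and f: "f \<in> intpoly (loc M)" shows "f \<in> local_at M B"
proof -
  have "f \<in> mprod B (constp ` loc M)" using f Int_loc_eq[OF M] by (simp add: intpoly_ext_eq mprod_comm)
  then show ?thesis by (rule mprod_locm[OF M(1) dmod_B subset_refl])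
qed

text \<open>The two hypotheses on Int(D) divide the work: for M in \<open>NN \<alpha>\<close> the
  polynomial is regarded in Int(T_\<alpha>), for the other M in Int(D_M).\<close>

lemma locm_B_stage:
  assumes b: "\<beta> \<le> \<alpha>" and f: "\<And>M a. M \<in> NN \<beta> \<Longrightarrow> a \<in> D \<Longrightarrow> vge (v M) 0 (poly f a)" and M: "M \<in> NN \<beta>"
  shows "f \<in> local_at M B"
proof (cases "M \<in> NN \<alpha>")
  case True
  have "f \<in> intpoly (TT \<alpha>)" using f NN_antimono[OF b] by (auto simp: intpoly_TT)
  then have "f \<in> mprod B (constp ` TT \<alpha>)" using Int_TT_eq by (simp add: intpoly_ext_eq mprod_comm)
  then show ?thesis by (rule mprod_locm[OF NN_Mx[OF M] dmod_B TT_loc[OF True]])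
next
  case False
  then show ?thesis using intpoly_loc_locm[OF NN_Mx[OF M]] f[OF M] intpoly_loc[OF NN_Mx[OF M]] by blast
qed

text \<open>Membership in C T_\<beta> involves finitely many elements of T_\<beta>; wherever these
  are integral, the same expression proves local membership.\<close>

lemma locm_open:
  assumes C: "D_module C" and d: "d \<in> D" "d \<noteq> 0" "smult d f \<in> C" and f: "\<And>M. M \<in> NN \<beta> \<Longrightarrow> f \<in> local_at M C"
  obtains W where "finite W" "W \<subseteq> TT \<beta>" "\<forall>M\<in>Mx. W \<subseteq> loc M \<longrightarrow> f \<in> local_at M C"
proof -
  have "f \<in> mprod C (constp ` TT \<beta>)"
  proof (rule local_global[OF sring_TT D_TT C d])
    fix M assume "M \<in> Mx" "TT \<beta> \<subseteq> loc M"
    then have "M \<in> NN \<beta>" using NN_iff by blast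
    then show "f \<in> local_at M C" by (rule f)
  qed
  then obtain W where W: "finite W" "W \<subseteq> TT \<beta>" "f \<in> mprod C (constp ` W)" by (rule mprod_constp_finite)
  then show ?thesis using that mprod_locm[OF _ C _ W(3)] by blast
qed

text \<open>Divided by its value ideal, F has value zero on \<open>NN \<beta>\<close>. Finitely many
  generators of the quotient and of its inverse are then locally in Int(D) on
  \<open>NN \<beta>\<close>, hence wherever a finite set is integral. There the values of both are
  nonnegative with sum zero.\<close>

lemma phi_const_open:
  assumes b: "\<beta> \<le> \<alpha>" and F: "F \<in> INV B" and c: "\<And>M a. M \<in> NN \<beta> \<Longrightarrow> a \<in> D \<Longrightarrow> phi M a F = phi M 0 F"
  obtains W where "finite W" "W \<subseteq> TT \<beta>" "\<forall>M\<in>Mx. W \<subseteq> loc M \<longrightarrow> (\<forall>a\<in>D. phi M a F = phi M 0 F)"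
proof -
  obtain G where G: "G \<in> INV B" "\<forall>M\<in>Mx. \<forall>a\<in>D. phi M a G = phi M a F - phi M 0 F"
    by (rule normalize_value[OF F])
  obtain H where H: "H \<in> INV B" "smod B G" "smod B H" "mprod G H = B" using G(1) by (rule INV_E)
  obtain X Y where XY: "finite X" "finite Y" "X \<subseteq> G" "Y \<subseteq> H" "1 \<in> mprod X Y" "G = mprod X B" "H = mprod Y B"
    using INV_finite_gens[OF sring_B H(2-4)] by metis
  have z: "phi M a G = 0" if "M \<in> NN \<beta>" "a \<in> D" for M a
    using G(2) NN_Mx[OF that(1)] c[OF that] that(2) by simp
  have zH: "phi M a H = - phi M a G" if "M \<in> Mx" "a \<in> D" for M a
    by (rule phi_inv[OF integral_at_D[OF that(1)] that(2) G(1) H(1,4)])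
  have "\<forall>f\<in>X \<union> Y. \<exists>W. finite W \<and> W \<subseteq> TT \<beta> \<and> (\<forall>M\<in>Mx. W \<subseteq> loc M \<longrightarrow> f \<in> local_at M B)"
  proof
    fix f assume f: "f \<in> X \<union> Y"
    have v: "vge (v M) 0 (poly f a)" if Ma: "M \<in> NN \<beta>" "a \<in> D" for M a
      using f phi_char(2)[OF integral_at_D[OF NN_Mx[OF Ma(1)]] Ma(2) G(1), of f]
        phi_char(2)[OF integral_at_D[OF NN_Mx[OF Ma(1)]] Ma(2) H(1), of f] XY(3,4) z[OF Ma] zH[OF NN_Mx[OF Ma(1)] Ma(2)] by auto
    obtain d where "d \<in> D" "d \<noteq> 0" "smult d f \<in> B" using poly_denominator by blast
    then obtain W where "finite W" "W \<subseteq> TT \<beta>" "\<forall>M\<in>Mx. W \<subseteq> loc M \<longrightarrow> f \<in> local_at M B"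
      by (rule locm_open[OF dmod_B _ _ _ locm_B_stage[OF b v]])
    then show "\<exists>W. finite W \<and> W \<subseteq> TT \<beta> \<and> (\<forall>M\<in>Mx. W \<subseteq> loc M \<longrightarrow> f \<in> local_at M B)" by blast
  qed
  from bchoice[OF this] obtain W where W: "\<forall>f\<in>X \<union> Y. finite (W f) \<and> W f \<subseteq> TT \<beta> \<and> (\<forall>M\<in>Mx. W f \<subseteq> loc M \<longrightarrow> f \<in> local_at M B)"
    by (rule exE)
  define V where "V = (\<Union>f\<in>X \<union> Y. W f)"
  have V: "finite V" "V \<subseteq> TT \<beta>" using W XY(1,2) unfolding V_def by auto
  have "phi M a F = phi M 0 F" if M: "M \<in> Mx" "V \<subseteq> loc M" "a \<in> D" for M a
  proof -
    interpret valn "v M" using M by (intro v_props)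
    have loc: "vge (v M) 0 (poly f a)" if "f \<in> X \<union> Y" for f
    proof (rule locm_B_vge[OF M(1) _ M(3)])
      show "f \<in> local_at M B" using W that M(1,2) unfolding V_def by blast
    qed
    have "add_closed {g. vge (v M) 0 (poly g a)}" by (auto simp: add_closed_def intro: vge_add)
    then have sub: "mprod Z B \<subseteq> {g. vge (v M) 0 (poly g a)}" if "Z \<subseteq> X \<union> Y" for Z
      using loc that intpoly_D_vge[OF M(1) _ M(3)] by (intro mprod_least) (auto intro: vge_mult0)
    obtain g where g: "g \<in> G" "poly g a \<noteq> 0" "v M (poly g a) = phi M a G"
      using phi_char(1)[OF integral_at_D[OF M(1)] M(3) G(1)] by blast
    obtain h where h: "h \<in> H" "poly h a \<noteq> 0" "v M (poly h a) = phi M a H"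
      using phi_char(1)[OF integral_at_D[OF M(1)] M(3) H(1)] by blast
    have "vge (v M) 0 (poly g a)" "vge (v M) 0 (poly h a)" using sub[of X] sub[of Y] g(1) h(1) XY(6,7) by auto
    then have "phi M a G = 0" using g h zH[OF M(1,3)] by (auto simp: vge_def)
    then show ?thesis using G(2) M by simp
  qed
  then show ?thesis using that V by blast
qed

text \<open>With J the inverse of (1, y), let L be generated by 1 - e and J, and L' by e and J. Then
  L L' = J Int(D): the product e (1 - e) lies there because y e (1 - e) is integer-valued, and e +
  (1 - e) = 1 recovers J. So L is invertible.\<close>

lemma ball_ideal_exists:
  assumes iso: "isol \<gamma> M z" and g: "\<gamma> < \<alpha>" and MN: "M \<notin> NN \<alpha>" and fin: "finite_residue M" and p: "p \<in> D"
  obtains L where "L \<in> INV B" "exts id (intpoly (TT \<alpha>)) L = intpoly (TT \<alpha>)"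
    "\<forall>N\<in>NN \<gamma>. N \<noteq> M \<longrightarrow> (\<forall>a\<in>D. phi N a L = 0)"
    "\<forall>a\<in>D. phi M a L = (if vge (v M) (int n) (a - p) then 1 else 0)"
proof -
  have M: "M \<in> Mx" using iso NN_Mx by (auto simp: isol_def)
  interpret valn "v M" using M by (rule v_props)
  obtain h where h: "\<forall>a\<in>D. vge (v M) (int n) (a - p) \<longrightarrow> vge (v M) 1 (poly h a - 1)"
    "\<forall>a\<in>D. \<not> vge (v M) (int n) (a - p) \<longrightarrow> vge (v M) 1 (poly h a)"
    by (rule ball_poly[OF M fin p])
  have h0: "vge (v M) 0 (poly h a)" if a: "a \<in> D" for a
  proof (cases "vge (v M) (int n) (a - p)")
    case True
    then have "vge (v M) 1 (poly h a - 1)" using h(1) a by blast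
    then have "vge (v M) 0 (poly h a - 1)" by (rule vge_mono) simp
    from vge_add[OF this, of 1] show ?thesis by simp
  next
    case False
    then have "vge (v M) 1 (poly h a)" using h(2) a by blast
    then show ?thesis by (rule vge_mono) simp
  qed
  then have "h \<in> intpoly (loc M)" using intpoly_loc[OF M] by blast
  then obtain s where s: "s \<in> D" "s \<notin> M" "smult s h \<in> B" using intpoly_loc_locm[OF M MN] by (auto simp: local_at_def)
  obtain t m where t: "t \<in> D" "m \<in> M" "s * t = 1 - m" by (rule unit_mod[OF M s(1,2)])
  have mD: "m \<in> D" using t(2) MxD[OF M] by blast
  \<comment> \<open>A factor s outside M brings h into Int(D); the factor t undoes it modulo M,
    since s t = 1 - m, so the residues on and off the ball survive.\<close>
  define e where "e = smult t (smult s h)"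
  have eB: "e \<in> B" unfolding e_def using dmod_B s t unfolding D_module_def by blast
  have ea: "poly e a = poly h a - m * poly h a" for a
  proof -
    have "poly e a = (s * t) * poly h a" by (simp add: e_def)
    then show ?thesis unfolding t(3) by (simp add: algebra_simps)
  qed
  have mv: "vge (v M) 1 (m * poly h a)" if "a \<in> D" for a
    using M_iff[OF M mD] t(2) h0[OF that] by (intro vge_mult0') auto
  have e1: "vge (v M) 1 (1 - poly e a)" if a: "a \<in> D" "vge (v M) (int n) (a - p)" for a
  proof -
    have "vge (v M) 1 (poly h a - 1)" using h(1) a by blast
    from vge_diff[OF mv[OF a(1)] this] show ?thesis by (simp add: ea algebra_simps)
  qed
  have e2: "vge (v M) 1 (poly e a)" if a: "a \<in> D" "\<not> vge (v M) (int n) (a - p)" for a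
    using h(2) a mv[OF a(1)] by (simp add: ea vge_diff)
  have e0: "vge (v M) 0 (poly e a)" if a: "a \<in> D" for a by (rule intpoly_D_vge[OF M eB a])
  have z: "z \<noteq> 0" "v M z = -1" "\<forall>L\<in>NN \<gamma>. L \<noteq> M \<longrightarrow> vge (v L) 0 z" using iso by (auto simp: isol_def)
  \<comment> \<open>At every point one of e and 1 - e lies in M, which compensates the simple pole
    of z.\<close>
  have "smult z (e * (1 - e)) \<in> intpoly (loc M)" unfolding intpoly_loc[OF M]
  proof
    fix a assume a: "a \<in> D"
    have e0': "vge (v M) 0 (1 - poly e a)" using e0[OF a] by (intro vge_diff) auto
    have "vge (v M) 1 (poly e a * (1 - poly e a))"
    proof (cases "vge (v M) (int n) (a - p)")
      case True
      show ?thesis by (rule vge_mult0[OF e0[OF a] e1[OF a True]])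
    next
      case False
      show ?thesis by (rule vge_mult0'[OF e2[OF a False] e0'])
    qed
    then have "vge (v M) (- 1 + 1) (z * (poly e a * (1 - poly e a)))" using z by (intro vge_mult) (auto simp: vge_def)
    then show "vge (v M) 0 (poly (smult z (e * (1 - e))) a)" by simp
  qed
  then obtain u where u: "u \<in> D" "u \<notin> M" "smult u (smult z (e * (1 - e))) \<in> B"
    using intpoly_loc_locm[OF M MN] unfolding local_at_def by blast
  \<comment> \<open>The denominator u is a unit at M and integral everywhere, so y isolates M as z
    does.\<close>
  define y where "y = u * z"
  have y0: "y \<noteq> 0" "v M y = -1" using z unit_v[OF M u(1,2)] by (auto simp: y_def v_mult)
  have yN: "vge (v N) 0 y" if "N \<in> NN \<gamma>" "N \<noteq> M" for N
    unfolding y_def using that z(3) D_vge[OF NN_Mx[OF that(1)] u(1)]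
    by (intro valn.vge_mult0[OF v_props(1)[OF NN_Mx[OF that(1)]]]) auto
  have ye: "smult y (e * (1 - e)) \<in> B" using u(3) by (simp add: y_def)
  have "mprod {1, y} D \<in> INV D" by (rule pruefer[of _ 1]) auto
  then obtain J where J: "J \<in> INV D" "smod D J" "mprod (mprod {1, y} D) J = D" by (rule INV_E)
  have yJ: "mprod {1, y} J = D" using J(3) mprod_unit[OF sring_D J(2)] by (simp add: mprod_assoc)
  have jD: "j \<in> D" "y * j \<in> D" if "j \<in> J" for j
    using mprodI[of 1 "{1,y}" j J] mprodI[of y "{1,y}" j J] that yJ by auto
  have jM: "vge (v M) 1 j" if "j \<in> J" for j
  proof (cases "j = 0")
    case False
    then show ?thesis using D_vge[OF M jD(2)[OF that]] y0 by (auto simp: vge_def v_mult)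
  qed simp
  \<comment> \<open>Because 1 lies in (1, y) J, a lower bound l for the value of y forces some
    member of J to have value at most -l.\<close>
  have attain: "\<exists>j\<in>J. \<not> vge (v N) k j" if N: "N \<in> Mx" "vge (v N) l y" "l \<le> 0" "k + l = 1" for N k l
  proof (rule ccontr)
    interpret N: valn "v N" using N by (intro v_props)
    assume n: "\<not> ?thesis"
    have "mprod {1, y} J \<subseteq> {x. vge (v N) 1 x}"
    proof (rule mprod_least[OF _ N.addc_vge])
      fix a j assume aj: "a \<in> {1, y}" "j \<in> J"
      then have "vge (v N) l a" using N by auto
      moreover have "vge (v N) k j" using n aj by blast
      ultimately have "vge (v N) (l + k) (a * j)" by (rule N.vge_mult)
      then show "a * j \<in> {x. vge (v N) 1 x}" using N(4) by (simp add: add.commute)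
    qed
    then have "1 \<in> {x. vge (v N) 1 x}" using yJ D_closed(2) by blast
    then show False by simp
  qed
  define G where "G = insert (1 - e) (constp ` J)"
  define G' where "G' = insert e (constp ` J)"
  define L where "L = mprod G B"
  define L' where "L' = mprod G' B"
  let ?C = "cext D J"
  have B': "f \<in> B \<Longrightarrow> g \<in> B \<Longrightarrow> f * g \<in> B" "f \<in> B \<Longrightarrow> g \<in> B \<Longrightarrow> f + g \<in> B" "1 \<in> B" "0 \<in> B" "f \<in> B \<Longrightarrow> - f \<in> B" for f g
    using sring_B by (auto simp: sring_def add_closed_def)
  have e'B: "1 - e \<in> B" using B'(2)[OF B'(3) B'(5)[OF eB]] by simp
  have cJB: "constp j \<in> B" if "j \<in> J" for j using jD(1)[OF that] constp_intpoly[OF sring_D] by blast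
  have sC: "smod B ?C" by (rule smod_exts[OF sring_B])
  have C: "g * f \<in> ?C" "f * g \<in> ?C" if "f \<in> constp ` J" "g \<in> B" for f g
    using mprodI[OF that] by (simp_all add: exts_def mult.commute)
  have "e * (1 - e) \<in> ?C"
  proof -
    have "mprod (constp ` {1, y}) (constp ` J) = constp ` D" by (simp only: rhom_mprod[OF rhom_constp, symmetric] yJ)
    then have "1 \<in> mprod (constp ` {1, y}) (constp ` J)"
      using D_closed(2) rhom_constp by (metis image_eqI rhom_def)
    then have "e * (1 - e) * 1 \<in> mprod {e * (1 - e)} (mprod (constp ` {1, y}) (constp ` J))" by (intro mprodI) auto
    also have "\<dots> = mprod (constp ` J) (mprod {e * (1 - e)} (constp ` {1, y}))" by (simp add: mprod_ac)
    also have "\<dots> \<subseteq> mprod (constp ` J) B"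
    proof (intro mprod_mono subset_refl mprod_least)
      fix a b assume "a \<in> {e * (1 - e)}" "b \<in> constp ` {1, y}"
      then consider "a * b = e * (1 - e)" | "a * b = smult y (e * (1 - e))" by (auto simp: constp_def mult.commute)
      then show "a * b \<in> B" using ye B'(1)[OF eB e'B] by cases auto
    qed (use sring_B in \<open>simp add: sring_def\<close>)
    finally show ?thesis by (simp add: exts_def)
  qed
  have LL': "mprod L L' = ?C"
  proof
    have "mprod L L' = mprod (mprod G G') (mprod B B)" by (simp add: L_def L'_def mprod_ac)
    also have "\<dots> = mprod (mprod G G') B" by (simp add: sring_idem[OF sring_B])
    also have "\<dots> \<subseteq> mprod ?C B"
    proof (intro mprod_mono subset_refl mprod_least)
      fix a b assume "a \<in> G" "b \<in> G'"
      then show "a * b \<in> ?C"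
        using C eB e'B cJB \<open>e * (1 - e) \<in> ?C\<close> by (auto simp: G_def G'_def mult.commute)
    qed (use sC in \<open>simp add: smod_def\<close>)
    finally show "mprod L L' \<subseteq> ?C" using mprod_unit[OF sring_B sC] by simp
    have sL: "smod B (mprod L L')" unfolding L_def by (intro smod_mprod smod_mprod2 smod_self[OF sring_B])
    have GL: "G \<subseteq> L" "G' \<subseteq> L'" unfolding L_def L'_def using mprodI[OF _ B'(3)] by fastforce+
    have "constp j \<in> mprod L L'" if j: "j \<in> J" for j
    proof -
      have "(1 - e) * constp j \<in> mprod L L'" "constp j * e \<in> mprod L L'"
        using GL j by (auto simp: G_def G'_def intro!: mprodI)
      then have "(1 - e) * constp j + constp j * e \<in> mprod L L'" using sL unfolding smod_def add_closed_def by blast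
      then show ?thesis by (simp add: algebra_simps)
    qed
    then show "?C \<subseteq> mprod L L'" unfolding exts_def using sL
      by (intro mprod_least) (auto simp: smod_def mult.commute)
  qed
  have CI: "?C \<in> INV B" by (rule cext_INV[OF sring_D J(1)])
  obtain C' where C': "C' \<in> INV B" "smod B C'" "mprod ?C C' = B" using CI by (rule INV_E)
  have LI: "L \<in> INV B"
  proof (rule INV_I)
    show "smod B L" "smod B (mprod L' C')" unfolding L_def L'_def
      by (intro smod_mprod smod_mprod2 smod_self[OF sring_B])+
    show "mprod L (mprod L' C') = B" using LL' C'(3) by (simp flip: mprod_assoc)
  qed
  have LB: "L \<subseteq> B" unfolding L_def G_def using cJB e'B B' sring_B
    by (intro mprod_least) (auto simp: sring_def)
  have GL: "G \<subseteq> L" unfolding L_def using mprodI[OF _ B'(3)] by fastforce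
  have jL: "constp j \<in> L" if "j \<in> J" for j using GL that by (auto simp: G_def)
  have L0: "vge (v N) 0 (poly f a)" if "N \<in> Mx" "f \<in> L" "a \<in> D" for N f a
    using intpoly_D_vge[OF that(1) _ that(3)] LB that(2) by blast
  show ?thesis
  proof (rule that[OF LI])
    show "exts id (intpoly (TT \<alpha>)) L = intpoly (TT \<alpha>)"
    proof
      let ?T = "intpoly (TT \<alpha>)"
      have sT: "sring ?T" by (rule sring_intpoly[OF sring_TT])
      have sE: "smod ?T (exts id ?T L)" by (rule smod_exts[OF sT])
      have "L \<subseteq> ?T" using LB intpoly_D_TT by blast
      then have "mprod L ?T \<subseteq> ?T" using sT by (intro mprod_least) (auto simp: sring_def)
      then show "exts id ?T L \<subseteq> ?T" by (simp add: exts_def)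
      \<comment> \<open>M is absent from \<open>NN \<alpha>\<close>, so y is integral there; then 1,
        which lies in (1, y) J, already lies in the extension of L.\<close>
      have "y \<in> TT \<alpha>" unfolding TT_iff
      proof
        fix N assume N: "N \<in> NN \<alpha>"
        then show "vge (v N) 0 y" using NN_antimono[OF less_imp_le[OF g]] MN by (intro yN) auto
      qed
      then have "constp ` {1, y} \<subseteq> ?T" using constp_intpoly[OF sring_TT[of \<alpha>]] D_TT[of \<alpha>] D_closed(2) by auto
      then have "mprod (constp ` {1, y}) (constp ` J) \<subseteq> mprod ?T L" using jL by (intro mprod_mono) auto
      moreover have "mprod (constp ` {1, y}) (constp ` J) = constp ` D"
        by (simp only: rhom_mprod[OF rhom_constp, symmetric] yJ)
      moreover have "1 \<in> constp ` D" using D_closed(2) rhom_constp by (metis image_eqI rhom_def)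
      ultimately have "1 \<in> exts id ?T L" by (simp add: exts_def mprod_comm) blast
      then show "?T \<subseteq> exts id ?T L" by (rule smod_one[OF sE])
    qed
    show "\<forall>N\<in>NN \<gamma>. N \<noteq> M \<longrightarrow> (\<forall>a\<in>D. phi N a L = 0)"
    proof (intro ballI impI)
      fix N a assume N: "N \<in> NN \<gamma>" "N \<noteq> M" and a: "a \<in> D"
      have NM: "N \<in> Mx" by (rule NN_Mx[OF N(1)])
      \<comment> \<open>Away from M in this stage y is integral, so J contains a unit at N.\<close>
      obtain j where j: "j \<in> J" "\<not> vge (v N) 1 j" using attain[OF NM yN[OF N], of 1] by auto
      have "vge (v N) 0 j" by (rule D_vge[OF NM jD(1)[OF j(1)]])
      then have "poly (constp j) a \<noteq> 0" "v N (poly (constp j) a) = 0" using j(2) by (auto simp: constp_def vge_def)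
      then show "phi N a L = 0" using phi_eqI[OF integral_at_D[OF NM] a LI jL[OF j(1)]] L0[OF NM _ a] by blast
    qed
    show "\<forall>a\<in>D. phi M a L = (if vge (v M) (int n) (a - p) then 1 else 0)"
    proof
      fix a assume a: "a \<in> D"
      show "phi M a L = (if vge (v M) (int n) (a - p) then 1 else 0)"
      proof (cases "vge (v M) (int n) (a - p)")
        case True
        have "vge (v M) (- 1) y" using y0 by (simp add: vge_def)
        \<comment> \<open>As y has value -1, the least value on J is exactly 1, and on the ball 1 -
          e does not go below it.\<close>
        then obtain j where j: "j \<in> J" "\<not> vge (v M) 2 j" using attain[OF M, of "-1" 2] by auto
        have jc: "poly (constp j) a \<noteq> 0" "v M (poly (constp j) a) = 1"
          using j(2) jM[OF j(1)] by (auto simp: constp_def vge_def)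
        have "add_closed {f. vge (v M) 1 (poly f a)}" by (auto simp: add_closed_def intro: vge_add)
        then have "L \<subseteq> {f. vge (v M) 1 (poly f a)}" unfolding L_def
        proof (rule mprod_least[rotated])
          fix f b assume fb: "f \<in> G" "b \<in> B"
          have "vge (v M) 1 (poly f a)" using fb(1) e1[OF a True] jM by (auto simp: G_def constp_def)
          then show "f * b \<in> {f. vge (v M) 1 (poly f a)}"
            using intpoly_D_vge[OF M fb(2) a] by (simp add: vge_mult0')
        qed
        then have "phi M a L = 1" using phi_eqI[OF integral_at_D[OF M] a LI jL[OF j(1)] jc] by blast
        then show ?thesis using True by simp
      next
        case False
        have "vge (v M) 1 (- poly e a)" using e2[OF a False] by simp
        then have "1 + - poly e a \<noteq> 0" "v M (1 + - poly e a) = 0" using v_add_eq[of 1 "- poly e a"] by simp_all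
        then have c: "poly (1 - e) a \<noteq> 0" "v M (poly (1 - e) a) = 0" by simp_all
        have "1 - e \<in> L" using GL by (auto simp: G_def)
        from phi_eqI[OF integral_at_D[OF M] a LI this c L0[OF M _ a]] show ?thesis using False by simp
      qed
    qed
  qed
qed

end

section \<open>The section\<close>

lemma induced_hom:
  assumes U: "group U" and P: "group P" and Q: "group Q" and q: "q \<in> hom U P" and surj: "q ` carrier U = carrier P"
    and h: "h \<in> hom U Q" and ker: "\<And>u. u \<in> carrier U \<Longrightarrow> q u = \<one>\<^bsub>P\<^esub> \<Longrightarrow> h u = \<one>\<^bsub>Q\<^esub>"
  shows "\<exists>g. g \<in> hom P Q \<and> (\<forall>u\<in>carrier U. g (q u) = h u)"
proof -
  interpret q: group_hom U P q using U P q by (simp add: group_hom_def group_hom_axioms_def)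
  interpret h: group_hom U Q h using U Q h by (simp add: group_hom_def group_hom_axioms_def)
  have wd: "h u = h w" if uw: "u \<in> carrier U" "w \<in> carrier U" "q u = q w" for u w
  proof -
    have "q (u \<otimes>\<^bsub>U\<^esub> inv\<^bsub>U\<^esub> w) = \<one>\<^bsub>P\<^esub>" using uw by simp
    then have "h (u \<otimes>\<^bsub>U\<^esub> inv\<^bsub>U\<^esub> w) = \<one>\<^bsub>Q\<^esub>" using uw by (intro ker) simp_all
    then have e: "h u \<otimes>\<^bsub>Q\<^esub> inv\<^bsub>Q\<^esub> h w = \<one>\<^bsub>Q\<^esub>" using uw by simp
    have c: "h u \<in> carrier Q" "h w \<in> carrier Q" using uw by simp_all
    have "h u = h u \<otimes>\<^bsub>Q\<^esub> (inv\<^bsub>Q\<^esub> h w \<otimes>\<^bsub>Q\<^esub> h w)" using c by simp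
    also have "\<dots> = h u \<otimes>\<^bsub>Q\<^esub> inv\<^bsub>Q\<^esub> h w \<otimes>\<^bsub>Q\<^esub> h w" using c by (simp add: h.H.m_assoc)
    finally show ?thesis using e c by simp
  qed
  define g where "g = (\<lambda>x. h (SOME u. u \<in> carrier U \<and> q u = x))"
  have g: "g (q u) = h u" if u: "u \<in> carrier U" for u
  proof -
    have "(SOME u'. u' \<in> carrier U \<and> q u' = q u) \<in> carrier U \<and> q (SOME u'. u' \<in> carrier U \<and> q u' = q u) = q u"
      by (rule someI[of _ u]) (use u in simp)
    then show ?thesis unfolding g_def using wd[OF _ u] by blast
  qed
  have "g \<in> hom P Q"
  proof (rule homI)
    fix x assume "x \<in> carrier P"
    then obtain u where "u \<in> carrier U" "x = q u" using surj by auto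
    then show "g x \<in> carrier Q" using g by simp
  next
    fix x y assume "x \<in> carrier P" "y \<in> carrier P"
    then have "x \<in> q ` carrier U" "y \<in> q ` carrier U" using surj by simp_all
    then obtain u w where uw: "u \<in> carrier U" "x = q u" "w \<in> carrier U" "y = q w" by blast
    then have e: "x \<otimes>\<^bsub>P\<^esub> y = q (u \<otimes>\<^bsub>U\<^esub> w)" by simp
    have "g (x \<otimes>\<^bsub>P\<^esub> y) = h (u \<otimes>\<^bsub>U\<^esub> w)" unfolding e by (rule g) (simp add: uw)
    then show "g (x \<otimes>\<^bsub>P\<^esub> y) = g x \<otimes>\<^bsub>Q\<^esub> g y" using uw(1,3) g by (simp add: uw(2,4))
  qed
  then show ?thesis using g by blast
qed

lemma (in comm_group) gfinprod_support:
  assumes "finite S" "S \<subseteq> K" "f \<in> K \<rightarrow> carrier G" "\<And>i. i \<in> K \<Longrightarrow> i \<notin> S \<Longrightarrow> f i = \<one>"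
  shows "gfinprod G f K = finprod G f S"
proof -
  have sub: "{x \<in> K. f x \<noteq> \<one>} \<subseteq> S" using assms(4) by blast
  then have "finite {x \<in> K. f x \<noteq> \<one>}" using assms(1) finite_subset by blast
  moreover have "finprod G f {x \<in> K. f x \<noteq> \<one>} = finprod G f S"
    using assms sub by (intro finprod_mono_neutral_cong_left) auto
  ultimately show ?thesis by (simp add: gfinprod_def)
qed

lemma hom_finprod_one:
  assumes G: "comm_group G" and H: "group H" and h: "h \<in> hom G H"
    and S: "finite S" and f: "\<And>i. i \<in> S \<Longrightarrow> f i \<in> carrier G" "\<And>i. i \<in> S \<Longrightarrow> h (f i) = \<one>\<^bsub>H\<^esub>"
  shows "h (finprod G f S) = \<one>\<^bsub>H\<^esub>"
proof -
  interpret G: comm_group G by fact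
  interpret h: group_hom G H h using H h by (simp add: group_hom_def group_hom_axioms_def G.is_group)
  show ?thesis using S f
  proof (induction S rule: finite_induct)
    case (insert x S)
    then have "f \<in> S \<rightarrow> carrier G" "f x \<in> carrier G" by auto
    then show ?case using insert by simp
  qed simp
qed

lemma hom_int_finprod:
  assumes G: "comm_group G" and h: "h \<in> hom G integer_group"
    and S: "finite S" and f: "\<And>i. i \<in> S \<Longrightarrow> f i \<in> carrier G"
  shows "h (finprod G f S) = (\<Sum>i\<in>S. h (f i))"
proof -
  interpret G: comm_group G by fact
  interpret h: group_hom G integer_group h using h by (simp add: group_hom_def group_hom_axioms_def G.is_group)
  show ?thesis using S f
  proof (induction S rule: finite_induct)
    case empty
    then show ?case using h.hom_one by simp
  next
    case (insert x S)
    then have "f \<in> S \<rightarrow> carrier G" "f x \<in> carrier G" by auto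
    then show ?case using insert h.hom_mult by simp
  qed
qed

section \<open>Normalized values on the Picard groups\<close>

context almost_dedekind_domain
begin

lemma group_invg_B: "group (invg (intpoly D))"
  by (rule comm_group.axioms(2)[OF comm_group_invg[OF sring_intpoly[OF sring_D]]])

lemma comm_group_PicInt_D: "comm_group (PicInt D)"
  by (rule comm_group_PicInt[OF sring_D])

lemma comm_group_Pic_loc: "M \<in> Mx \<Longrightarrow> comm_group (Pic (IntK (loc M)))"
  by (rule comm_group_Pic[OF sring_IntK[OF sring_loc]])

text \<open>Subtracting the value at 0 cancels constants, and by \<open>pint_one_phi\<close>
  constancy is precisely triviality of the class; so normalized values descend.\<close>

lemma dP_exists: assumes N: "N \<in> Mx" "a \<in> D"
  shows "\<exists>d. d \<in> hom (PicInt D) integer_group \<and> (\<forall>F\<in>carrier (invg (intpoly D)). d (pint D F) = phi N a F - phi N 0 F)"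
proof (rule induced_hom[OF group_invg_B comm_group.axioms(2)[OF comm_group_PicInt_D] group_integer_group pint_hom[OF sring_D]])
  show "pint D ` carrier (invg (intpoly D)) = carrier (PicInt D)" by (simp add: pint_surj[OF sring_D])
  show "(\<lambda>F. phi N a F - phi N 0 F) \<in> hom (invg (intpoly D)) integer_group"
    using phi_mult[OF integral_at_D[OF N(1)] N(2)] phi_mult[OF integral_at_D[OF N(1)] D_closed(1)] by (intro homI) auto
  show "phi N a u - phi N 0 u = \<one>\<^bsub>integer_group\<^esub>"
    if "u \<in> carrier (invg (intpoly D))" "pint D u = \<one>\<^bsub>PicInt D\<^esub>" for u
    using that pint_one_phi[of u] N by simp
qed

definition dP :: "'a set \<Rightarrow> 'a \<Rightarrow> 'a poly fract set set set \<Rightarrow> int" where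
  "dP N a = (SOME d. d \<in> hom (PicInt D) integer_group \<and>
     (\<forall>F\<in>carrier (invg (intpoly D)). d (pint D F) = phi N a F - phi N 0 F))"

lemma dP: assumes "N \<in> Mx" "a \<in> D"
  shows "dP N a \<in> hom (PicInt D) integer_group"
    and "F \<in> INV (intpoly D) \<Longrightarrow> dP N a (pint D F) = phi N a F - phi N 0 F"
  using someI_ex[OF dP_exists[OF assms]] unfolding dP_def by auto

lemma dM_exists: assumes M: "M \<in> Mx" "a \<in> D"
  shows "\<exists>d. d \<in> hom (Pic (IntK (loc M))) integer_group \<and>
    (\<forall>F\<in>carrier (invg (intpoly (loc M))). d (pcls (loc M) F) = phi M a F - phi M 0 F)"
proof (rule induced_hom)
  have s: "sring (intpoly (loc M))" by (rule sring_intpoly[OF sring_loc[OF M(1)]])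
  show "group (invg (intpoly (loc M)))" by (rule comm_group.axioms(2)[OF comm_group_invg[OF s]])
  show "group (Pic (IntK (loc M)))" by (rule comm_group.axioms(2)[OF comm_group_Pic_loc[OF M(1)]])
  show "group integer_group" by simp
  show "pcls (loc M) \<in> hom (invg (intpoly (loc M))) (Pic (IntK (loc M)))" by (rule pcls_hom[OF sring_loc[OF M(1)]])
  show "pcls (loc M) ` carrier (invg (intpoly (loc M))) = carrier (Pic (IntK (loc M)))"
    using pcls_surj[OF sring_loc[OF M(1)]] by simp
  show "(\<lambda>F. phi M a F - phi M 0 F) \<in> hom (invg (intpoly (loc M))) integer_group"
    using phi_mult[OF integral_at_loc[OF M(1)] M(2)] phi_mult[OF integral_at_loc[OF M(1)] D_closed(1)] by (intro homI) auto
  fix u assume u: "u \<in> carrier (invg (intpoly (loc M)))" "pcls (loc M) u = \<one>\<^bsub>Pic (IntK (loc M))\<^esub>"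
  have "pcls (loc M) u = pcls (loc M) (intpoly (loc M))" using u(2) by (simp add: pcls_def IntK_emb)
  then have "phi M a u - phi M 0 u = phi M a (intpoly (loc M)) - phi M 0 (intpoly (loc M))"
    using u(1) by (intro pcls_phi[OF M(1) _ INV_self[OF s] _ M(2)]) auto
  then show "phi M a u - phi M 0 u = \<one>\<^bsub>integer_group\<^esub>"
    using phi_one[OF integral_at_loc[OF M(1)]] M(2) D_closed(1) by simp
qed

definition dM :: "'a set \<Rightarrow> 'a \<Rightarrow> 'a poly fract set set \<Rightarrow> int" where
  "dM M a = (SOME d. d \<in> hom (Pic (IntK (loc M))) integer_group \<and>
    (\<forall>F\<in>carrier (invg (intpoly (loc M))). d (pcls (loc M) F) = phi M a F - phi M 0 F))"

lemma dM: assumes "M \<in> Mx" "a \<in> D"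
  shows "dM M a \<in> hom (Pic (IntK (loc M))) integer_group"
    and "F \<in> INV (intpoly (loc M)) \<Longrightarrow> dM M a (pcls (loc M) F) = phi M a F - phi M 0 F"
  using someI_ex[OF dM_exists[OF assms]] unfolding dM_def by auto

lemma carrier_PicE: assumes "M \<in> Mx" "X \<in> carrier (Pic (IntK (loc M)))"
  obtains F where "F \<in> INV (intpoly (loc M))" "X = pcls (loc M) F"
  using pcls_surj[OF sring_loc[OF assms(1)]] assms(2) by blast

lemma dM_zero: assumes "M \<in> Mx" "X \<in> carrier (Pic (IntK (loc M)))" shows "dM M 0 X = 0"
  using carrier_PicE[OF assms] dM(2)[OF assms(1) D_closed(1)] by (metis diff_self)

text \<open>Hence the homomorphisms \<open>dM M a\<close> together separate the elements of
  Pic(Int(D_M)).\<close>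

lemma dM_trivial:
  assumes M: "M \<in> Mx" and X: "X \<in> carrier (Pic (IntK (loc M)))" and z: "\<And>a. a \<in> D \<Longrightarrow> dM M a X = 0"
  shows "X = \<one>\<^bsub>Pic (IntK (loc M))\<^esub>"
proof -
  obtain F where F: "F \<in> INV (intpoly (loc M))" "X = pcls (loc M) F" by (rule carrier_PicE[OF M X])
  have "phi M a F = phi M 0 F" if "a \<in> D" for a using z[OF that] dM(2)[OF M that F(1)] F(2) by simp
  then show ?thesis using pcls_one_phi[OF M F(1)] F(2) by simp
qed

lemma dM_locally_const:
  assumes M: "M \<in> Mx" and X: "X \<in> carrier (Pic (IntK (loc M)))"
  obtains n :: nat where "\<forall>a\<in>D. \<forall>b\<in>D. vge (v M) (int n) (a - b) \<longrightarrow> dM M a X = dM M b X"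
proof -
  obtain F where F: "F \<in> INV (intpoly (loc M))" "X = pcls (loc M) F" by (rule carrier_PicE[OF M X])
  obtain n :: nat where n: "\<forall>a\<in>D. \<forall>b\<in>D. vge (v M) (int n) (a - b) \<longrightarrow> phi M a F = phi M b F"
    using phi_locally_const[OF integral_at_loc[OF M] F(1)] by blast
  have "dM M a X = dM M b X" if "a \<in> D" "b \<in> D" "vge (v M) (int n) (a - b)" for a b
    using n that dM(2)[OF M that(1) F(1)] dM(2)[OF M that(2) F(1)] F(2) by simp
  then show ?thesis using that by blast
qed

lemma dM_inf:
  assumes M: "M \<in> Mx" and X: "X \<in> carrier (Pic (IntK (loc M)))" and inf: "\<not> finite_residue M" and a: "a \<in> D"
  shows "dM M a X = 0"
proof -
  obtain F where F: "F \<in> INV (intpoly (loc M))" "X = pcls (loc M) F" by (rule carrier_PicE[OF M X])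
  show ?thesis using phi_const_inf[OF integral_at_loc[OF M] F(1) inf a D_closed(1)] dM(2)[OF M a F(1)] F(2) by simp
qed

text \<open>The coefficients are additive in \<open>g\<close>, so lifting each ball separately gives a homomorphic
  section, although no basis is chosen.\<close>
lemma ball_expansion:
  fixes g :: "'a \<Rightarrow> int"
  assumes M: "M \<in> Mx" and fin: "finite_residue M" and g: "\<And>a b. a \<in> D \<Longrightarrow> b \<in> D \<Longrightarrow> vge (v M) (int N) (a - b) \<Longrightarrow> g a = g b"
    and a: "a \<in> D"
  shows "(\<Sum>(n, p)\<in>(SIGMA n:{..<N}. rho M (Suc n) ` D).
      (g p - g (rho M n p)) * (if vge (v M) (int (Suc n)) (a - p) then 1 else 0)) = g a - g (rho M 0 a)"
proof -
  \<comment> \<open>At each level only the ball containing a contributes, namely the change of g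
    from one level to the next; the sum over levels telescopes.\<close>
  have inner: "(\<Sum>p\<in>rho M (Suc n) ` D. (g p - g (rho M n p)) * (if vge (v M) (int (Suc n)) (a - p) then 1 else 0))
     = g (rho M (Suc n) a) - g (rho M n a)" for n
  proof -
    have eq: "vge (v M) (int (Suc n)) (a - p) \<longleftrightarrow> p = rho M (Suc n) a" if "p \<in> rho M (Suc n) ` D" for p
      using rho_eq_iff[OF M a, of p "Suc n"] rho_image[OF M that] by metis
    have "(\<Sum>p\<in>rho M (Suc n) ` D. (g p - g (rho M n p)) * (if vge (v M) (int (Suc n)) (a - p) then 1 else 0))
      = (\<Sum>p\<in>rho M (Suc n) ` D. if p = rho M (Suc n) a then g p - g (rho M n p) else 0)"
    proof (rule sum.cong[OF refl])
      fix p assume p: "p \<in> rho M (Suc n) ` D"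
      show "(g p - g (rho M n p)) * (if vge (v M) (int (Suc n)) (a - p) then 1 else 0)
        = (if p = rho M (Suc n) a then g p - g (rho M n p) else 0)"
        unfolding eq[OF p] by simp
    qed
    also have "\<dots> = g (rho M (Suc n) a) - g (rho M n (rho M (Suc n) a))"
      using a finite_rho[OF M fin] by (simp add: sum.delta)
    also have "rho M n (rho M (Suc n) a) = rho M n a" by (rule rho_rho[OF M a]) simp
    finally show ?thesis .
  qed
  have "(\<Sum>(n, p)\<in>(SIGMA n:{..<N}. rho M (Suc n) ` D).
      (g p - g (rho M n p)) * (if vge (v M) (int (Suc n)) (a - p) then 1 else 0))
    = (\<Sum>n<N. \<Sum>p\<in>rho M (Suc n) ` D. (g p - g (rho M n p)) * (if vge (v M) (int (Suc n)) (a - p) then 1 else 0))"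
    using finite_rho[OF M fin] by (subst sum.Sigma) auto
  also have "\<dots> = (\<Sum>n<N. g (rho M (Suc n) a) - g (rho M n a))" by (simp only: inner)
  also have "\<dots> = g (rho M N a) - g (rho M 0 a)" by (rule sum_lessThan_telescope)
  also have "g (rho M N a) = g a"
    using g[OF a rho_D(1)[OF M a, of N] rho_D(2)[OF M a, of N]] by simp
  finally show ?thesis .
qed

end

section \<open>Homomorphic lifts from Pic(Int(D_M))\<close>

context int_compatible
begin

abbreviation TI where "TI \<equiv> intpoly (TT \<alpha>)"

lemma sring_TI: "sring TI" by (rule sring_intpoly[OF sring_TT])

lemma comm_group_PicInt_TT: "comm_group (PicInt (TT \<alpha>))"
  by (rule comm_group_PicInt[OF sring_TT])

lemma extT_hom: "exts id TI \<in> hom (invg B) (invg TI)"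
  using intpoly_D_TT by (intro exts_hom sring_B sring_TI) auto

lemma extT_INV: "F \<in> INV B \<Longrightarrow> exts id TI F \<in> INV TI"
  using hom_in_carrier[OF extT_hom] by simp

text \<open>An ideal extended from D becomes one extended from T_\<alpha>, so extension to
  Int(T_\<alpha>) passes to classes.\<close>

lemma gT_exists: "\<exists>g. g \<in> hom (PicInt D) (PicInt (TT \<alpha>)) \<and>
    (\<forall>F\<in>carrier (invg B). g (pint D F) = (pint (TT \<alpha>) \<circ> exts id TI) F)"
proof (rule induced_hom[OF group_invg_B comm_group.axioms(2)[OF comm_group_PicInt_D] comm_group.axioms(2)[OF comm_group_PicInt_TT] pint_hom[OF sring_D]])
  show "pint D ` carrier (invg B) = carrier (PicInt D)" by (simp add: pint_surj[OF sring_D])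
  show "pint (TT \<alpha>) \<circ> exts id TI \<in> hom (invg B) (PicInt (TT \<alpha>))"
    by (rule hom_compose[OF extT_hom pint_hom[OF sring_TT]])
  fix F assume F: "F \<in> carrier (invg B)" "pint D F = \<one>\<^bsub>PicInt D\<^esub>"
  then obtain J where J: "J \<in> INV D" "F = cext D J" using pint_one_iff[OF sring_D] by auto
  have "exts id TI F = exts constp TI J"
    unfolding J(2) using exts_exts[OF rhom_constp sring_B sring_TI rhom_id(1)] intpoly_D_TT by simp
  also have "\<dots> = cext (TT \<alpha>) (exts id (TT \<alpha>) J)"
    using exts_exts[OF rhom_id(1) sring_TT[of \<alpha>] sring_TI rhom_constp constp_intpoly[OF sring_TT[of \<alpha>]]] by simp
  finally have e: "exts id TI F = cext (TT \<alpha>) (exts id (TT \<alpha>) J)" .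
  have "exts id (TT \<alpha>) \<in> hom (invg D) (invg (TT \<alpha>))"
    using D_TT by (intro exts_hom sring_D sring_TT) auto
  then have "exts id (TT \<alpha>) J \<in> INV (TT \<alpha>)" using hom_in_carrier J(1) by fastforce
  then show "(pint (TT \<alpha>) \<circ> exts id TI) F = \<one>\<^bsub>PicInt (TT \<alpha>)\<^esub>"
    using pint_one_iff[OF sring_TT extT_INV[of F]] F(1) e by (simp only: invg_simps comp_def) blast
qed

definition gT where
  "gT = (SOME g. g \<in> hom (PicInt D) (PicInt (TT \<alpha>)) \<and>
    (\<forall>F\<in>carrier (invg B). g (pint D F) = (pint (TT \<alpha>) \<circ> exts id TI) F))"

lemma gT: "gT \<in> hom (PicInt D) (PicInt (TT \<alpha>))" "F \<in> INV B \<Longrightarrow> gT (pint D F) = pint (TT \<alpha>) (exts id TI F)"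
  using someI_ex[OF gT_exists] unfolding gT_def by auto

lemma pint_carrier: "F \<in> INV B \<Longrightarrow> pint D F \<in> carrier (PicInt D)"
  using pint_surj[OF sring_D] by blast

lemma pint_TI_one: "pint (TT \<alpha>) TI = \<one>\<^bsub>PicInt (TT \<alpha>)\<^esub>"
proof -
  have "pint (TT \<alpha>) \<one>\<^bsub>invg TI\<^esub> = \<one>\<^bsub>PicInt (TT \<alpha>)\<^esub>"
    by (rule hom_one[OF pint_hom[OF sring_TT] comm_group.axioms(2)[OF comm_group_invg[OF sring_TI]] comm_group.axioms(2)[OF comm_group_PicInt_TT]])
  then show ?thesis by simp
qed

text \<open>Classes of ball ideals play the part of indicators of balls: with the increments of
  \<open>dM\<close> as exponents, their product reproduces the value function of X at M by
  \<open>ball_expansion\<close>. It is trivial over T_\<alpha> and has zero normalized values on the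
  rest of the stage because each ball ideal does.\<close>

lemma section_exists:
  assumes M: "M \<in> Mx" "M \<notin> NN \<alpha>"
  shows "\<exists>\<gamma> s. \<gamma> < \<alpha> \<and> M \<in> NN \<gamma> \<and> s \<in> hom (Pic (IntK (loc M))) (PicInt D) \<and>
    (\<forall>X\<in>carrier (Pic (IntK (loc M))). gT (s X) = \<one>\<^bsub>PicInt (TT \<alpha>)\<^esub> \<and>
      (\<forall>a\<in>D. dP M a (s X) = dM M a X) \<and> (\<forall>N\<in>NN \<gamma>. N \<noteq> M \<longrightarrow> (\<forall>a\<in>D. dP N a (s X) = 0)))"
proof -
  obtain \<gamma> z where g: "\<gamma> < \<alpha>" "isol \<gamma> M z" using stage_exists[OF M] by blast
  then have MN: "M \<in> NN \<gamma>" by (simp add: isol_def)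
  let ?P = "PicInt D" and ?G = "Pic (IntK (loc M))" and ?Q = "PicInt (TT \<alpha>)"
  interpret P: comm_group ?P by (rule comm_group_PicInt_D)
  interpret Q: comm_group ?Q by (rule comm_group_PicInt_TT)
  interpret G: comm_group ?G by (rule comm_group_Pic_loc[OF M(1)])
  have dP1: "dP N a \<one>\<^bsub>?P\<^esub> = 0" if "N \<in> Mx" "a \<in> D" for N a
    using hom_one[OF dP(1)[OF that] P.is_group group_integer_group] by simp
  show ?thesis
  proof (cases "finite_residue M")
    case False
    \<comment> \<open>By \<open>dM_inf\<close> all normalized values of X vanish, so the constant
      map already has the required ones.\<close>
    let ?s = "\<lambda>X. \<one>\<^bsub>?P\<^esub>"
    have "?s \<in> hom ?G ?P" by (rule homI) auto
    moreover have "gT \<one>\<^bsub>?P\<^esub> = \<one>\<^bsub>?Q\<^esub>" by (rule hom_one[OF gT(1) P.is_group Q.is_group])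
    ultimately show ?thesis using g(1) MN dP1 M(1) NN_Mx dM_inf[OF M(1) _ False]
      by (intro exI[of _ \<gamma>] exI[of _ ?s]) auto
  next
    case fin: True
    \<comment> \<open>The index (n, p) stands for the ball p + M^(n+1); the ball modulo M^0 is all
      of D, which normalized values do not see.\<close>
    have "\<forall>i\<in>UNIV \<times> D. \<exists>L. L \<in> INV B \<and> exts id TI L = TI \<and>
      (\<forall>N\<in>NN \<gamma>. N \<noteq> M \<longrightarrow> (\<forall>a\<in>D. phi N a L = 0)) \<and>
      (\<forall>a\<in>D. phi M a L = (if vge (v M) (int (Suc (fst i))) (a - snd i) then 1 else 0))"
    proof
      fix i :: "nat \<times> 'a" assume "i \<in> UNIV \<times> D"
      then have p: "snd i \<in> D" by auto
      obtain L where "L \<in> INV B" "exts id TI L = TI" "\<forall>N\<in>NN \<gamma>. N \<noteq> M \<longrightarrow> (\<forall>a\<in>D. phi N a L = 0)"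
        "\<forall>a\<in>D. phi M a L = (if vge (v M) (int (Suc (fst i))) (a - snd i) then 1 else 0)"
        by (rule ball_ideal_exists[OF g(2,1) M(2) fin p])
      then show "\<exists>L. L \<in> INV B \<and> exts id TI L = TI \<and>
        (\<forall>N\<in>NN \<gamma>. N \<noteq> M \<longrightarrow> (\<forall>a\<in>D. phi N a L = 0)) \<and>
        (\<forall>a\<in>D. phi M a L = (if vge (v M) (int (Suc (fst i))) (a - snd i) then 1 else 0))" by blast
    qed
    from bchoice[OF this] obtain L where L: "\<forall>i\<in>UNIV \<times> D. L i \<in> INV B \<and> exts id TI (L i) = TI \<and>
      (\<forall>N\<in>NN \<gamma>. N \<noteq> M \<longrightarrow> (\<forall>a\<in>D. phi N a (L i) = 0)) \<and>
      (\<forall>a\<in>D. phi M a (L i) = (if vge (v M) (int (Suc (fst i))) (a - snd i) then 1 else 0))" by (rule exE)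
    define K where "K = (SIGMA n:(UNIV :: nat set). rho M (Suc n) ` D)"
    define S where "S = (\<lambda>N. SIGMA n:{..<N}. rho M (Suc n) ` D)"
    have finS: "finite (S N)" for N unfolding S_def using finite_rho[OF M(1) fin] by auto
    have KD: "i \<in> UNIV \<times> D" if "i \<in> K" for i using that rho_D[OF M(1)] by (auto simp: K_def)
    have SK: "S N \<subseteq> K" for N by (auto simp: S_def K_def)
    define c where "c = (\<lambda>X i. dM M (snd i) X - dM M (rho M (fst i) (snd i)) X)"
    define l where "l = (\<lambda>i. pint D (L i))"
    have lP: "l i \<in> carrier ?P" if "i \<in> K" for i unfolding l_def using L KD[OF that] by (intro pint_carrier) blast
    \<comment> \<open>The index set is the same for all X, so that exponents add under
      multiplication; local constancy makes the product finite for each X.\<close>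
    define s where "s = (\<lambda>X. gfinprod ?P (\<lambda>i. l i [^]\<^bsub>?P\<^esub> c X i) K)"
    have powK: "(\<lambda>i. l i [^]\<^bsub>?P\<^esub> c X i) \<in> K \<rightarrow> carrier ?P" for X using lP by auto
    have supp: "\<exists>N. (\<forall>a b. a \<in> D \<longrightarrow> b \<in> D \<longrightarrow> vge (v M) (int N) (a - b) \<longrightarrow> dM M a X = dM M b X) \<and>
      (\<forall>i\<in>K. i \<notin> S N \<longrightarrow> l i [^]\<^bsub>?P\<^esub> c X i = \<one>\<^bsub>?P\<^esub>)" if X: "X \<in> carrier ?G" for X
    proof -
      obtain N :: nat where N: "\<forall>a\<in>D. \<forall>b\<in>D. vge (v M) (int N) (a - b) \<longrightarrow> dM M a X = dM M b X"
        by (rule dM_locally_const[OF M(1) X])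
      have "l i [^]\<^bsub>?P\<^esub> c X i = \<one>\<^bsub>?P\<^esub>" if i: "i \<in> K" "i \<notin> S N" for i
      proof -
        obtain n p where np: "i = (n, p)" "p \<in> rho M (Suc n) ` D" using i(1) by (auto simp: K_def)
        then have n: "N \<le> n" using i(2) by (auto simp: S_def not_less)
        have p: "p \<in> D" using KD[OF i(1)] np by simp
        have "vge (v M) (int N) (p - rho M n p)"
          using rho_D(2)[OF M(1) p, of n] n valn.vge_mono[OF v_props(1)[OF M(1)]] by simp
        \<comment> \<open>From level N on, a point and its representative have the same normalized
          value.\<close>
        then have "c X i = 0" using N p rho_D(1)[OF M(1) p, of n] by (simp add: c_def np(1))
        then show ?thesis by simp
      qed
      then show ?thesis using N by (intro exI[of _ N]) blast
    qed
    have s_eq: "s X = finprod ?P (\<lambda>i. l i [^]\<^bsub>?P\<^esub> c X i) (S N)"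
      if "\<forall>i\<in>K. i \<notin> S N \<longrightarrow> l i [^]\<^bsub>?P\<^esub> c X i = \<one>\<^bsub>?P\<^esub>" for X N
      unfolding s_def using that by (intro P.gfinprod_support finS SK powK) auto
    have cP: "l i [^]\<^bsub>?P\<^esub> c X i \<in> carrier ?P" if "i \<in> S N" for X i N using lP that SK by blast
    have fsupp: "finite {i \<in> K. l i [^]\<^bsub>?P\<^esub> c X i \<noteq> \<one>\<^bsub>?P\<^esub>}" if X: "X \<in> carrier ?G" for X
    proof -
      obtain N where "\<forall>i\<in>K. i \<notin> S N \<longrightarrow> l i [^]\<^bsub>?P\<^esub> c X i = \<one>\<^bsub>?P\<^esub>" using supp[OF X] by blast
      then have "{i \<in> K. l i [^]\<^bsub>?P\<^esub> c X i \<noteq> \<one>\<^bsub>?P\<^esub>} \<subseteq> S N" by blast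
      then show ?thesis using finS by (rule finite_subset)
    qed
    have hom: "s \<in> hom ?G ?P"
    proof (rule homI)
      fix X assume "X \<in> carrier ?G"
      show "s X \<in> carrier ?P" unfolding s_def by (rule P.gfinprod_closed[OF powK])
    next
      fix X Y assume XY: "X \<in> carrier ?G" "Y \<in> carrier ?G"
      have cXY: "c (X \<otimes>\<^bsub>?G\<^esub> Y) i = c X i + c Y i" if "i \<in> K" for i
      proof -
        have "snd i \<in> D" using KD[OF that] by auto
        moreover have "rho M (fst i) (snd i) \<in> D" using rho_D[OF M(1)] calculation by blast
        ultimately show ?thesis using hom_mult[OF dM(1)[OF M(1)] XY] by (simp add: c_def)
      qed
      have "s (X \<otimes>\<^bsub>?G\<^esub> Y) = gfinprod ?P (\<lambda>i. l i [^]\<^bsub>?P\<^esub> c X i \<otimes>\<^bsub>?P\<^esub> l i [^]\<^bsub>?P\<^esub> c Y i) K"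
        unfolding s_def
      proof (rule P.gfinprod_cong[OF refl])
        show "(\<lambda>i. l i [^]\<^bsub>?P\<^esub> c (X \<otimes>\<^bsub>?G\<^esub> Y) i) \<in> K \<rightarrow> carrier ?P" by (rule powK)
        show "i \<in> K =simp=> l i [^]\<^bsub>?P\<^esub> c (X \<otimes>\<^bsub>?G\<^esub> Y) i = l i [^]\<^bsub>?P\<^esub> c X i \<otimes>\<^bsub>?P\<^esub> l i [^]\<^bsub>?P\<^esub> c Y i" for i
          unfolding simp_implies_def using cXY lP P.int_pow_mult by simp
      qed
      also have "\<dots> = s X \<otimes>\<^bsub>?P\<^esub> s Y"
        unfolding s_def using fsupp XY powK by (intro P.gfinprod_distrib)
      finally show "s (X \<otimes>\<^bsub>?G\<^esub> Y) = s X \<otimes>\<^bsub>?P\<^esub> s Y" .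
    qed
    have main: "gT (s X) = \<one>\<^bsub>?Q\<^esub> \<and> (\<forall>a\<in>D. dP M a (s X) = dM M a X) \<and>
      (\<forall>N\<in>NN \<gamma>. N \<noteq> M \<longrightarrow> (\<forall>a\<in>D. dP N a (s X) = 0))" if X: "X \<in> carrier ?G" for X
    proof -
      obtain N where N: "\<forall>a b. a \<in> D \<longrightarrow> b \<in> D \<longrightarrow> vge (v M) (int N) (a - b) \<longrightarrow> dM M a X = dM M b X"
        "\<forall>i\<in>K. i \<notin> S N \<longrightarrow> l i [^]\<^bsub>?P\<^esub> c X i = \<one>\<^bsub>?P\<^esub>" using supp[OF X] by blast
      note sX = s_eq[OF N(2)]
      have LD: "L i \<in> INV B" "i \<in> UNIV \<times> D" if i: "i \<in> S N" for i
      proof -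
        show "i \<in> UNIV \<times> D" by (rule KD[OF subsetD[OF SK i]])
        from bspec[OF L this] show "L i \<in> INV B" by blast
      qed
      have 1: "gT (s X) = \<one>\<^bsub>?Q\<^esub>" unfolding sX
      proof (rule hom_finprod_one[OF comm_group_PicInt_D Q.is_group gT(1) finS cP])
        fix i assume i: "i \<in> S N"
        have "gT (l i) = pint (TT \<alpha>) (exts id TI (L i))" unfolding l_def by (rule gT(2)[OF LD(1)[OF i]])
        also have "exts id TI (L i) = TI" using bspec[OF L LD(2)[OF i]] by blast
        also have "pint (TT \<alpha>) TI = \<one>\<^bsub>?Q\<^esub>" by (rule pint_TI_one)
        finally have "gT (l i) = \<one>\<^bsub>?Q\<^esub>" .
        then show "gT (l i [^]\<^bsub>?P\<^esub> c X i) = \<one>\<^bsub>?Q\<^esub>"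
          using hom_int_pow[OF gT(1) _ P.is_group Q.is_group, of "l i" "c X i"] lP SK i by (metis Q.int_pow_one subsetD)
      qed
      have val: "dP A a (s X) = (\<Sum>i\<in>S N. c X i * (phi A a (L i) - phi A 0 (L i)))" if A: "A \<in> Mx" "a \<in> D" for A a
      proof -
        have "dP A a (s X) = (\<Sum>i\<in>S N. dP A a (l i [^]\<^bsub>?P\<^esub> c X i))"
          unfolding sX by (rule hom_int_finprod[OF comm_group_PicInt_D dP(1)[OF A] finS cP])
        also have "\<dots> = (\<Sum>i\<in>S N. c X i * (phi A a (L i) - phi A 0 (L i)))"
        proof (rule sum.cong[OF refl])
          fix i assume i: "i \<in> S N"
          have "dP A a (l i [^]\<^bsub>?P\<^esub> c X i) = dP A a (l i) [^]\<^bsub>integer_group\<^esub> c X i"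
            using lP SK i by (intro hom_int_pow[OF dP(1)[OF A] _ P.is_group group_integer_group]) blast
          also have "\<dots> = c X i * dP A a (l i)" by simp
          finally show "dP A a (l i [^]\<^bsub>?P\<^esub> c X i) = c X i * (phi A a (L i) - phi A 0 (L i))"
            using dP(2)[OF A LD(1)[OF i]] by (simp add: l_def)
        qed
        finally show ?thesis .
      qed
      have 3: "dP A a (s X) = 0" if A: "A \<in> NN \<gamma>" "A \<noteq> M" "a \<in> D" for A a
        unfolding val[OF NN_Mx[OF A(1)] A(3)]
      proof (rule sum.neutral, rule ballI)
        fix i assume i: "i \<in> S N"
        show "c X i * (phi A a (L i) - phi A 0 (L i)) = 0"
          using bspec[OF L LD(2)[OF i]] A D_closed(1) by simp
      qed
      have 2: "dP M a (s X) = dM M a X" if a: "a \<in> D" for a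
      proof -
        let ?g = "\<lambda>p. dM M p X"
        let ?E = "\<lambda>a. \<Sum>(n, p)\<in>(SIGMA n:{..<N}. rho M (Suc n) ` D).
          (?g p - ?g (rho M n p)) * (if vge (v M) (int (Suc n)) (a - p) then 1 else 0)"
        have ex: "?E b = ?g b - ?g (rho M 0 b)" if "b \<in> D" for b
          by (rule ball_expansion[OF M(1) fin _ that]) (use N(1) in blast)
        have "dP M a (s X) = ?E a - ?E 0"
          unfolding val[OF M(1) a] sum_subtractf[symmetric] S_def
        proof (rule sum.cong[OF refl])
          fix i assume "i \<in> (SIGMA n:{..<N}. rho M (Suc n) ` D)"
          then have i: "i \<in> S N" by (simp add: S_def)
          show "c X i * (phi M a (L i) - phi M 0 (L i)) =
            (case i of (n, p) \<Rightarrow> (?g p - ?g (rho M n p)) * (if vge (v M) (int (Suc n)) (a - p) then 1 else 0)) -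
            (case i of (n, p) \<Rightarrow> (?g p - ?g (rho M n p)) * (if vge (v M) (int (Suc n)) (0 - p) then 1 else 0))"
            using bspec[OF L LD(2)[OF i]] a D_closed(1) by (simp add: c_def case_prod_unfold)
        qed
        also have "\<dots> = (?g a - ?g (rho M 0 a)) - (?g 0 - ?g (rho M 0 0))"
          by (simp only: ex[OF a] ex[OF D_closed(1)])
        \<comment> \<open>All points agree modulo M^0, so the two level-zero terms cancel.\<close>
        also have "rho M 0 a = rho M 0 0"
          by (rule rho_cong[OF M(1)]) (use D_vge[OF M(1) a] in simp)
        finally show ?thesis using dM_zero[OF M(1) X] by simp
      qed
      show ?thesis using 1 2 3 by blast
    qed
    then show ?thesis using g(1) MN hom by blast
  qed
qed

end

section \<open>Lifting ideals from an overring\<close>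

context almost_dedekind_domain
begin

text \<open>D is the sum of two ideals: the u with u / d integral wherever W is, and the t that
  multiply W into D. Where W is integral at M, a common denominator of W is a unit in the second;
  elsewhere a power of a nonintegral w gives a unit in the first. Write 1 = u + t and take \<zeta> =
  u / d: where W is not integral, t lies in M and u is a unit.\<close>

lemma cut_element:
  assumes W: "finite W" and d: "d \<in> D" "d \<noteq> 0"
  obtains \<zeta> where "\<forall>M\<in>Mx. W \<subseteq> loc M \<longrightarrow> vge (v M) 0 \<zeta>"
    "\<forall>M\<in>Mx. \<not> W \<subseteq> loc M \<longrightarrow> d * \<zeta> \<noteq> 0 \<and> v M (d * \<zeta>) = 0"
proof -
  define T where "T = {y. \<forall>M\<in>Mx. W \<subseteq> loc M \<longrightarrow> vge (v M) 0 y}"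
  have T: "x + y \<in> T" "x * y \<in> T" if "x \<in> T" "y \<in> T" for x y
  proof -
    show "x + y \<in> T" unfolding T_def
    proof (intro CollectI ballI impI)
      fix M assume M: "M \<in> Mx" "W \<subseteq> loc M"
      then show "vge (v M) 0 (x + y)" using that by (intro valn.vge_add[OF v_props(1)]) (auto simp: T_def)
    qed
    show "x * y \<in> T" unfolding T_def
    proof (intro CollectI ballI impI)
      fix M assume M: "M \<in> Mx" "W \<subseteq> loc M"
      then show "vge (v M) 0 (x * y)" using that by (intro valn.vge_mult0[OF v_props(1)]) (auto simp: T_def)
    qed
  qed
  have DT: "D \<subseteq> T" using D_vge by (auto simp: T_def)
  have T1: "1 \<in> T" "0 \<in> T" using DT D_closed by blast+
  have WT: "W \<subseteq> T" using v_props(2) by (auto simp: T_def)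
  define Q where "Q = {u + t | u t. u \<in> D \<and> u / d \<in> T \<and> t \<in> D \<and> (\<forall>w\<in>W. t * w \<in> D)}"
  have Qi: "u + t \<in> Q" if "u \<in> D" "u / d \<in> T" "t \<in> D" "\<forall>w\<in>W. t * w \<in> D" for u t
    using that unfolding Q_def by blast
  have "1 \<in> Q"
  proof (rule ccontr)
    assume n: "1 \<notin> Q"
    have "smod D Q" unfolding smod_def add_closed_def
    proof (intro conjI ballI)
      show "0 \<in> Q" using Qi[of 0 0] D_closed(1) T1 by simp
      fix x y assume "x \<in> Q" "y \<in> Q"
      then obtain u t u' t' where *: "x = u + t" "u \<in> D" "u / d \<in> T" "t \<in> D" "\<forall>w\<in>W. t * w \<in> D"
        "y = u' + t'" "u' \<in> D" "u' / d \<in> T" "t' \<in> D" "\<forall>w\<in>W. t' * w \<in> D" unfolding Q_def by blast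
      have "(u + u') + (t + t') \<in> Q"
        using * T(1)[OF *(3,8)] by (intro Qi) (auto simp: D_closed(3) add_divide_distrib distrib_right)
      then show "x + y \<in> Q" using * by (simp add: algebra_simps)
    next
      fix c x assume c: "c \<in> D" and "x \<in> Q"
      then obtain u t where *: "x = u + t" "u \<in> D" "u / d \<in> T" "t \<in> D" "\<forall>w\<in>W. t * w \<in> D" unfolding Q_def by blast
      have "c * u + c * t \<in> Q"
        using * c T(2)[of c "u / d"] DT by (intro Qi) (auto simp: D_closed(4) mult.assoc)
      then show "c * x \<in> Q" using * by (simp add: distrib_left)
    qed
    moreover have "Q \<subseteq> D" using D_closed(3) by (auto simp: Q_def)
    moreover have "d \<in> Q" using Qi[of d 0] d D_closed(1) T1 by simp
    ultimately obtain M where M: "M \<in> Mx" "D \<subseteq> loc M" "\<forall>x\<in>Q. vge (v M) 1 x"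
      using overring_max[OF sring_D subset_refl, of Q d] n d(2) by blast
    interpret valn "v M" using M by (intro v_props)
    show False
    proof (cases "W \<subseteq> loc M")
      case True
      have "\<forall>w\<in>W. \<exists>s. s \<in> D \<and> s \<notin> M \<and> s * w \<in> D"
      proof
        fix w assume "w \<in> W"
        then have "vge (v M) 0 w" using True v_props(2)[OF M(1)] by auto
        then obtain a s where "a \<in> D" "s \<in> D" "s \<notin> M" "s \<noteq> 0" "v M s = 0" "w = a / s" by (rule locE[OF M(1)])
        then show "\<exists>s. s \<in> D \<and> s \<notin> M \<and> s * w \<in> D" by (intro exI[of _ s]) auto
      qed
      from bchoice[OF this] obtain s where s: "\<forall>w\<in>W. s w \<in> D \<and> s w \<notin> M \<and> s w * w \<in> D" by blast
      have pD: "prod s W \<in> D \<and> prod s W \<notin> M" using M_prime_prod[OF M(1), of W s] s by simp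
      have "\<forall>w\<in>W. prod s W * w \<in> D"
      proof
        fix w assume w: "w \<in> W"
        then have "prod s W * w = s w * w * prod s (W - {w})" using W by (simp add: prod.remove ac_simps)
        moreover have "prod s (W - {w}) \<in> D" using s by (intro D_prod) auto
        ultimately show "prod s W * w \<in> D" using s w D_closed(4) by metis
      qed
      then have "0 + prod s W \<in> Q" using pD D_closed(1) T1 by (intro Qi) auto
      then have "prod s W \<in> Q" by simp
      with M(3) have "vge (v M) 1 (prod s W)" by (rule bspec)
      then show False using pD M_iff[OF M(1)] by blast
    next
      case False
      then obtain w where w: "w \<in> W" "\<not> vge (v M) 0 w" using v_props(2)[OF M(1)] by auto
      then have w0: "w \<noteq> 0" "v M w \<le> -1" by (auto simp: vge_def)
      \<comment> \<open>Then w^k has value at most -v(d), so d w^k has nonpositive value, which some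
        c in D corrects to 0.\<close>
      define k where "k = nat (v M d)"
      have vd: "v M d = int k" using D_vge[OF M(1) d(1)] d(2) by (simp add: k_def vge_def)
      have "int k * v M w \<le> int k * (-1)" using w0 by (intro mult_left_mono) auto
      then have neg: "v M (d * w ^ k) \<le> 0" using d w0 vd by (simp add: v_mult v_power)
      obtain c where c: "c \<in> D" "c \<noteq> 0" "v M c = - v M (d * w ^ k)" by (rule D_elt[OF M(1), of "- v M (d * w ^ k)"]) (use neg in auto)
      have y: "d * w ^ k * c \<noteq> 0" "v M (d * w ^ k * c) = 0" using d w0 c by (auto simp: v_mult)
      then have "vge (v M) 0 (d * w ^ k * c)" by (simp add: vge_def)
      then obtain a s where as: "a \<in> D" "s \<in> D" "s \<notin> M" "s \<noteq> 0" "v M s = 0" "d * w ^ k * c = a / s" by (rule locE[OF M(1)])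
      have a: "a = s * (d * w ^ k * c)" using as by simp
      have wk: "w ^ k \<in> T" using w WT T(2) T1 by (induction k) auto
      have "a / d = s * (w ^ k * c)" using a d by simp
      also have "\<dots> \<in> T" using wk c as DT T(2) by blast
      finally have "a + 0 \<in> Q" using as D_closed(1) by (intro Qi) auto
      then have "a \<in> Q" by simp
      with M(3) have "vge (v M) 1 a" by (rule bspec)
      moreover have "a \<noteq> 0" unfolding a using as(4) y(1) by (simp only: mult_eq_0_iff) simp
      moreover have "v M a = 0" unfolding a using v_mult[OF as(4) y(1)] y(2) as(5) by simp
      ultimately show False by (simp add: vge_def)
    qed
  qed
  then obtain u t where ut: "1 = u + t" "u \<in> D" "u / d \<in> T" "t \<in> D" "\<forall>w\<in>W. t * w \<in> D" unfolding Q_def by blast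
  show ?thesis
  proof
    show "\<forall>M\<in>Mx. W \<subseteq> loc M \<longrightarrow> vge (v M) 0 (u / d)" using ut(3) by (simp add: T_def)
    show "\<forall>M\<in>Mx. \<not> W \<subseteq> loc M \<longrightarrow> d * (u / d) \<noteq> 0 \<and> v M (d * (u / d)) = 0"
    proof (intro ballI impI)
      fix M assume M: "M \<in> Mx" "\<not> W \<subseteq> loc M"
      interpret valn "v M" using M by (intro v_props)
      obtain w where w: "w \<in> W" "\<not> vge (v M) 0 w" using M v_props(2)[OF M(1)] by auto
      have "vge (v M) 1 t"
      proof (cases "t = 0")
        case False
        have "vge (v M) 0 (t * w)" using ut(5) w(1) by (intro D_vge[OF M(1)]) blast
        then show ?thesis using w(2) False by (auto simp: vge_def v_mult)
      qed simp
      then have "vge (v M) (v M 1 + 1) (- t)" by simp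
      note v_add_eq[OF one_neq_zero this]
      moreover have "1 + - t = u" using ut(1) by (simp add: algebra_simps)
      ultimately have "u \<noteq> 0" "v M u = 0" by (simp_all only: v_one not_False_eq_True)
      then show "d * (u / d) \<noteq> 0 \<and> v M (d * (u / d)) = 0" using d(2) by simp
    qed
  qed
qed

lemma common_denominator:
  assumes "finite X" shows "\<exists>d\<in>D. d \<noteq> 0 \<and> (\<forall>f\<in>X. smult d f \<in> intpoly D)"
  using assms
proof (induction X rule: finite_induct)
  case empty
  then show ?case using D_closed(2) by (intro bexI[of _ 1]) auto
next
  case (insert g X)
  then obtain d where d: "d \<in> D" "d \<noteq> 0" "\<forall>f\<in>X. smult d f \<in> intpoly D" by blast
  obtain e where e: "e \<in> D" "e \<noteq> 0" "smult e g \<in> intpoly D" using poly_denominator by blast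
  have sm: "smult c f \<in> intpoly D" if "c \<in> D" "f \<in> intpoly D" for c f
    using dmod_B that unfolding D_module_def by blast
  have "smult (e * d) f \<in> intpoly D" if "f \<in> insert g X" for f
  proof (cases "f = g")
    case True
    then show ?thesis using sm[OF d(1) e(3)] by (simp add: mult.commute)
  next
    case False
    then show ?thesis using sm[OF e(1), of "smult d f"] d(3) that by simp
  qed
  then show ?case using d e D_closed(4) by (intro bexI[of _ "e * d"]) auto
qed

lemma locm_self: "M \<in> Mx \<Longrightarrow> C \<subseteq> local_at M C"
  using MxD(3) D_closed(2) by (auto simp: local_at_def intro!: bexI[of _ 1])

lemma locm_idem: assumes M: "M \<in> Mx" and f: "f \<in> local_at M (local_at M C)" shows "f \<in> local_at M C"
proof -
  obtain s where s: "s \<in> D" "s \<notin> M" "smult s f \<in> local_at M C" using f unfolding local_at_def by blast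
  then obtain t where t: "t \<in> D" "t \<notin> M" "smult t (smult s f) \<in> C" unfolding local_at_def by blast
  have "smult (t * s) f \<in> C" using t by simp
  then show ?thesis using M_prime[OF M t(1,2) s(1,2)] unfolding local_at_def by blast
qed

lemma locm_mult:
  assumes M: "M \<in> Mx" and f: "f \<in> local_at M C" "g \<in> local_at M C'" and CC: "\<And>a b. a \<in> C \<Longrightarrow> b \<in> C' \<Longrightarrow> a * b \<in> E"
  shows "f * g \<in> local_at M E"
proof -
  obtain s where s: "s \<in> D" "s \<notin> M" "smult s f \<in> C" using f(1) unfolding local_at_def by blast
  obtain t where t: "t \<in> D" "t \<notin> M" "smult t g \<in> C'" using f(2) unfolding local_at_def by blast
  have "smult s f * smult t g \<in> E" by (rule CC[OF s(3) t(3)])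
  then have "smult (s * t) (f * g) \<in> E" by (simp add: mult.commute)
  then show ?thesis using M_prime[OF M s(1,2) t(1,2)] unfolding local_at_def by blast
qed

end

context int_compatible
begin

text \<open>An ideal over \<open>TT \<alpha>\<close> is given by generators over \<open>D\<close> that can fail to be invertible only at the
  \<open>M\<close> where some finite \<open>W \<subseteq> TT \<alpha>\<close> is not integral; at those \<open>M\<close> it is replaced by the unit ideal.\<close>
lemma extT_surj:
  assumes I': "I' \<in> INV TI" shows "\<exists>I\<in>INV B. exts id TI I = I'"
proof -
  obtain H' where H': "H' \<in> INV TI" "smod TI I'" "smod TI H'" "mprod I' H' = TI" using I' by (rule INV_E)
  obtain X Y where XY: "finite X" "finite Y" "X \<subseteq> I'" "Y \<subseteq> H'" "1 \<in> mprod X Y" "I' = mprod X TI" "H' = mprod Y TI"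
    using INV_finite_gens[OF sring_TI H'(2-4)] by metis
  define F where "F = mprod X B"
  define H where "H = mprod Y B"
  have sF: "smod B F" "smod B H" unfolding F_def H_def by (intro smod_mprod2 smod_self sring_B)+
  have B': "f * g \<in> B" "f + g \<in> B" "1 \<in> B" "0 \<in> B" if "f \<in> B" "g \<in> B" for f g
    using sring_B that by (auto simp: sring_def add_closed_def)
  have B1: "1 \<in> B" using sring_B by (simp add: sring_def)
  have cB: "constp a \<in> B" if "a \<in> D" for a using constp_intpoly[OF sring_D] that by blast
  have TIeq: "TI = mprod B (constp ` TT \<alpha>)" using Int_TT_eq by (simp add: intpoly_ext_eq mprod_comm)
  have "\<forall>i\<in>X \<times> Y. \<exists>W. finite W \<and> W \<subseteq> TT \<alpha> \<and> fst i * snd i \<in> mprod B (constp ` W)"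
  proof
    fix i assume "i \<in> X \<times> Y"
    then have "fst i * snd i \<in> mprod I' H'" using XY(3,4) by (intro mprodI) auto
    then have "fst i * snd i \<in> mprod B (constp ` TT \<alpha>)" using H'(4) TIeq by simp
    then obtain W where "finite W" "W \<subseteq> TT \<alpha>" "fst i * snd i \<in> mprod B (constp ` W)" by (rule mprod_constp_finite)
    then show "\<exists>W. finite W \<and> W \<subseteq> TT \<alpha> \<and> fst i * snd i \<in> mprod B (constp ` W)" by blast
  qed
  from bchoice[OF this] obtain Wf where Wf: "\<forall>i\<in>X \<times> Y. finite (Wf i) \<and> Wf i \<subseteq> TT \<alpha> \<and> fst i * snd i \<in> mprod B (constp ` Wf i)"
    by (rule exE)
  define W where "W = (\<Union>i\<in>X \<times> Y. Wf i)"
  have "finite (X \<times> Y)" using XY(1,2) by simp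
  then have W: "finite W" "W \<subseteq> TT \<alpha>" using Wf unfolding W_def by blast+
  have good: "f * g \<in> local_at M B" if M: "M \<in> Mx" "W \<subseteq> loc M" and fg: "f \<in> F" "g \<in> H" for M f g
  proof -
    have gen: "x * y \<in> local_at M B" if "x \<in> X" "y \<in> Y" for x y
    proof -
      have i: "(x, y) \<in> X \<times> Y" using that by blast
      then have "Wf (x, y) \<subseteq> loc M" using M(2) unfolding W_def by blast
      moreover have "x * y \<in> mprod B (constp ` Wf (x, y))" using bspec[OF Wf i] by simp
      ultimately show ?thesis by (intro mprod_locm[OF M(1) dmod_B])
    qed
    have BB: "b * h \<in> local_at M B" if "h \<in> local_at M B" "b \<in> B" for h b
      using locm_mult[OF M(1) subsetD[OF locm_self[OF M(1)] that(2)] that(1)] B'(1) by blast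
    have "mprod F H = mprod (mprod X Y) (mprod B B)" by (simp add: F_def H_def mprod_ac)
    also have "\<dots> \<subseteq> local_at M B"
    proof (rule mprod_least[OF _ addc_locm[OF M(1) dmod_B]])
      fix a b assume ab: "a \<in> mprod X Y" "b \<in> mprod B B"
      have "mprod X Y \<subseteq> local_at M B" by (rule mprod_least[OF gen addc_locm[OF M(1) dmod_B]])
      then have "a \<in> local_at M B" using ab(1) by blast
      moreover have "b \<in> B" using ab(2) sring_idem[OF sring_B] by simp
      ultimately have "b * a \<in> local_at M B" by (intro BB)
      then show "a * b \<in> local_at M B" by (simp add: mult.commute)
    qed
    finally show ?thesis using mprodI[OF fg] by blast
  qed
  obtain d where d: "d \<in> D" "d \<noteq> 0" "\<forall>f\<in>X \<union> Y. smult d f \<in> B"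
    using common_denominator[of "X \<union> Y"] XY(1,2) by auto
  \<comment> \<open>Write d as d times an expression of 1 through \<open>mprod X Y\<close>, and let
    d clear the denominators of the factors from the other set.\<close>
  have dF: "constp d \<in> F" "constp d \<in> H"
  proof -
    have "constp d * 1 \<in> mprod {constp d} (mprod X Y)" using XY(5) by (intro mprodI) auto
    moreover have "mprod {constp d} (mprod X Y) \<subseteq> mprod X B"
    proof -
      have "mprod {constp d} (mprod X Y) = mprod X (mprod {constp d} Y)" by (rule mprod_left_comm)
      also have "\<dots> \<subseteq> mprod X B"
        using d(3) sring_B by (intro mprod_mono subset_refl mprod_least) (auto simp: constp_mult sring_def)
      finally show ?thesis .
    qed
    moreover have "mprod {constp d} (mprod X Y) \<subseteq> mprod Y B"
    proof -
      have "mprod {constp d} (mprod X Y) = mprod Y (mprod {constp d} X)" by (simp add: mprod_ac)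
      also have "\<dots> \<subseteq> mprod Y B"
        using d(3) sring_B by (intro mprod_mono subset_refl mprod_least) (auto simp: constp_mult sring_def)
      finally show ?thesis .
    qed
    ultimately show "constp d \<in> F" "constp d \<in> H" unfolding F_def H_def by (auto simp: mult_1_right)
  qed
  have dFB: "smult d f \<in> B" if "f \<in> F \<union> H" for f
  proof -
    have "mprod Z B \<subseteq> {f. smult d f \<in> B}" if Z: "Z \<subseteq> X \<union> Y" for Z
    proof (rule mprod_least)
      show "add_closed {f. smult d f \<in> B}" using sring_B by (auto simp: sring_def add_closed_def smult_add_right)
      fix a b assume ab: "a \<in> Z" "b \<in> B"
      then have "smult d a \<in> B" using d(3) Z by blast
      then have "smult d a * b \<in> B" using ab(2) by (rule B'(1))
      then show "a * b \<in> {f. smult d f \<in> B}" by simp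
    qed
    from this[of X] this[of Y] show ?thesis using that unfolding F_def H_def by blast
  qed
  obtain \<zeta> where z: "\<forall>M\<in>Mx. W \<subseteq> loc M \<longrightarrow> vge (v M) 0 \<zeta>"
    "\<forall>M\<in>Mx. \<not> W \<subseteq> loc M \<longrightarrow> d * \<zeta> \<noteq> 0 \<and> v M (d * \<zeta>) = 0"
    by (rule cut_element[OF W(1) d(1,2)])
  have "mprod {1, \<zeta>} D \<in> INV D" by (rule pruefer[of _ 1]) auto
  then obtain J where J: "J \<in> INV D" "smod D J" "mprod (mprod {1, \<zeta>} D) J = D" by (rule INV_E)
  have yJ: "mprod {1, \<zeta>} J = D" using J(3) mprod_unit[OF sring_D J(2)] by (simp add: mprod_assoc)
  have jD: "j \<in> D" "\<zeta> * j \<in> D" if "j \<in> J" for j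
    using mprodI[of 1 "{1,\<zeta>}" j J] mprodI[of \<zeta> "{1,\<zeta>}" j J] that yJ by auto
  \<comment> \<open>For Z = \<open>X\<close> or \<open>Y\<close>: where W is integral at M, J
    contains a unit while d and d \<zeta> add nothing new, so the localization is that of
    \<open>mprod Z B\<close>. At the other M, d \<zeta> is a unit and J has value at least that of
    d, so the localization is that of Int(D).\<close>
  define gen where "gen = (\<lambda>Z. {x * constp j | x j. x \<in> Z \<and> j \<in> J} \<union> {constp d, constp (d * \<zeta>)})"
  define I where "I = mprod (gen X) B"
  define K where "K = mprod (gen Y) B"
  have sI: "smod B I" "smod B K" unfolding I_def K_def by (intro smod_mprod2 smod_self sring_B)+
  have genI: "f \<in> I" if "f \<in> gen X" for f using mprodI[OF that B1] by (simp add: I_def)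
  have genK: "f \<in> K" if "f \<in> gen Y" for f using mprodI[OF that B1] by (simp add: K_def)
  have gd: "constp d \<in> gen Z" "constp (d * \<zeta>) \<in> gen Z" for Z by (simp_all add: gen_def)
  have smB: "smult a f \<in> C" if "a \<in> D" "f \<in> C" "smod B C" for a f C
    using smod_dmod[OF that(3)] that(1,2) unfolding D_module_def by blast
  have lmB: "f * b \<in> local_at M C" if "M \<in> Mx" "f \<in> local_at M C" "b \<in> B" "smod B C" for M f b C
    using locm_mult[OF that(1,2) subsetD[OF locm_self[OF that(1)] that(3)], of C] that(4)
    unfolding smod_def by (metis mult.commute)
  have gsub: "mprod (gen Z) B \<subseteq> local_at M (mprod Z B)"
    if M: "M \<in> Mx" "W \<subseteq> loc M" and Z: "constp d \<in> mprod Z B" for M Z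
  proof (rule mprod_least[OF _ addc_locm[OF M(1) smod_dmod]])
    show s: "smod B (mprod Z B)" by (intro smod_mprod2 smod_self sring_B)
    have "vge (v M) 0 \<zeta>" using z(1) M by blast
    then obtain a s where as: "a \<in> D" "s \<in> D" "s \<notin> M" "s \<noteq> 0" "v M s = 0" "\<zeta> = a / s" by (rule locE[OF M(1)])
    have 1: "f \<in> local_at M (mprod Z B)" if fg: "f \<in> gen Z" for f
    proof -
      consider x j where "f = x * constp j" "x \<in> Z" "j \<in> J" | "f = constp d" | "f = constp (d * \<zeta>)"
        using fg unfolding gen_def by blast
      then show ?thesis
      proof cases
        case 1
        then have "f \<in> mprod Z B" using cB[OF jD(1)] by (auto intro: mprodI)
        then show ?thesis using locm_self[OF M(1)] by blast
      next
        case 2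
        then show ?thesis using Z locm_self[OF M(1)] by blast
      next
        case 3
        have "smult s f = smult a (constp d)" using 3 as by (simp add: constp_def)
        also have "\<dots> \<in> mprod Z B" by (rule smB[OF as(1) Z s])
        finally show ?thesis using as unfolding local_at_def by blast
      qed
    qed
    fix f b assume "f \<in> gen Z" "b \<in> B"
    then show "f * b \<in> local_at M (mprod Z B)" using 1 lmB[OF M(1) _ _ s] by blast
  qed
  have gbad: "mprod (gen Z) B \<subseteq> local_at M B"
    if M: "M \<in> Mx" "\<not> W \<subseteq> loc M" and Z: "Z \<subseteq> X \<union> Y" for M Z
  proof (rule mprod_least[OF _ addc_locm[OF M(1) dmod_B]])
    interpret valn "v M" using M by (intro v_props)
    have dz: "d * \<zeta> \<noteq> 0" "v M (d * \<zeta>) = 0" using z(2) M by blast+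
    have 1: "f \<in> local_at M B" if fg: "f \<in> gen Z" for f
    proof -
      consider x j where "f = x * constp j" "x \<in> Z" "j \<in> J" | "f = constp d" | "f = constp (d * \<zeta>)"
        using fg unfolding gen_def by blast
      then show ?thesis
      proof cases
        case 1
        have zn: "\<zeta> \<noteq> 0" using dz by auto
        \<comment> \<open>Since \<zeta> j is integral and d \<zeta> is a unit, j is divisible by d
          in D_M and thus clears the denominators of x.\<close>
        have "vge (v M) 0 (d * \<zeta> * (j / d))" using D_vge[OF M(1) jD(2)[OF 1(3)]] d(2) by simp
        then have "vge (v M) 0 (j / d)" using dz by (cases "j / d = 0") (auto simp: vge_def v_mult v_divide)
        then obtain a s where as: "a \<in> D" "s \<in> D" "s \<notin> M" "s \<noteq> 0" "v M s = 0" "j / d = a / s" by (rule locE[OF M(1)])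
        then have sj: "s * j = a * d" using d(2) by (simp add: field_simps)
        have "smult s f = smult (s * j) x" using 1 by (simp add: constp_def mult.commute)
        also have "\<dots> = smult a (smult d x)" by (simp add: sj)
        also have "\<dots> \<in> B" using d(3) 1(2) Z by (intro smB[OF as(1) _ smod_self[OF sring_B]]) blast
        finally show ?thesis using as unfolding local_at_def by blast
      next
        case 2
        then show ?thesis using cB[OF d(1)] locm_self[OF M(1)] by blast
      next
        case 3
        have "vge (v M) 0 (d * \<zeta>)" using dz by (simp add: vge_def)
        then obtain a s where as: "a \<in> D" "s \<in> D" "s \<notin> M" "s \<noteq> 0" "v M s = 0" "d * \<zeta> = a / s" by (rule locE[OF M(1)])
        have "smult s f = constp a" using 3 as by (simp add: constp_def)
        then show ?thesis using as cB[OF as(1)] unfolding local_at_def by auto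
      qed
    qed
    fix f b assume "f \<in> gen Z" "b \<in> B"
    then show "f * b \<in> local_at M B" using 1 lmB[OF M(1) _ _ smod_self[OF sring_B]] by blast
  qed
  have sE: "smod B (mprod I K)" by (rule smod_mprod[OF sI(1)])
  have unitj: "\<exists>j\<in>J. j \<in> D \<and> j \<notin> M" if M: "M \<in> Mx" "W \<subseteq> loc M" for M
  proof (rule ccontr)
    interpret valn "v M" using M by (intro v_props)
    assume "\<not> ?thesis"
    then have n: "vge (v M) 1 j" if "j \<in> J" for j using M_iff[OF M(1) jD(1)[OF that]] jD(1)[OF that] that by blast
    have "mprod {1, \<zeta>} J \<subseteq> {x. vge (v M) 1 x}"
    proof (rule mprod_least[OF _ addc_vge])
      fix a j assume "a \<in> {1, \<zeta>}" "j \<in> J"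
      then have "vge (v M) 0 a" "vge (v M) 1 j" using z(1) M n by auto
      then show "a * j \<in> {x. vge (v M) 1 x}" by (simp add: vge_mult0)
    qed
    then have "1 \<in> {x. vge (v M) 1 x}" using yJ D_closed(2) by blast
    then show False by simp
  qed
  have FI: "mprod Z B \<subseteq> local_at M (mprod (gen Z) B)" if M: "M \<in> Mx" "W \<subseteq> loc M" for M Z
  proof -
    obtain j where j: "j \<in> J" "j \<in> D" "j \<notin> M" using unitj[OF M] by blast
    have s: "smod B (mprod (gen Z) B)" by (intro smod_mprod2 smod_self sring_B)
    have 1: "x \<in> local_at M (mprod (gen Z) B)" if "x \<in> Z" for x
    proof -
      have "x * constp j \<in> gen Z" using that j(1) unfolding gen_def by blast
      then have "x * constp j * 1 \<in> mprod (gen Z) B" using B1 by (rule mprodI)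
      then have "smult j x \<in> mprod (gen Z) B" by (simp add: constp_def mult.commute)
      then show ?thesis using j unfolding local_at_def by blast
    qed
    show ?thesis
    proof (rule mprod_least[OF _ addc_locm[OF M(1) smod_dmod[OF s]]])
      fix x b assume "x \<in> Z" "b \<in> B"
      then show "x * b \<in> local_at M (mprod (gen Z) B)" using 1 lmB[OF M(1) _ _ s] by blast
    qed
  qed
  have IK: "mprod I K = B"
  proof
    show "mprod I K \<subseteq> B"
    proof (rule mprod_least)
      show "add_closed B" using sring_B by (simp add: sring_def)
      fix f g assume fg: "f \<in> I" "g \<in> K"
      obtain e where e: "e \<in> D" "e \<noteq> 0" "smult e (f * g) \<in> B" using poly_denominator by blast
      show "f * g \<in> B"
      proof (rule local_global_D[OF dmod_B e])
        fix M assume M: "M \<in> Mx"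
        show "f * g \<in> local_at M B"
        proof (cases "W \<subseteq> loc M")
          case True
          have "f \<in> local_at M F" using gsub[OF M True, of X] dF fg(1) unfolding I_def F_def by blast
          moreover have "g \<in> local_at M H" using gsub[OF M True, of Y] dF fg(2) unfolding K_def H_def by blast
          ultimately have "f * g \<in> local_at M (local_at M B)" by (rule locm_mult[OF M _ _ good[OF M True]])
          then show ?thesis by (rule locm_idem[OF M])
        next
          case False
          have "f \<in> local_at M B" using gbad[OF M False, of X] fg(1) unfolding I_def by blast
          moreover have "g \<in> local_at M B" using gbad[OF M False, of Y] fg(2) unfolding K_def by blast
          ultimately show ?thesis by (rule locm_mult[OF M _ _ B'(1)])
        qed
      qed
    qed
    \<comment> \<open>This supplies the nonzero multiplier into the product that
      \<open>local_global_D\<close> asks for.\<close>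
    have dd: "constp d * constp d \<in> mprod I K" using gd by (intro mprodI genI genK)
    have e: "d * d \<in> D" "d * d \<noteq> 0" "smult (d * d) 1 \<in> mprod I K"
      using d D_closed(4) dd by (simp_all add: constp_def one_pCons)
    have "1 \<in> mprod I K"
    proof (rule local_global_D[OF smod_dmod[OF sE] e])
      fix M assume M: "M \<in> Mx"
      show "1 \<in> local_at M (mprod I K)"
      proof (cases "W \<subseteq> loc M")
        case True
        have "mprod X Y \<subseteq> local_at M (mprod I K)"
        proof (rule mprod_least[OF _ addc_locm[OF M smod_dmod[OF sE]]])
          fix x y assume xy: "x \<in> X" "y \<in> Y"
          have "x * 1 \<in> mprod X B" "y * 1 \<in> mprod Y B" using xy B1 by (auto intro!: mprodI simp del: mult_1_right)
          then have "x \<in> local_at M I" "y \<in> local_at M K" using FI[OF M True] unfolding I_def K_def by auto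
          then show "x * y \<in> local_at M (mprod I K)" by (rule locm_mult[OF M _ _ mprodI])
        qed
        then show ?thesis using XY(5) by blast
      next
        case False
        interpret valn "v M" using M by (intro v_props)
        have dz: "d * \<zeta> \<noteq> 0" "v M (d * \<zeta>) = 0" using z(2) M False by blast+
        then have "vge (v M) 0 (d * \<zeta>)" by (simp add: vge_def)
        then obtain a s where as: "a \<in> D" "s \<in> D" "s \<notin> M" "s \<noteq> 0" "v M s = 0" "d * \<zeta> = a / s" by (rule locE[OF M])
        have a0: "a \<noteq> 0" "v M a = 0" using as dz by (auto simp: v_divide)
        then have aM: "a \<notin> M" using M_iff[OF M as(1)] by (simp add: vge_def)
        have "smult s (constp (d * \<zeta>)) = smult a 1" using as(4,6) by (simp add: constp_def one_pCons)
        then have "smult a 1 \<in> I" "smult a 1 \<in> K"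
          using smB[OF as(2) genI[OF gd(2)] sI(1)] smB[OF as(2) genK[OF gd(2)] sI(2)] by simp_all
        then have "smult a 1 * smult a 1 \<in> mprod I K" by (rule mprodI)
        then have "smult (a * a) 1 \<in> mprod I K" by (simp add: one_pCons)
        then show ?thesis using M_prime[OF M as(1) aM as(1) aM] unfolding local_at_def by blast
      qed
    qed
    then show "B \<subseteq> mprod I K" by (rule smod_one[OF sE])
  qed
  have II: "I \<in> INV B" by (rule INV_I[OF sI IK])
  have BT: "mprod B TI = TI"
  proof -
    have "mprod B TI = exts id TI B" by (simp add: exts_def)
    also have "\<dots> = TI" using intpoly_D_TT B1 by (intro exts_one[OF rhom_id(1) sring_TI]) auto
    finally show ?thesis .
  qed
  have cT: "constp ` TT \<alpha> \<subseteq> TI" by (rule constp_intpoly[OF sring_TT])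
  \<comment> \<open>Every D_M above T_\<alpha> is one where nothing was replaced, so over T_\<alpha>
    the ideals I and I' agree locally.\<close>
  have W\<alpha>: "W \<subseteq> loc M" if "TT \<alpha> \<subseteq> loc M" for M using W(2) that by blast
  have "exts id TI I = I'"
  proof
    have "I \<subseteq> I'"
    proof
      fix f assume f: "f \<in> I"
      obtain e where e: "e \<in> D" "e \<noteq> 0" "smult e f \<in> B" using poly_denominator by blast
      have "smult e f * constp d \<in> F" using e(3) dF(1) sF(1) unfolding smod_def by blast
      then have ed: "e * d \<in> D" "e * d \<noteq> 0" "smult (e * d) f \<in> F"
        using e d D_closed(4) by (simp_all add: constp_def mult.commute)
      have "f \<in> mprod F (constp ` TT \<alpha>)"
      proof (rule local_global[OF sring_TT D_TT smod_dmod[OF sF(1)] ed])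
        fix M assume "M \<in> Mx" "TT \<alpha> \<subseteq> loc M"
        then show "f \<in> local_at M F" using gsub[of M X] W\<alpha> dF(1) f unfolding F_def I_def by blast
      qed
      also have "mprod F (constp ` TT \<alpha>) \<subseteq> mprod F TI" by (rule mprod_mono[OF subset_refl cT])
      also have "mprod F TI = I'" unfolding F_def mprod_assoc BT using XY(6) by simp
      finally show "f \<in> I'" .
    qed
    then have "mprod I TI \<subseteq> mprod I' TI" by (intro mprod_mono) auto
    then show "exts id TI I \<subseteq> I'" using mprod_unit[OF sring_TI H'(2)] by (simp add: exts_def)
    have "X \<subseteq> mprod I TI"
    proof
      fix f assume f: "f \<in> X"
      have sd: "smult d f \<in> B" using d(3) f by blast
      have "smult d f * constp d \<in> I" using sd genI[OF gd(1)] sI(1) unfolding smod_def by blast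
      then have ed: "d * d \<in> D" "d * d \<noteq> 0" "smult (d * d) f \<in> I"
        using d D_closed(4) by (simp_all add: constp_def mult.commute)
      have "f \<in> mprod I (constp ` TT \<alpha>)"
      proof (rule local_global[OF sring_TT D_TT smod_dmod[OF sI(1)] ed])
        fix M assume M: "M \<in> Mx" "TT \<alpha> \<subseteq> loc M"
        have "f * 1 \<in> mprod X B" using f B1 by (rule mprodI)
        then show "f \<in> local_at M I" using FI[OF M(1) W\<alpha>[OF M(2)], of X] unfolding I_def by auto
      qed
      then show "f \<in> mprod I TI" using mprod_mono[OF subset_refl cT] by blast
    qed
    then have "mprod X TI \<subseteq> mprod (mprod I TI) TI" by (intro mprod_mono) auto
    also have "\<dots> = mprod I TI" by (simp add: mprod_assoc sring_idem[OF sring_TI])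
    finally show "I' \<subseteq> exts id TI I" using XY(6) by (simp add: exts_def)
  qed
  then show ?thesis using II by blast
qed

lemma gT_surj: "gT ` carrier (PicInt D) = carrier (PicInt (TT \<alpha>))"
proof
  show "gT ` carrier (PicInt D) \<subseteq> carrier (PicInt (TT \<alpha>))" using hom_in_carrier[OF gT(1)] by blast
  show "carrier (PicInt (TT \<alpha>)) \<subseteq> gT ` carrier (PicInt D)"
  proof
    fix X assume "X \<in> carrier (PicInt (TT \<alpha>))"
    then obtain I' where I': "I' \<in> INV TI" "X = pint (TT \<alpha>) I'" using pint_surj[OF sring_TT[of \<alpha>]] by blast
    obtain I where I: "I \<in> INV B" "exts id TI I = I'" using extT_surj[OF I'(1)] by blast
    then have "X = gT (pint D I)" using gT(2) I'(2) by simp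
    then show "X \<in> gT ` carrier (PicInt D)" using pint_carrier[OF I(1)] by blast
  qed
qed

end

section \<open>The exact sequence\<close>

declare Pic_simps [simp del]

context int_compatible
begin

abbreviation A where "A \<equiv> {M \<in> Mx. M \<notin> NN \<alpha>}"
abbreviation GM where "GM \<equiv> \<lambda>M. Pic (IntK (loc M))"
abbreviation SG where "SG \<equiv> sum_group A GM"

lemma group_GM: "M \<in> A \<Longrightarrow> group (GM M)"
  using comm_group_Pic_loc comm_group.axioms(2) by blast

text \<open>The lift from M has known normalized values on \<open>NN (st M)\<close>. At an N that
  belongs to the stages of all other factors present, f has the normalized values of the component
  at N alone; both halves of the argument arrange this situation.\<close>

lemma exact_sequence:
  "\<exists>f g. group SG \<and> group (PicInt D) \<and> group (PicInt (TT \<alpha>)) \<and> f \<in> hom SG (PicInt D) \<and>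
    inj_on f (carrier SG) \<and> g \<in> hom (PicInt D) (PicInt (TT \<alpha>)) \<and>
    g ` carrier (PicInt D) = carrier (PicInt (TT \<alpha>)) \<and>
    f ` carrier SG = kernel (PicInt D) (PicInt (TT \<alpha>)) g"
proof -
  let ?P = "PicInt D" and ?Q = "PicInt (TT \<alpha>)"
  interpret P: comm_group ?P by (rule comm_group_PicInt_D)
  interpret Q: comm_group ?Q by (rule comm_group_PicInt_TT)
  have gSG: "group SG" using group_GM by (rule sum_group)
  have "\<forall>M\<in>A. \<exists>\<gamma>s. fst \<gamma>s < \<alpha> \<and> M \<in> NN (fst \<gamma>s) \<and> snd \<gamma>s \<in> hom (GM M) ?P \<and>
    (\<forall>X\<in>carrier (GM M). gT (snd \<gamma>s X) = \<one>\<^bsub>?Q\<^esub> \<and> (\<forall>a\<in>D. dP M a (snd \<gamma>s X) = dM M a X) \<and>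
      (\<forall>N\<in>NN (fst \<gamma>s). N \<noteq> M \<longrightarrow> (\<forall>a\<in>D. dP N a (snd \<gamma>s X) = 0)))"
  proof
    fix M assume "M \<in> A"
    then obtain \<gamma> s where "\<gamma> < \<alpha> \<and> M \<in> NN \<gamma> \<and> s \<in> hom (GM M) ?P \<and>
    (\<forall>X\<in>carrier (GM M). gT (s X) = \<one>\<^bsub>?Q\<^esub> \<and>
      (\<forall>a\<in>D. dP M a (s X) = dM M a X) \<and> (\<forall>N\<in>NN \<gamma>. N \<noteq> M \<longrightarrow> (\<forall>a\<in>D. dP N a (s X) = 0)))"
      using section_exists[of M] by blast
    then show "\<exists>\<gamma>s. fst \<gamma>s < \<alpha> \<and> M \<in> NN (fst \<gamma>s) \<and> snd \<gamma>s \<in> hom (GM M) ?P \<and>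
    (\<forall>X\<in>carrier (GM M). gT (snd \<gamma>s X) = \<one>\<^bsub>?Q\<^esub> \<and> (\<forall>a\<in>D. dP M a (snd \<gamma>s X) = dM M a X) \<and>
      (\<forall>N\<in>NN (fst \<gamma>s). N \<noteq> M \<longrightarrow> (\<forall>a\<in>D. dP N a (snd \<gamma>s X) = 0)))"
      by (intro exI[of _ "(\<gamma>, s)"]) simp
  qed
  from bchoice[OF this] obtain t where t: "\<forall>M\<in>A. fst (t M) < \<alpha> \<and> M \<in> NN (fst (t M)) \<and> snd (t M) \<in> hom (GM M) ?P \<and>
    (\<forall>X\<in>carrier (GM M). gT (snd (t M) X) = \<one>\<^bsub>?Q\<^esub> \<and> (\<forall>a\<in>D. dP M a (snd (t M) X) = dM M a X) \<and>
      (\<forall>N\<in>NN (fst (t M)). N \<noteq> M \<longrightarrow> (\<forall>a\<in>D. dP N a (snd (t M) X) = 0)))" by (rule exE)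
  define st where "st = (\<lambda>M. fst (t M))"
  define s where "s = (\<lambda>M. snd (t M))"
  have st: "st M < \<alpha>" "M \<in> NN (st M)" if "M \<in> A" for M using bspec[OF t that] by (simp_all add: st_def)
  have shom: "s M \<in> hom (GM M) ?P" if "M \<in> A" for M using bspec[OF t that] by (simp add: s_def)
  have sg: "gT (s M X) = \<one>\<^bsub>?Q\<^esub>" if "M \<in> A" "X \<in> carrier (GM M)" for M X
    using bspec[OF t that(1)] that(2) by (simp add: s_def)
  have sM: "dP M a (s M X) = dM M a X" if "M \<in> A" "X \<in> carrier (GM M)" "a \<in> D" for M X a
    using bspec[OF t that(1)] that(2,3) by (simp add: s_def)
  have sN: "dP N a (s M X) = 0" if "M \<in> A" "X \<in> carrier (GM M)" "a \<in> D" "N \<in> NN (st M)" "N \<noteq> M" for M X a N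
    using bspec[OF t that(1)] that(2-5) by (simp add: s_def st_def)
  define f where "f = (\<lambda>x. gfinprod ?P (\<lambda>M. s M (x M)) A)"
  have fhom: "f \<in> hom SG ?P"
    unfolding f_def by (rule P.hom_group_sum[OF shom group_GM])
  have carrier_SG: "carrier SG = {x \<in> \<Pi>\<^sub>E i\<in>A. carrier (GM i). finite {i \<in> A. x i \<noteq> \<one>\<^bsub>GM i\<^esub>}}"
    by (rule carrier_sum_group[OF group_GM])
  have car: "x M \<in> carrier (GM M)" if "x \<in> carrier SG" "M \<in> A" for x M
    using that(1) that(2) unfolding carrier_SG by blast
  have fin: "finite {M \<in> A. x M \<noteq> \<one>\<^bsub>GM M\<^esub>}" if "x \<in> carrier SG" for x
    using that unfolding carrier_SG by blast
  have sc: "s M (x M) \<in> carrier ?P" if "x \<in> carrier SG" "M \<in> A" for x M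
    by (rule hom_in_carrier[OF shom[OF that(2)] car[OF that]])
  have f_eq: "f x = finprod ?P (\<lambda>M. s M (x M)) E"
    if x: "x \<in> carrier SG" and E: "finite E" "E \<subseteq> A" "\<And>M. M \<in> A \<Longrightarrow> M \<notin> E \<Longrightarrow> x M = \<one>\<^bsub>GM M\<^esub>" for x E
    unfolding f_def
  proof (rule P.gfinprod_support[OF E(1,2)])
    show "(\<lambda>M. s M (x M)) \<in> A \<rightarrow> carrier ?P" using sc[OF x] by blast
    fix M assume M: "M \<in> A" "M \<notin> E"
    have "s M \<one>\<^bsub>GM M\<^esub> = \<one>\<^bsub>?P\<^esub>" by (rule hom_one[OF shom[OF M(1)] group_GM[OF M(1)] P.is_group])
    then show "s M (x M) = \<one>\<^bsub>?P\<^esub>" using E(3)[OF M] by simp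
  qed
  have fval: "dP N a (f x) = (if N \<in> E then dM N a (x N) else 0)"
    if x: "x \<in> carrier SG" and E: "finite E" "E \<subseteq> A" "\<And>M. M \<in> A \<Longrightarrow> M \<notin> E \<Longrightarrow> x M = \<one>\<^bsub>GM M\<^esub>"
      and N: "N \<in> Mx" "\<And>M. M \<in> E \<Longrightarrow> M \<noteq> N \<Longrightarrow> N \<in> NN (st M)" and a: "a \<in> D" for x E N a
  proof -
    have "dP N a (f x) = dP N a (finprod ?P (\<lambda>M. s M (x M)) E)" by (rule arg_cong[OF f_eq[OF x E]])
    also have "\<dots> = (\<Sum>M\<in>E. dP N a (s M (x M)))"
      by (rule hom_int_finprod[OF comm_group_PicInt_D dP(1)[OF N(1) a] E(1) sc[OF x subsetD[OF E(2)]]])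
    also have "\<dots> = (\<Sum>M\<in>E. if M = N then dM N a (x N) else 0)"
    proof (rule sum.cong[OF refl])
      fix M assume M: "M \<in> E"
      then have MA: "M \<in> A" using E(2) by blast
      show "dP N a (s M (x M)) = (if M = N then dM N a (x N) else 0)"
      proof (cases "M = N")
        case True
        then show ?thesis using sM[OF MA car[OF x MA] a] by simp
      next
        case False
        then show ?thesis using sN[OF MA car[OF x MA] a N(2)[OF M False]] by simp
      qed
    qed
    also have "\<dots> = (if N \<in> E then dM N a (x N) else 0)" using E(1) by (simp add: sum.delta)
    finally show ?thesis .
  qed
  have inj: "inj_on f (carrier SG)"
  proof -
    interpret f: group_hom SG ?P f using fhom gSG P.is_group by (simp add: group_hom_def group_hom_axioms_def)
    have "x = \<one>\<^bsub>SG\<^esub>" if x: "x \<in> carrier SG" and fx: "f x = \<one>\<^bsub>?P\<^esub>" for x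
    proof (rule ccontr)
      assume n: "x \<noteq> \<one>\<^bsub>SG\<^esub>"
      define E where "E = {M \<in> A. x M \<noteq> \<one>\<^bsub>GM M\<^esub>}"
      have E: "finite E" "E \<subseteq> A" "\<And>M. M \<in> A \<Longrightarrow> M \<notin> E \<Longrightarrow> x M = \<one>\<^bsub>GM M\<^esub>"
        using fin[OF x] by (auto simp: E_def)
      have "E \<noteq> {}"
      proof
        assume "E = {}"
        then have "x M = \<one>\<^bsub>SG\<^esub> M" if "M \<in> A" for M using E(3)[OF that] that by simp
        moreover have "x \<in> extensional A" "\<one>\<^bsub>SG\<^esub> \<in> extensional A"
          using x unfolding carrier_SG by (auto simp: PiE_iff)
        ultimately show False using n extensionalityI[of x A "\<one>\<^bsub>SG\<^esub>"] by blast
      qed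
      then have "Max (st ` E) \<in> st ` E" using E(1) by (intro Max_in) auto
      then obtain M where M: "M \<in> E" "st M = Max (st ` E)" by (metis imageE)
      \<comment> \<open>M belongs to its own stage, the latest one present, hence to the stages of
        all factors; so the value at M isolates its component.\<close>
      then have max: "st L \<le> st M" if "L \<in> E" for L using that E(1) by simp
      have MA: "M \<in> A" using M E by blast
      have "dM M a (x M) = 0" if a: "a \<in> D" for a
      proof -
        have "dP M a (f x) = (if M \<in> E then dM M a (x M) else 0)"
        proof (rule fval[OF x E _ _ a])
          show "M \<in> Mx" using MA by blast
          show "M \<in> NN (st L)" if "L \<in> E" for L using st(2)[OF MA] NN_antimono[OF max[OF that]] by blast
        qed
        moreover have "dP M a \<one>\<^bsub>?P\<^esub> = 0"
          using hom_one[OF dP(1)[OF _ a] P.is_group group_integer_group] MA by simp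
        ultimately show ?thesis using M(1) fx by simp
      qed
      then have "x M = \<one>\<^bsub>GM M\<^esub>" using MA car[OF x MA] by (intro dM_trivial) blast+
      then show False using M(1) by (simp add: E_def)
    qed
    then show ?thesis using f.inj_on_one_iff by blast
  qed
  have ker1: "f ` carrier SG \<subseteq> kernel ?P ?Q gT"
  proof
    fix y assume "y \<in> f ` carrier SG"
    then obtain x where x: "x \<in> carrier SG" "y = f x" by blast
    define E where "E = {M \<in> A. x M \<noteq> \<one>\<^bsub>GM M\<^esub>}"
    have E: "finite E" "E \<subseteq> A" "\<And>M. M \<in> A \<Longrightarrow> M \<notin> E \<Longrightarrow> x M = \<one>\<^bsub>GM M\<^esub>"
      using fin[OF x(1)] by (auto simp: E_def)
    have "gT (f x) = gT (finprod ?P (\<lambda>M. s M (x M)) E)" by (rule arg_cong[OF f_eq[OF x(1) E]])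
    also have "\<dots> = \<one>\<^bsub>?Q\<^esub>"
    proof (rule hom_finprod_one[OF comm_group_PicInt_D Q.is_group gT(1) E(1)])
      fix M assume "M \<in> E"
      then have MA: "M \<in> A" using E(2) by blast
      show "s M (x M) \<in> carrier ?P" by (rule sc[OF x(1) MA])
      show "gT (s M (x M)) = \<one>\<^bsub>?Q\<^esub>" by (rule sg[OF MA car[OF x(1) MA]])
    qed
    finally have "gT (f x) = \<one>\<^bsub>?Q\<^esub>" .
    then show "y \<in> kernel ?P ?Q gT" using x hom_in_carrier[OF fhom x(1)] by (simp add: kernel_def)
  qed
  \<comment> \<open>The induction lowers \<beta>, enlarging the set on which the value functions are
    constant; at stage zero the class is trivial.\<close>
  have stage: "pint D F \<in> f ` carrier SG"
    if "\<beta> \<le> \<alpha>" "F \<in> INV B" "\<forall>M\<in>NN \<beta>. \<forall>a\<in>D. phi M a F = phi M 0 F" for \<beta> F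
    using that
  proof (induction \<beta> arbitrary: F rule: less_induct)
    case (less \<beta>)
    show ?case
    proof (cases \<beta> rule: ordinal_cases)
      case 1
      then have p1: "pint D F = \<one>\<^bsub>?P\<^esub>" using pint_one_phi[OF less.prems(2)] less.prems(3) NN_zero by simp
      have "\<one>\<^bsub>SG\<^esub> \<in> carrier SG" by (rule monoid.one_closed[OF group.is_monoid[OF gSG]])
      then have "f \<one>\<^bsub>SG\<^esub> \<in> f ` carrier SG" by (rule imageI)
      then show ?thesis unfolding p1 hom_one[OF fhom gSG P.is_group] .
    next
      case 3
      obtain W where W: "finite W" "W \<subseteq> TT \<beta>" "\<forall>M\<in>Mx. W \<subseteq> loc M \<longrightarrow> (\<forall>a\<in>D. phi M a F = phi M 0 F)"
        by (rule phi_const_open[OF less.prems(1,2)]) (use less.prems(3) in blast)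
      \<comment> \<open>At a limit the finite set already lies in an earlier ring, so constancy
        holds on an earlier stage without any correction.\<close>
      obtain \<gamma> where g: "\<gamma> < \<beta>" "W \<subseteq> TT \<gamma>" using finite_TT_limit[OF 3 W(1,2)] by blast
      have "\<forall>M\<in>NN \<gamma>. \<forall>a\<in>D. phi M a F = phi M 0 F" using W(3) g(2) TT_loc NN_Mx by blast
      moreover have "\<gamma> \<le> \<alpha>" using g(1) less.prems(1) by simp
      ultimately show ?thesis by (intro less.IH[OF g(1) _ less.prems(2)])
    next
      case (2 \<gamma>)
      have lt: "\<gamma> < \<beta>" "\<gamma> \<le> \<alpha>" using 2 less.prems(1) by (auto simp: is_pred_def)
      obtain W where W: "finite W" "W \<subseteq> TT \<beta>" "\<forall>M\<in>Mx. W \<subseteq> loc M \<longrightarrow> (\<forall>a\<in>D. phi M a F = phi M 0 F)"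
        by (rule phi_const_open[OF less.prems(1,2)]) (use less.prems(3) in blast)
      \<comment> \<open>The members of \<open>NN \<gamma>\<close> at which constancy can fail; there
        are finitely many, so a single element of the direct sum corrects them all.\<close>
      define E where "E = {M \<in> NN \<gamma>. \<not> W \<subseteq> loc M}"
      have finE: "finite E" unfolding E_def by (rule finite_bad[OF 2 W(1,2)])
      have EN: "M \<notin> NN \<beta>" if "M \<in> E" for M using that W(2) TT_loc by (auto simp: E_def)
      have EA: "E \<subseteq> A"
      proof
        fix M assume M: "M \<in> E"
        then have "M \<notin> NN \<alpha>" using EN NN_antimono[OF less.prems(1)] by blast
        then show "M \<in> A" using M NN_Mx by (auto simp: E_def)
      qed
      \<comment> \<open>The correction records the local classes of F at the exceptional
        places.\<close>
      define x where "x = (\<lambda>M\<in>A. if M \<in> E then pcls (loc M) (exts id (intpoly (loc M)) F) else \<one>\<^bsub>GM M\<^esub>)"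
      have extM: "exts id (intpoly (loc M)) F \<in> INV (intpoly (loc M))" if "M \<in> Mx" for M
      proof -
        have "exts id (intpoly (loc M)) \<in> hom (invg B) (invg (intpoly (loc M)))"
          using intpoly_D_loc[OF that] sring_intpoly[OF sring_loc[OF that]] by (intro exts_hom sring_B) auto
        from hom_in_carrier[OF this, of F] show ?thesis using less.prems(2) by simp
      qed
      have x1: "x M = \<one>\<^bsub>GM M\<^esub>" if "M \<in> A" "M \<notin> E" for M using that by (simp add: x_def)
      have xE: "x M = pcls (loc M) (exts id (intpoly (loc M)) F)" if "M \<in> E" for M
        using that EA by (auto simp: x_def)
      have xc: "x M \<in> carrier (GM M)" if M: "M \<in> A" for M
      proof (cases "M \<in> E")
        case True
        have "M \<in> Mx" using M by blast
        then show ?thesis unfolding xE[OF True] using pcls_surj[OF sring_loc] extM by blast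
      next
        case False
        then show ?thesis unfolding x1[OF M False] using group.is_monoid[OF group_GM[OF M]] by (rule_tac monoid.one_closed)
      qed
      have x: "x \<in> carrier SG"
      proof -
        have "{M \<in> A. x M \<noteq> \<one>\<^bsub>GM M\<^esub>} \<subseteq> E" using x1 by blast
        then have "finite {M \<in> A. x M \<noteq> \<one>\<^bsub>GM M\<^esub>}" using finE finite_subset by blast
        moreover have "x \<in> (\<Pi>\<^sub>E i\<in>A. carrier (GM i))" using xc by (auto simp: PiE_iff x_def)
        ultimately show ?thesis unfolding carrier_SG by blast
      qed
      \<comment> \<open>The exceptional places are gone at \<beta>, so their stages contain
        \<open>NN \<gamma>\<close>, as the evaluation of f there requires.\<close>
      have stE: "st M \<le> \<gamma>" if M: "M \<in> E" for M
      proof (rule is_pred_le[OF 2])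
        show "st M < \<beta>"
        proof (rule ccontr)
          assume "\<not> st M < \<beta>"
          then have "\<beta> \<le> st M" by simp
          then have "M \<in> NN \<beta>" using st(2)[of M] EA M NN_antimono[of \<beta> "st M"] by blast
          then show False using EN[OF M] by blast
        qed
      qed
      have val: "dP N a (f x) = dP N a (pint D F)" if N: "N \<in> NN \<gamma>" and a: "a \<in> D" for N a
      proof -
        have NM: "N \<in> Mx" by (rule NN_Mx[OF N])
        have 1: "dP N a (f x) = (if N \<in> E then dM N a (x N) else 0)"
          by (rule fval[OF x finE EA x1 NM subsetD[OF NN_antimono[OF stE] N] a])
        show ?thesis
        proof (cases "N \<in> E")
          case True
          have "dM N a (x N) = phi N a F - phi N 0 F"
            unfolding xE[OF True] dM(2)[OF NM a extM[OF NM]]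
            using phi_ext[OF integral_at_loc[OF NM] a, of F] phi_ext[OF integral_at_loc[OF NM] D_closed(1), of F] by simp
          then show ?thesis using 1 True dP(2)[OF NM a less.prems(2)] by simp
        next
          case False
          then have "W \<subseteq> loc N" using N by (auto simp: E_def)
          then have "phi N a F = phi N 0 F" using W(3) NM a by blast
          then show ?thesis using 1 False dP(2)[OF NM a less.prems(2)] by simp
        qed
      qed
      have fc: "f x \<in> carrier ?P" by (rule hom_in_carrier[OF fhom x])
      have pc: "pint D F \<in> carrier ?P" by (rule pint_carrier[OF less.prems(2)])
      \<comment> \<open>Divided by the correction, the class has constant value functions on all of
        \<open>NN \<gamma>\<close>, where the induction hypothesis applies.\<close>
      define y where "y = pint D F \<otimes>\<^bsub>?P\<^esub> inv\<^bsub>?P\<^esub> f x"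
      have yc: "y \<in> carrier ?P" using fc pc by (simp add: y_def)
      then obtain G where G: "G \<in> INV B" "y = pint D G" using pint_surj[OF sring_D] by blast
      have "phi N a G = phi N 0 G" if N: "N \<in> NN \<gamma>" and a: "a \<in> D" for N a
      proof -
        have NM: "N \<in> Mx" by (rule NN_Mx[OF N])
        interpret d: group_hom ?P integer_group "dP N a"
          using dP(1)[OF NM a] P.is_group by (simp add: group_hom_def group_hom_axioms_def)
        have "dP N a y = dP N a (pint D F) - dP N a (f x)"
          unfolding y_def using d.hom_mult[of "pint D F" "inv\<^bsub>?P\<^esub> f x"] d.hom_inv[OF fc] fc pc by simp
        then show ?thesis using val[OF N a] dP(2)[OF NM a G(1)] G(2) by simp
      qed
      then have "pint D G \<in> f ` carrier SG" using less.IH[OF lt(1,2) G(1)] by blast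
      then obtain w where w: "w \<in> carrier SG" "y = f w" using G(2) by blast
      have "pint D F = y \<otimes>\<^bsub>?P\<^esub> f x" using fc pc by (simp add: y_def P.m_assoc)
      also have "\<dots> = f (w \<otimes>\<^bsub>SG\<^esub> x)" using hom_mult[OF fhom w(1) x] w(2) by simp
      finally show ?thesis using monoid.m_closed[OF group.is_monoid[OF gSG] w(1) x] by blast
    qed
  qed
  have ker2: "kernel ?P ?Q gT \<subseteq> f ` carrier SG"
  proof
    fix y assume y: "y \<in> kernel ?P ?Q gT"
    then have "y \<in> carrier ?P" "gT y = \<one>\<^bsub>?Q\<^esub>" by (simp_all add: kernel_def)
    then obtain F where F: "F \<in> INV B" "y = pint D F" using pint_surj[OF sring_D] by blast
    then have "pint (TT \<alpha>) (exts id TI F) = \<one>\<^bsub>?Q\<^esub>" using gT(2)[OF F(1)] \<open>gT y = _\<close> by simp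
    then obtain J where J: "exts id TI F = cext (TT \<alpha>) J"
      using pint_one_iff[OF sring_TT extT_INV[OF F(1)]] by blast
    \<comment> \<open>Extending F to Int(T_\<alpha>) keeps its values on \<open>NN \<alpha>\<close>,
      and an ideal extended from T_\<alpha> has constant ones.\<close>
    have "phi M a F = phi M 0 F" if M: "M \<in> NN \<alpha>" "a \<in> D" for M a
    proof -
      have "phi M a F = phi M a (cext (TT \<alpha>) J)" "phi M 0 F = phi M 0 (cext (TT \<alpha>) J)"
        using phi_ext[OF integral_at_TT[OF M(1)] M(2), of F] phi_ext[OF integral_at_TT[OF M(1)] D_closed(1), of F] J by simp_all
      then show ?thesis
        using phi_cext[OF sring_TT integral_at_TT[OF M(1)] M(2)] phi_cext[OF sring_TT integral_at_TT[OF M(1)] D_closed(1)] by simp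
    qed
    then show "y \<in> f ` carrier SG" using stage[OF order_refl F(1)] F(2) by blast
  qed
  show ?thesis
    by (rule exI[of _ f], rule exI[of _ gT])
      (intro conjI gSG P.is_group Q.is_group fhom inj gT(1) gT_surj subset_antisym ker1 ker2)
qed

end

theorem theorem7p5:
  fixes D :: "'a::field set" and \<alpha> :: "'o::wellorder"
  assumes "almost_dedekind D"
    and "\<forall>M\<in>max_ideals D.
           localization D M \<notin> derived (localization D ` max_ideals D) \<alpha> \<longrightarrow>
           intpoly_ext D (localization D M) = intpoly (localization D M)"
    and "intpoly_ext D (derived_ring (localization D ` max_ideals D) \<alpha>)
           = intpoly (derived_ring (localization D ` max_ideals D) \<alpha>)"
  shows "\<exists>f g.
    Group.group (sum_group {M \<in> max_ideals D. localization D M \<notin> derived (localization D ` max_ideals D) \<alpha>}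
                   (\<lambda>M. Pic (IntK (localization D M)))) \<and>
    Group.group (PicInt D) \<and>
    Group.group (PicInt (derived_ring (localization D ` max_ideals D) \<alpha>)) \<and>
    f \<in> hom (sum_group {M \<in> max_ideals D. localization D M \<notin> derived (localization D ` max_ideals D) \<alpha>}
                   (\<lambda>M. Pic (IntK (localization D M)))) (PicInt D) \<and>
    inj_on f (carrier (sum_group {M \<in> max_ideals D. localization D M \<notin> derived (localization D ` max_ideals D) \<alpha>}
                   (\<lambda>M. Pic (IntK (localization D M))))) \<and>
    g \<in> hom (PicInt D) (PicInt (derived_ring (localization D ` max_ideals D) \<alpha>)) \<and>
    g ` carrier (PicInt D) = carrier (PicInt (derived_ring (localization D ` max_ideals D) \<alpha>)) \<and>
    f ` carrier (sum_group {M \<in> max_ideals D. localization D M \<notin> derived (localization D ` max_ideals D) \<alpha>}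
                   (\<lambda>M. Pic (IntK (localization D M))))
      = kernel (PicInt D) (PicInt (derived_ring (localization D ` max_ideals D) \<alpha>)) g"
proof -
  interpret almost_dedekind_domain D using assms(1) by unfold_locales
  interpret derived_stages D \<alpha> by unfold_locales
  have notin: "M \<notin> NN \<alpha> \<longleftrightarrow> localization D M \<notin> derived (localization D ` max_ideals D) \<alpha>" if "M \<in> max_ideals D" for M
    using that by (simp add: NN_def)
  interpret int_compatible D \<alpha>
    using assms(2,3) notin by unfold_locales (auto simp: TT_def)
  have A: "A = {M \<in> max_ideals D. localization D M \<notin> derived (localization D ` max_ideals D) \<alpha>}"
    using notin by blast
  show ?thesis using exact_sequence unfolding A TT_def .
qed

end
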